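(* There is a constant $C>0$ such that the following holds. Let $n\ge1$ be an integer and $\delta>0$. If $m$ is a positive integer with $m\ge C\delta^{-2}n^2\log(\delta^{-1}n)$ and $\mathcal{P}=\{P_j\}_{j=1}^m$ is an independent sequence of uniformly distributed projections in $\mathrm{Proj}_{\mathbb{F}}(n,2n)$, then with probability at least $1-\exp(-n)$ $$\|\hat X-X\|<\delta\quad\text{for all }X\in\mathrm{Proj}_{\mathbb{F}}(1,2n)$$ (simultaneously), where $\hat X$ is the solution to the Principal Eigenspace Program (PEP) with input $\Phi_{\mathcal{P}}(X)$.
   Context: $\mathbb{F}$ is either $\mathbb{R}$ or $\mathbb{C}$. $\mathrm{Proj}_{\mathbb{F}}(k,d)$ is the set of rank-$k$ orthogonal projections on $\mathbb{F}^d$; its uniform distribution is the unique probability measure invariant under conjugation by all orthogonal ($\mathbb{F}=\mathbb{R}$) or unitary ($\mathbb{F}=\mathbb{C}$) $d\times d$ matrices. $\|\cdot\|$ on matrices is the operator norm. For $P\in\mathrm{Proj}_{\mathbb{F}}(n,2n)$ and $X\in\mathrm{Proj}_{\mathbb{F}}(1,2n)$, $\phi_P(X)=1$ if $\mathrm{tr}(PX)\ge\frac12$ and $\phi_P(X)=0$ otherwise. For $\mathcal{P}=\{P_j\}_{j=1}^m$, the binary measurement map is $\Phi_{\mathcal{P}}(X)=(\phi_{P_j}(X))_{j=1}^m\in\{0,1\}^m$. (PEP) with input $b\in\{0,1\}^m$: put $Q_b=\frac1m\sum_{j=1}^m R_j$, where $R_j=P_j$ if $b_j=1$ and $R_j=I-P_j$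 if $b_j=0$, and maximize $\mathrm{tr}(Q_bY)$ over positive semidefinite $Y\in\mathbb{F}^{2n\times 2n}$ with $\mathrm{tr}(Y)\le1$. The solution is taken to be a rank-one orthogonal projection onto a line in the eigenspace of the largest eigenvalue of $Q_b$; when that eigenvalue is simple (which happens with probability 1 in this random model) it is the unique solution, namely the orthogonal projection onto that eigenspace. *)

theory Defs
  imports "HOL-Probability.Probability" "Jordan_Normal_Form.DL_Rank"
    "Jordan_Normal_Form.Schur_Decomposition"
begin

text \<open>
  The dimension has to be quantified inside the formulas, so vectors and matrices have their
  dimension in the carrier.  The class constraint below has both \<^typ>\<open>real\<close> and \<^typ>\<open>complex\<close> as
  instances.  On \<^typ>\<open>real\<close>, \<^const>\<open>conjugate\<close> is the identity, so that \<^const>\<open>mat_adjoint\<close> is the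
  transpose and unitary means orthogonal.  On \<^typ>\<open>complex\<close>, \<open>x \<le> y\<close> means \<open>Re x \<le> Re y\<close> and
  \<open>Im x = Im y\<close>; it is only used below to compare numbers that are real (traces of products
  of Hermitian matrices, values of Hermitian forms, eigenvalues of Hermitian matrices).
\<close>

definition mat_trace :: "'a::comm_monoid_add mat \<Rightarrow> 'a" where
  "mat_trace A = (\<Sum>i<dim_row A. A $$ (i, i))"

definition vec_l2_norm :: "'a::real_normed_field vec \<Rightarrow> real" where
  "vec_l2_norm v = L2_set (\<lambda>i. norm (v $ i)) {..<dim_vec v}"

definition op_norm :: "'a::real_normed_field mat \<Rightarrow> real" where
  "op_norm A = (SUP v\<in>{v \<in> carrier_vec (dim_col A). vec_l2_norm v \<le> 1}. vec_l2_norm (A *\<^sub>v v))"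

definition unitary_mats :: "nat \<Rightarrow> 'a::conjugatable_field mat set" where
  "unitary_mats d =
    {U \<in> carrier_mat d d. mat_adjoint U * U = 1\<^sub>m d \<and> U * mat_adjoint U = 1\<^sub>m d}"

definition psd :: "nat \<Rightarrow> 'a::conjugatable_ordered_field mat \<Rightarrow> bool" where
  "psd d Y \<longleftrightarrow> Y \<in> carrier_mat d d \<and> mat_adjoint Y = Y \<and>
    (\<forall>v \<in> carrier_vec d. 0 \<le> (Y *\<^sub>v v) \<bullet>c v)"

definition Proj :: "nat \<Rightarrow> nat \<Rightarrow> 'a::conjugatable_field mat set" where
  "Proj k d = {P \<in> carrier_mat d d. P * P = P \<and> mat_adjoint P = P \<and> vec_space.rank d P = k}"

text \<open>
  The measurable space of projections: \<^term>\<open>Proj k d\<close> with the restriction of the Borel sigma-algebra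
  of the space of \<open>d \<times> d\<close> arrays of scalars.
\<close>

definition Proj_borel :: "nat \<Rightarrow> nat \<Rightarrow> 'a::{conjugatable_field, real_normed_field} mat measure" where
  "Proj_borel k d = vimage_algebra (Proj k d)
    (\<lambda>P. \<lambda>ij \<in> {..<d} \<times> {..<d}. P $$ ij) (\<Pi>\<^sub>M ij \<in> {..<d} \<times> {..<d}. borel)"

definition uniform_Proj ::
    "nat \<Rightarrow> nat \<Rightarrow> 'a::{conjugatable_field, real_normed_field} mat measure \<Rightarrow> bool" where
  "uniform_Proj k d \<mu> \<longleftrightarrow> prob_space \<mu> \<and> sets \<mu> = sets (Proj_borel k d) \<and>
    (\<forall>U \<in> unitary_mats d. distr \<mu> \<mu> (\<lambda>P. U * P * mat_adjoint U) = \<mu>)"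

definition phi :: "'a::conjugatable_ordered_field mat \<Rightarrow> 'a mat \<Rightarrow> nat" where
  "phi P X = (if 1 / 2 \<le> mat_trace (P * X) then 1 else 0)"

definition Phi ::
    "nat \<Rightarrow> (nat \<Rightarrow> 'a::conjugatable_ordered_field mat) \<Rightarrow> 'a mat \<Rightarrow> nat \<Rightarrow> nat" where
  "Phi m P X = (\<lambda>j \<in> {..<m}. phi (P j) X)"

definition pep_matrix ::
    "nat \<Rightarrow> nat \<Rightarrow> (nat \<Rightarrow> 'a::field mat) \<Rightarrow> (nat \<Rightarrow> nat) \<Rightarrow> 'a mat" where
  "pep_matrix d m P b = mat d d (\<lambda>ik.
    (1 / of_nat m) * (\<Sum>j<m. (if b j = 1 then P j else 1\<^sub>m d - P j) $$ ik))"

definition pep_feasible :: "nat \<Rightarrow> 'a::conjugatable_ordered_field mat \<Rightarrow> bool" where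
  "pep_feasible d Y \<longleftrightarrow> psd d Y \<and> mat_trace Y \<le> 1"

definition pep_maximizer ::
    "nat \<Rightarrow> 'a::conjugatable_ordered_field mat \<Rightarrow> 'a mat \<Rightarrow> bool" where
  "pep_maximizer d Q Y \<longleftrightarrow> pep_feasible d Y \<and>
    (\<forall>Z. pep_feasible d Z \<longrightarrow> mat_trace (Q * Z) \<le> mat_trace (Q * Y))"

definition largest_eigenvalue :: "'a::conjugatable_ordered_field mat \<Rightarrow> 'a \<Rightarrow> bool" where
  "largest_eigenvalue Q l \<longleftrightarrow> eigenvalue Q l \<and> (\<forall>l'. eigenvalue Q l' \<longrightarrow> l' \<le> l)"

text \<open>
  The last conjunct says that the range of \<open>Y\<close> lies in the eigenspace of the largest eigenvalue.
  If that eigenvalue is not simple, every rank-one projection onto a line in its eigenspace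
  counts as a solution.
\<close>

definition pep_solution ::
    "nat \<Rightarrow> nat \<Rightarrow> (nat \<Rightarrow> 'a::conjugatable_ordered_field mat) \<Rightarrow> (nat \<Rightarrow> nat) \<Rightarrow> 'a mat \<Rightarrow> bool"
  where
  "pep_solution d m P b Y \<longleftrightarrow>
    (let Q = pep_matrix d m P b in
      pep_maximizer d Q Y \<and> Y \<in> Proj 1 d \<and>
      (\<exists>l. largest_eigenvalue Q l \<and>
        (\<forall>v \<in> carrier_vec d. Q *\<^sub>v (Y *\<^sub>v v) = l \<cdot>\<^sub>v (Y *\<^sub>v v))))"

end

theory Submission
  imports Defs
begin

text \<open>
  Attach to each projection \<open>P\<close> the reflection \<open>S = 2 * P - 1\<close>, which has trace zero, and write
  \<open>q x\<close> for its quadratic form at a unit vector \<open>x\<close> (\<open>q\<close>, \<open>refl_form\<close>). The answer of \<open>P\<close> on the line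
  through \<open>x\<close> is the sign of \<open>q x\<close>, and the program maximizes, over unit vectors \<open>y\<close>, the sum over \<open>j\<close>
  of \<open>sgn (q\<^sub>j x) * q\<^sub>j y\<close>, up to an affine change. So a solution \<open>y\<close> satisfies
  \<open>\<Sum>j. sgn (q\<^sub>j x) * (q\<^sub>j x - q\<^sub>j y) \<le> 0\<close> (\<open>pep_solution_gain\<close>). The distance of the two lines is
  at most the square root of \<open>1 - \<bar>\<langle>x, y\<rangle>\<bar>\<^sup>2\<close> (\<open>op_norm_line_diff\<close>). It therefore suffices that with high
  probability this sum, the gain of \<open>x\<close> over \<open>y\<close>, is positive for all \<open>x\<close> and \<open>y\<close> for which that
  root is at least \<open>\<delta>\<close> (\<open>uniform_gain_event\<close>).

  \<^bold>\<open>Mean.\<close> By invariance under the stabilizer of \<open>x\<close>, the mean of \<open>sgn (q x) * S\<close> is diagonal in any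
  orthonormal basis that starts with \<open>x\<close>, with equal entries except for the first one. As its trace is
  zero, the mean gain in one measurement is at least \<open>1 - \<bar>\<langle>x, y\<rangle>\<bar>\<^sup>2\<close> times the mean of \<open>\<bar>q x\<bar>\<close>
  (\<open>sgn_gap\<close>).

  \<^bold>\<open>Size of q.\<close> The mean of \<open>\<bar>q x\<bar>\<close> is of order \<open>1 / sqrt n\<close>, and \<open>\<bar>q x\<bar> \<le> \<epsilon>\<close> has probability at most
  \<open>12 * n * \<epsilon>\<close> (\<open>mean_abs_ge\<close>, \<open>anticoncentration\<close>). Since the law of \<open>q x\<close> is the same for all unit vectors, the second derivative of the mean of \<open>\<phi> (q x)\<close> along a rotation of
  \<open>x\<close> vanishes. Summing over all directions yields a Stein identity (\<open>Stein_identity\<close>), and both bounds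
  come from choosing \<open>\<phi>\<close> as a smooth version of the absolute value.

  \<^bold>\<open>Fluctuation.\<close> For a fixed pair at distance \<open>\<rho>\<close> the gains of the single measurements are
  bounded by a multiple of \<open>\<rho>\<close>, so by Hoeffding's inequality the probability of a nonpositive sum decays
  like \<open>exp (- c * m * \<rho>\<^sup>2 / n)\<close> (\<open>robust_gain_tail\<close>). Pairs from a net whose mesh is polynomial in
  \<open>\<delta> / n\<close> number \<open>exp (O (n * ln (n / \<delta>)))\<close>; this is where the required size
  \<open>n\<^sup>2 * \<delta>\<^sup>-\<^sup>2 * ln (n / \<delta>)\<close> of \<open>m\<close> comes from. The answers are discontinuous in \<open>x\<close>, but near a net point
  they can change only if \<open>\<bar>q\<bar>\<close> is tiny there, which is rare; the quantity controlled on the net is the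
  gain with a penalty in this event (\<open>robust_gain\<close>).

  The logarithm can be arbitrarily small when \<open>n = 1\<close> and \<open>\<delta>\<close> is near \<open>1\<close>. Then \<open>\<delta>\<^sup>2\<close> exceeds \<open>1 / 2\<close>,
  and plane geometry applies: the line of the positive eigenvalue of a nonzero trace-free
  Hermitian matrix of size two has squared overlap at least \<open>1 / 2\<close> with every line on which the form is nonnegative
  (\<open>planar_overlap\<close>), and the matrix is almost surely nonzero (\<open>planar_nondegenerate\<close>).
\<close>

section \<open>Scalars: the real and the complex numbers\<close>

text \<open>
The proof never distinguishes the two scalar fields, so it is carried out once, for this class.
The parameter \<open>rot\<close> is \<open>1\<close> over the reals and \<open>\<i>\<close> over the complex numbers, so that the real parts of \<open>x\<close> and of \<open>rot * x\<close> together see the whole size of \<open>x\<close>. Over the reals the last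
axiom has room to spare (a factor \<open>2\<close>), which only affects constants.
\<close>

class rc_field = conjugatable_ordered_field + real_normed_field + second_countable_topology +
  fixes re :: "'a \<Rightarrow> real" and rot :: "'a"
  assumes mult_conjugate_scaleR: "x * conjugate x = (norm x)\<^sup>2 *\<^sub>R 1"
    and add_conjugate_scaleR: "x + conjugate x = (2 * re x) *\<^sub>R 1"
    and scaleR_one_le_iff: "a *\<^sub>R 1 \<le> b *\<^sub>R 1 \<longleftrightarrow> a \<le> b"
    and norm_rot: "norm rot = 1"
    and norm_le_re_rot: "(norm x)\<^sup>2 \<le> (re x)\<^sup>2 + (re (rot * x))\<^sup>2"

lemma mult_conjugate: "x * conjugate x = (of_real ((norm x)\<^sup>2) :: 'a::rc_field)"
  and add_conjugate: "x + conjugate x = (of_real (2 * re x) :: 'a)"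
  and of_real_le_iff': "(of_real a :: 'a) \<le> of_real b \<longleftrightarrow> a \<le> b"
  by (simp_all only: of_real_def mult_conjugate_scaleR add_conjugate_scaleR scaleR_one_le_iff)

instantiation real :: rc_field
begin
definition "re (x::real) = x"
definition "rot = (1::real)"
instance by standard (auto simp: re_real_def rot_real_def power2_eq_square)
end

instantiation complex :: rc_field
begin
definition "re (x::complex) = Re x"
definition "rot = \<i>"
instance
proof
  show "a *\<^sub>R 1 \<le> (b *\<^sub>R 1 :: complex) \<longleftrightarrow> a \<le> b" for a b
    by (simp add: less_eq_complex_def)
  show "x * conjugate x = (norm x)\<^sup>2 *\<^sub>R 1" for x :: complex
    by (simp add: complex_eq_iff cmod_power2 power2_eq_square[of "Re _"] power2_eq_square[of "Im _"])
  show "x + conjugate x = (2 * re x) *\<^sub>R 1" for x :: complex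
    by (simp add: complex_eq_iff re_complex_def)
qed (auto simp: re_complex_def rot_complex_def cmod_power2)
end

abbreviation cj :: "'a::conjugate \<Rightarrow> 'a" where "cj \<equiv> conjugate"

lemma cj_of_real [simp]: "cj (of_real r) = (of_real r :: 'a::rc_field)"
proof (cases "r = 0")
  case False
  have "of_real r * cj (of_real r) = (of_real r * of_real r :: 'a)"
    using mult_conjugate[of "of_real r :: 'a"] by (simp add: power2_eq_square flip: of_real_mult)
  then show ?thesis using False by simp
qed simp

lemma cj_simps [simp]:
  fixes x y :: "'a::rc_field"
  shows "cj 1 = (1::'a)" "cj (x + y) = cj x + cj y" "cj (x * y) = cj x * cj y" "cj (- x) = - cj x"
    "cj (x - y) = cj x - cj y"
proof -
  show "cj 1 = (1::'a)" using cj_of_real[of 1, where 'a='a] by simp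
  show "cj (x + y) = cj x + cj y" "cj (x * y) = cj x * cj y" "cj (- x) = - cj x"
    by (simp_all add: conjugate_dist_add conjugate_dist_mul conjugate_neg)
  show "cj (x - y) = cj x - cj y"
    using conjugate_dist_add[of x "-y"] by (simp add: conjugate_neg)
qed

lemma cj_sum: "cj (\<Sum>i\<in>A. f i) = (\<Sum>i\<in>A. cj (f i :: 'a::rc_field))"
  by (induction A rule: infinite_finite_induct) auto

lemma cj_numeral [simp]: "cj (numeral k) = (numeral k :: 'a::rc_field)"
  using cj_of_real[of "numeral k", where 'a='a] by simp

lemma norm_cj [simp]: "norm (cj x) = norm (x::'a::rc_field)"
proof -
  have "(of_real ((norm (cj x))\<^sup>2) :: 'a) = of_real ((norm x)\<^sup>2)"
    using mult_conjugate[of x] mult_conjugate[of "cj x"] by (simp add: mult.commute)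
  then show ?thesis by (simp only: of_real_eq_iff) simp
qed

lemma cj_divide [simp]: "cj (x / y) = cj x / cj (y::'a::rc_field)"
proof (cases "y = 0")
  case False
  have "cj (x / y) * cj y = cj x" using False by (simp flip: cj_simps(3))
  then show ?thesis using False by (simp add: field_simps)
qed simp

lemma re_of_real [simp]: "re (of_real r :: 'a::rc_field) = r"
  using add_conjugate[of "of_real r :: 'a"] by (simp add: field_simps flip: of_real_add of_real_mult)

lemma re_eqI: "x + cj x = of_real (2 * r) \<Longrightarrow> re (x::'a::rc_field) = r"
  using add_conjugate[of x] by (metis of_real_eq_iff mult_cancel_left zero_neq_numeral)

lemma re_add [simp]: "re (x + y) = re x + re (y::'a::rc_field)"
proof (rule re_eqI)
  have "x + y + cj (x + y) = (x + cj x) + (y + cj y)" by simp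
  also have "\<dots> = of_real (2 * re x) + of_real (2 * re y)" by (simp only: add_conjugate)
  finally show "x + y + cj (x + y) = of_real (2 * (re x + re y))" by (simp add: algebra_simps)
qed

lemma re_mult_of_real [simp]: "re (of_real r * x) = r * re (x::'a::rc_field)"
proof (rule re_eqI)
  have "of_real r * x + cj (of_real r * x) = of_real r * (x + cj x)" by (simp add: algebra_simps)
  also have "\<dots> = of_real r * of_real (2 * re x)" by (simp only: add_conjugate)
  finally show "of_real r * x + cj (of_real r * x) = of_real (2 * (r * re x))"
    by (simp add: algebra_simps)
qed

lemma re_zero [simp]: "re (0::'a::rc_field) = 0"
  using re_of_real[of 0, where 'a='a] by simp

lemma re_one [simp]: "re (1::'a::rc_field) = 1"
  using re_of_real[of 1, where 'a='a] by simp

lemma re_uminus [simp]: "re (- x) = - re (x::'a::rc_field)"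
  using re_mult_of_real[of "-1" x] by simp

lemma re_diff [simp]: "re (x - y) = re x - re (y::'a::rc_field)"
  using re_add[of x "-y"] by simp

lemma re_sum: "re (\<Sum>i\<in>A. f i) = (\<Sum>i\<in>A. re (f i :: 'a::rc_field))"
  by (induction A rule: infinite_finite_induct) auto

lemma re_cj [simp]: "re (cj x) = re (x::'a::rc_field)"
  using add_conjugate[of x] by (intro re_eqI) (simp add: add.commute)

lemma abs_re_le: "\<bar>re x\<bar> \<le> norm (x::'a::rc_field)"
proof -
  have "norm (x + cj x) = 2 * \<bar>re x\<bar>" by (simp only: add_conjugate norm_of_real abs_mult abs_numeral)
  then show ?thesis using norm_triangle_ineq[of x "cj x"] by simp
qed

lemma of_real_re: "cj x = x \<Longrightarrow> of_real (re x) = (x::'a::rc_field)"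
  using add_conjugate[of x] by (simp add: field_simps flip: mult_2)

lemma re_mult_cj: "re (x * cj x) = (norm (x::'a::rc_field))\<^sup>2"
  by (simp only: mult_conjugate re_of_real)

lemma norm_add_sq: "(norm (x + y))\<^sup>2 = (norm x)\<^sup>2 + (norm y)\<^sup>2 + 2 * re (x * cj (y::'a::rc_field))"
proof -
  have "(norm (x + y))\<^sup>2 = re ((x + y) * cj (x + y))" by (simp only: re_mult_cj)
  also have "\<dots> = re (x * cj x) + re (y * cj y) + re (x * cj y) + re (y * cj x)"
    by (simp add: algebra_simps)
  also have "re (y * cj x) = re (cj (x * cj y))" by (simp add: mult.commute)
  also have "\<dots> = re (x * cj y)" by (simp only: re_cj)
  finally show ?thesis by (simp add: re_mult_cj)
qed

lemma continuous_on_re: "continuous_on UNIV (re :: 'a::rc_field \<Rightarrow> real)"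
proof (rule continuous_onI)
  fix x :: 'a and e :: real assume "e > 0"
  then show "\<exists>d>0. \<forall>x'\<in>UNIV. dist x' x < d \<longrightarrow> dist (re x') (re x) \<le> e"
    by (intro exI[of _ e]) (auto simp: dist_norm simp flip: re_diff intro: order_trans[OF abs_re_le])
qed

lemma measurable_re [measurable]: "re \<in> borel_measurable (borel :: 'a::rc_field measure)"
  using continuous_on_re by (rule borel_measurable_continuous_onI)

text \<open>
A line determines a unit vector only up to a phase; this lemma chooses the phase so that an
inner product becomes real.
\<close>

lemma phase_exists: "\<exists>u. norm u = 1 \<and> u * z = of_real (norm (z::'a::rc_field))"
proof (cases "z = 0")
  case False
  have "cj z / of_real (norm z) * z = of_real (norm z)"
    using False mult_conjugate[of z] by (simp add: field_simps power2_eq_square)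
  moreover have "norm (cj z / of_real (norm z)) = 1" using False by (simp add: norm_divide)
  ultimately show ?thesis by blast
qed (auto intro!: exI[of _ 1])

section \<open>Coordinate vectors\<close>

text \<open>
Vectors of dimension \<open>d\<close> are functions of which only the values below \<open>d\<close> count. Inner products and
forms are then plain double sums, and no dimension side conditions have to be carried along.
\<close>

definition ip :: "nat \<Rightarrow> (nat \<Rightarrow> 'a::rc_field) \<Rightarrow> (nat \<Rightarrow> 'a) \<Rightarrow> 'a" where
  "ip d x y = (\<Sum>i<d. x i * cj (y i))"

definition nrm :: "nat \<Rightarrow> (nat \<Rightarrow> 'a::rc_field) \<Rightarrow> real" where
  "nrm d x = sqrt (\<Sum>i<d. (norm (x i))\<^sup>2)"

definition usphere :: "nat \<Rightarrow> (nat \<Rightarrow> 'a::rc_field) set" where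
  "usphere d = {x. nrm d x = 1}"

lemma nrm_sq: "(nrm d x)\<^sup>2 = (\<Sum>i<d. (norm (x i))\<^sup>2)"
  by (simp add: nrm_def sum_nonneg)

lemma nrm_nonneg [simp]: "0 \<le> nrm d x" by (simp add: nrm_def sum_nonneg)

lemma ip_self: "ip d x x = of_real ((nrm d x)\<^sup>2)"
  by (simp only: ip_def nrm_sq mult_conjugate of_real_sum)

lemma ip_add_left: "ip d (\<lambda>i. x i + y i) z = ip d x z + ip d y z"
  by (simp add: ip_def algebra_simps sum.distrib)
lemma ip_add_right: "ip d z (\<lambda>i. x i + y i) = ip d z x + ip d z y"
  by (simp add: ip_def algebra_simps sum.distrib)
lemma ip_diff_left: "ip d (\<lambda>i. x i - y i) z = ip d x z - ip d y z"
  by (simp add: ip_def algebra_simps sum_subtractf)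
lemma ip_diff_right: "ip d z (\<lambda>i. x i - y i) = ip d z x - ip d z y"
  by (simp add: ip_def algebra_simps sum_subtractf)
lemma ip_scale_left: "ip d (\<lambda>i. c * x i) z = c * ip d x z"
  by (simp add: ip_def algebra_simps sum_distrib_left)
lemma ip_scale_right: "ip d z (\<lambda>i. c * x i) = cj c * ip d z x"
  by (simp add: ip_def algebra_simps sum_distrib_left)
lemma ip_commute: "cj (ip d x y) = ip d y x"
  by (simp add: ip_def cj_sum mult.commute)

lemmas ip_linear = ip_add_left ip_add_right ip_diff_left ip_diff_right ip_scale_left ip_scale_right

lemma Cauchy_Schwarz: "norm (ip d x y) \<le> nrm d x * nrm d y"
proof -
  have "norm (ip d x y) \<le> (\<Sum>i<d. \<bar>norm (x i)\<bar> * \<bar>norm (y i)\<bar>)"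
    unfolding ip_def by (rule order_trans[OF norm_sum]) (simp add: norm_mult)
  also have "\<dots> \<le> L2_set (\<lambda>i. norm (x i)) {..<d} * L2_set (\<lambda>i. norm (y i)) {..<d}"
    by (rule L2_set_mult_ineq)
  finally show ?thesis by (simp add: nrm_def L2_set_def)
qed

lemma nrm_triangle: "nrm d (\<lambda>i. x i + y i) \<le> nrm d x + nrm d y"
proof -
  have "nrm d (\<lambda>i. x i + y i) \<le> L2_set (\<lambda>i. norm (x i) + norm (y i)) {..<d}"
    unfolding nrm_def L2_set_def
    by (intro real_sqrt_le_mono sum_mono power_mono norm_triangle_ineq) auto
  also have "\<dots> \<le> nrm d x + nrm d y"
    using L2_set_triangle_ineq by (simp add: nrm_def L2_set_def)
  finally show ?thesis .
qed

lemma nrm_scale: "nrm d (\<lambda>i. c * x i) = norm c * nrm d x"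
  by (simp add: nrm_def norm_mult power_mult_distrib real_sqrt_mult flip: sum_distrib_left)

lemma nrm_add_sq:
  "(nrm d (\<lambda>i. x i + y i))\<^sup>2 = (nrm d x)\<^sup>2 + (nrm d y)\<^sup>2 + 2 * re (ip d x y)"
  by (simp add: nrm_sq norm_add_sq sum.distrib ip_def re_sum sum_distrib_left)

lemma nrm_diff_sq:
  "(nrm d (\<lambda>i. x i - y i))\<^sup>2 = (nrm d x)\<^sup>2 + (nrm d y)\<^sup>2 - 2 * re (ip d x y)"
  using nrm_add_sq[of d x "\<lambda>i. - 1 * y i"] nrm_scale[of d "- 1" y]
  by (simp add: ip_scale_right[of d x "- 1" y, simplified])

lemma nrm_eq_0_iff: "nrm d x = 0 \<longleftrightarrow> (\<forall>i<d. x i = 0)"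
  by (auto simp: nrm_def sum_nonneg_eq_0_iff)

lemma usphereD: "x \<in> usphere d \<Longrightarrow> nrm d x = 1"
  by (simp add: usphere_def)

section \<open>Orthogonal projections\<close>

lemma mat_adjoint_index [simp]:
  "i < dim_col A \<Longrightarrow> j < dim_row A \<Longrightarrow> mat_adjoint A $$ (i, j) = cj (A $$ (j, i))"
  by (simp add: mat_adjoint_def mat_of_rows_index)

lemma mat_adjoint_dim [simp]: "dim_row (mat_adjoint A) = dim_col A" "dim_col (mat_adjoint A) = dim_row A"
  by (auto simp: mat_adjoint_def)

lemma ProjD:
  assumes "P \<in> Proj k d"
  shows "P \<in> carrier_mat d d" "P * P = P" "mat_adjoint P = P" "vec_space.rank d P = k"
  using assms by (auto simp: Proj_def)

lemma Proj_hermitian: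
  assumes "P \<in> Proj k d" "i < d" "j < d"
  shows "cj (P $$ (i, j)) = P $$ (j, i)"
  using ProjD(1,3)[OF assms(1)] assms(2,3)
  by (metis mat_adjoint_index carrier_matD)

text \<open>
An orthogonal basis of the column space, obtained from a maximal independent set of columns by the
Gram-Schmidt process, consists of fixed vectors of \<open>P\<close>. Hence the coefficients of the columns of
\<open>P\<close> in this basis can be computed by pairing with the basis vectors. This is the only place where
the rank of a matrix is opened up: from here on it acts through the trace.
\<close>

lemma Proj_orthogonal_decomposition:
  assumes P: "(P :: 'a::rc_field mat) \<in> Proj k d"
  shows "\<exists>U. finite U \<and> card U = k \<and> U \<subseteq> carrier_vec d \<and> (\<forall>u\<in>U. u \<bullet>c u \<noteq> 0) \<and>
    (\<forall>i<d. \<forall>j<d. P $$ (i, j) = (\<Sum>u\<in>U. u $ i * cj (u $ j) / (u \<bullet>c u)))"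
proof -
  interpret cof_vec_space d "TYPE('a)" .
  have car: "P \<in> carrier_mat d d" using ProjD(1)[OF P] .
  have colsc: "set (cols P) \<subseteq> carrier_vec d" using cols_dim car by blast
  obtain B where B: "maximal B (\<lambda>T. T \<subseteq> set (cols P) \<and> lin_indpt T)" "finite B"
    using maximal_exists_superset[of "set (cols P)" "\<lambda>T. T \<subseteq> set (cols P) \<and> lin_indpt T" "{}"]
    by (auto simp: lin_dep_def)
  have Bsub: "B \<subseteq> set (cols P)" "lin_indpt B" using B(1) by (auto simp: maximal_def)
  have Bcar: "B \<subseteq> carrier_vec d" using Bsub colsc by auto
  have cardB: "card B = k" using rank_card_indpt[OF car B(1)] ProjD(4)[OF P] by simp
  have cols_span: "set (cols P) \<subseteq> span B"
  proof
    fix s assume s: "s \<in> set (cols P)"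
    show "s \<in> span B"
    proof (rule ccontr)
      assume ns: "s \<notin> span B"
      have nB: "s \<notin> B" using ns Bcar in_own_span[of B] by auto
      have "s \<in> carrier_vec d" using s colsc by auto
      then have "lin_indpt (B \<union> {s})"
        using lin_dep_iff_in_span[of B s] Bcar Bsub(2) nB ns by simp
      then show False using B(1) s Bsub nB unfolding maximal_def by blast
    qed
  qed
  obtain ws where ws: "set ws = B" "distinct ws" using finite_distinct_list[OF B(2)] by auto
  define us where "us = gram_schmidt d ws"
  have gs: "span (set ws) = span (set us)" "corthogonal us" "set us \<subseteq> carrier_vec d"
      "length us = length ws" "distinct us"
    using gram_schmidt_result[OF _ ws(2) _ us_def] ws(1) Bcar Bsub(2) by auto
  have cardU: "card (set us) = k" using gs(4,5) ws cardB distinct_card by metis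
  have orth: "u \<bullet>c v = 0 \<longleftrightarrow> u \<noteq> v" if "u \<in> set us" "v \<in> set us" for u v
    using that corthogonalD[OF gs(2)] gs(5) by (metis in_set_conv_nth nth_eq_iff_index_eq)
  have fixu: "P *\<^sub>v u = u" if u: "u \<in> set us" for u
  proof -
    have "u \<in> span B" using u gs(1,3) ws(1) in_own_span[of "set us"] by auto
    then have "u \<in> span (set (cols P))" using span_is_monotone[OF Bsub(1)] by auto
    then have "u \<in> col_space P" by (simp add: col_space_def)
    then obtain x where x: "x \<in> carrier_vec d" "P *\<^sub>v x = u" using col_space_eq[OF car] car by auto
    then show ?thesis using car ProjD(2)[OF P]
      by (metis assoc_mult_mat_vec)
  qed
  have "P $$ (i, j) = (\<Sum>u\<in>set us. u $ i * cj (u $ j) / (u \<bullet>c u))" if ij: "i < d" "j < d" for i j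
  proof -
    have "col P j \<in> span (set us)"
      using cols_span gs(1) ws(1) ij car by (metis carrier_matD(2) cols_length cols_nth nth_mem subsetD)
    then obtain a where a: "lincomb a (set us) = col P j"
      using finite_in_span[of "set us" "col P j"] gs(3) by auto
    have idx: "P $$ (l, j) = (\<Sum>u\<in>set us. a u * u $ l)" if "l < d" for l
      using lincomb_index[OF that gs(3), of a] a ij that car by simp
    have coef: "a u = cj (u $ j) / (u \<bullet>c u)" if u: "u \<in> set us" for u
    proof -
      have uc: "u \<in> carrier_vec d" using u gs(3) by auto
      have sp: "v \<bullet>c u = (\<Sum>l<d. v $ l * cj (u $ l))" for v
        using uc by (simp add: scalar_prod_def lessThan_atLeast0)
      have "(\<Sum>l<d. P $$ (l, j) * cj (u $ l)) = (\<Sum>l<d. \<Sum>v\<in>set us. a v * (v $ l * cj (u $ l)))"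
        by (intro sum.cong refl) (simp add: idx sum_distrib_right mult.assoc)
      also have "\<dots> = (\<Sum>v\<in>set us. a v * (v \<bullet>c u))"
        by (subst sum.swap) (simp add: sp sum_distrib_left)
      also have "\<dots> = (\<Sum>v\<in>set us. if v = u then a u * (u \<bullet>c u) else 0)"
        by (intro sum.cong) (use orth[OF _ u] in auto)
      also have "\<dots> = a u * (u \<bullet>c u)" using u by simp
      finally have 1: "(\<Sum>l<d. P $$ (l, j) * cj (u $ l)) = a u * (u \<bullet>c u)" .
      have "cj (u $ j) = cj ((P *\<^sub>v u) $ j)" using fixu[OF u] by simp
      also have "\<dots> = (\<Sum>l<d. P $$ (l, j) * cj (u $ l))"
        using car uc ij Proj_hermitian[OF P ij(2)]
        by (simp add: scalar_prod_def lessThan_atLeast0 cj_sum)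
      finally show ?thesis using 1 orth[OF u u] by (simp add: field_simps)
    qed
    show ?thesis using idx[OF ij(1)] coef by (auto intro!: sum.cong simp: mult.commute)
  qed
  then show ?thesis using gs(3) cardU orth
    by (intro exI[of _ "set us"]) auto
qed

lemma Proj_trace:
  assumes P: "(P :: 'a::rc_field mat) \<in> Proj k d"
  shows "(\<Sum>i<d. P $$ (i, i)) = of_nat k"
proof -
  obtain U where U: "finite U" "card U = k" "U \<subseteq> carrier_vec d" "\<forall>u\<in>U. u \<bullet>c u \<noteq> 0"
    "\<forall>i<d. \<forall>j<d. P $$ (i, j) = (\<Sum>u\<in>U. u $ i * cj (u $ j) / (u \<bullet>c u))"
    using Proj_orthogonal_decomposition[OF P] by blast
  have "(\<Sum>i<d. P $$ (i, i)) = (\<Sum>u\<in>U. (\<Sum>i<d. u $ i * cj (u $ i)) / (u \<bullet>c u))"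
    using U(5) by (simp add: sum_divide_distrib sum.swap[of _ U])
  also have "\<dots> = (\<Sum>u\<in>U. 1)"
    using U(3,4) by (intro sum.cong) (auto simp: scalar_prod_def lessThan_atLeast0)
  finally show ?thesis using U(2) by simp
qed

definition line_proj :: "nat \<Rightarrow> (nat \<Rightarrow> 'a::rc_field) \<Rightarrow> 'a mat" where
  "line_proj d x = mat d d (\<lambda>(i, j). x i * cj (x j))"

lemma Proj_1_obtain_unit:
  assumes P: "(P :: 'a::rc_field mat) \<in> Proj 1 d"
  obtains x where "x \<in> usphere d" "P = line_proj d x"
proof -
  obtain U where U: "finite U" "card U = 1" "U \<subseteq> carrier_vec d" "\<forall>u\<in>U. u \<bullet>c u \<noteq> 0"
    "\<forall>i<d. \<forall>j<d. P $$ (i, j) = (\<Sum>u\<in>U. u $ i * cj (u $ j) / (u \<bullet>c u))"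
    using Proj_orthogonal_decomposition[OF P] by blast
  obtain u where Uu: "U = {u}" using U(2) card_1_singletonE by blast
  define r where "r = nrm d (\<lambda>i. u $ i)"
  have uu: "u \<bullet>c u = of_real (r\<^sup>2)"
    using U(3) Uu ip_self[of d "\<lambda>i. u $ i"]
    by (simp add: scalar_prod_def lessThan_atLeast0 ip_def r_def)
  have r: "r > 0" using U(4) Uu uu nrm_nonneg[of d "\<lambda>i. u $ i"]
    unfolding r_def by (metis insertI1 less_eq_real_def of_real_0 power_zero_numeral)
  show ?thesis
  proof
    show "(\<lambda>i. of_real (1 / r) * u $ i) \<in> usphere d"
      unfolding usphere_def using nrm_scale[of d "of_real (1 / r) :: 'a" "\<lambda>i. u $ i"] r
      by (simp add: r_def[symmetric] norm_divide)
    show "P = line_proj d (\<lambda>i. of_real (1 / r) * u $ i)"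
      using ProjD(1)[OF P] U(5) Uu uu r
      by (intro eq_matI) (auto simp: line_proj_def power2_eq_square)
  qed
qed

lemma line_proj_index [simp]:
  "i < d \<Longrightarrow> j < d \<Longrightarrow> line_proj d x $$ (i, j) = x i * cj (x j)"
  by (simp add: line_proj_def)

lemma line_proj_carrier [simp]: "line_proj d x \<in> carrier_mat d d"
  by (simp add: line_proj_def)

section \<open>The distance of two lines\<close>

lemma ip_cong: "(\<And>i. i < d \<Longrightarrow> x i = x' i) \<Longrightarrow> (\<And>i. i < d \<Longrightarrow> y i = y' i) \<Longrightarrow> ip d x y = ip d x' y'"
  by (simp add: ip_def)

lemma nrm_cong: "(\<And>i. i < d \<Longrightarrow> x i = x' i) \<Longrightarrow> nrm d x = nrm d x'"
  by (simp add: nrm_def)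

text \<open>
On the plane spanned by \<open>x\<close> and \<open>y\<close> the difference of the two line projections is, in an orthonormal
basis that starts with \<open>x\<close>, a trace-free Hermitian matrix whose square is
\<open>1 - (norm (ip d y x))\<^sup>2\<close> times the identity; it vanishes on the orthogonal complement of that plane.
\<close>

lemma line_diff_bound:
  assumes x: "x \<in> usphere d" and y: "y \<in> usphere d"
  shows "(nrm d (\<lambda>i. ip d v x * x i - ip d v y * y i))\<^sup>2
    \<le> (1 - (norm (ip d y x))\<^sup>2) * (nrm d v)\<^sup>2"
proof -
  define c where "c = ip d y x"
  define z where "z = (\<lambda>i. y i - c * x i)"
  define a where "a = ip d v x"
  define \<zeta> where "\<zeta> = ip d v z"
  define s where "s = 1 - (norm c)\<^sup>2"
  have xx: "ip d x x = 1" and yy: "ip d y y = 1"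
    using x y by (auto simp: ip_self usphere_def)
  have xy: "ip d x y = cj c" by (simp add: c_def ip_commute)
  have zx: "ip d z x = 0" by (simp add: z_def ip_linear xx c_def)
  then have xz: "ip d x z = 0" using ip_commute[of d z x] by simp
  have zz: "ip d z z = of_real s"
    using mult_conjugate[of c] xx yy xy
    by (simp add: z_def ip_linear s_def c_def[symmetric] algebra_simps)
  then have zn: "(nrm d z)\<^sup>2 = s" using ip_self[of d z] by (metis of_real_eq_iff)
  then have s0: "s \<ge> 0" by (metis zero_le_power2)
  have yv: "ip d v y = cj c * a + \<zeta>"
    by (simp add: \<zeta>_def z_def ip_linear a_def)
  have nv: "(nrm d (\<lambda>i. v i - a * x i))\<^sup>2 = (nrm d v)\<^sup>2 - (norm a)\<^sup>2"
  proof -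
    have "(nrm d (\<lambda>i. v i - a * x i))\<^sup>2 = (nrm d v)\<^sup>2 + (norm a)\<^sup>2 - 2 * re (cj a * a)"
      unfolding nrm_diff_sq using usphereD[OF x]
      by (simp add: nrm_scale ip_linear a_def[symmetric] power_mult_distrib)
    also have "cj a * a = of_real ((norm a)\<^sup>2)" by (simp only: mult_conjugate mult.commute)
    finally show ?thesis by (simp only: re_of_real)
  qed
  have zeta: "(norm \<zeta>)\<^sup>2 \<le> ((nrm d v)\<^sup>2 - (norm a)\<^sup>2) * s"
  proof -
    have "ip d (\<lambda>i. v i - a * x i) z = \<zeta>" by (simp add: ip_linear xz \<zeta>_def)
    then have "norm \<zeta> \<le> nrm d (\<lambda>i. v i - a * x i) * nrm d z" using Cauchy_Schwarz by metis
    then have "(norm \<zeta>)\<^sup>2 \<le> (nrm d (\<lambda>i. v i - a * x i) * nrm d z)\<^sup>2" by (simp add: power_mono)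
    then show ?thesis by (simp add: power_mult_distrib nv zn)
  qed
  have "nrm d (\<lambda>i. a * x i - ip d v y * y i) = nrm d (\<lambda>i. (a - ip d v y * c) * x i - ip d v y * z i)"
    by (intro nrm_cong) (simp add: z_def algebra_simps)
  then have "(nrm d (\<lambda>i. a * x i - ip d v y * y i))\<^sup>2
      = (norm (a - ip d v y * c))\<^sup>2 + (norm (ip d v y))\<^sup>2 * s"
    using usphereD[OF x] by (simp add: nrm_diff_sq nrm_scale ip_linear xz power_mult_distrib zn)
  also have "a - ip d v y * c = of_real s * a - c * \<zeta>"
  proof -
    have "of_real s = 1 - c * cj c" by (simp only: s_def mult_conjugate) simp
    moreover have "a - ip d v y * c = (1 - c * cj c) * a - c * \<zeta>" by (simp add: yv algebra_simps)
    ultimately show ?thesis by simp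
  qed
  also have "(norm (of_real s * a - c * \<zeta>))\<^sup>2 = s\<^sup>2 * (norm a)\<^sup>2 + (norm c)\<^sup>2 * (norm \<zeta>)\<^sup>2 - 2 * s * re (a * cj c * cj \<zeta>)"
    using norm_add_sq[of "of_real s * a" "- (c * \<zeta>)"] re_mult_of_real[of s "a * cj c * cj \<zeta>"]
    by (simp add: norm_mult power_mult_distrib mult.assoc)
  also have "(norm (ip d v y))\<^sup>2 = (norm c)\<^sup>2 * (norm a)\<^sup>2 + (norm \<zeta>)\<^sup>2 + 2 * re (a * cj c * cj \<zeta>)"
    by (simp add: yv norm_add_sq norm_mult power_mult_distrib mult_ac)
  also have "s\<^sup>2 * (norm a)\<^sup>2 + (norm c)\<^sup>2 * (norm \<zeta>)\<^sup>2 - 2 * s * re (a * cj c * cj \<zeta>) +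
     ((norm c)\<^sup>2 * (norm a)\<^sup>2 + (norm \<zeta>)\<^sup>2 + 2 * re (a * cj c * cj \<zeta>)) * s
     = (s + (norm c)\<^sup>2) * (s * (norm a)\<^sup>2 + (norm \<zeta>)\<^sup>2)"
    by (simp add: algebra_simps power2_eq_square)
  also have "\<dots> = s * (norm a)\<^sup>2 + (norm \<zeta>)\<^sup>2" by (simp add: s_def)
  also have "\<dots> \<le> s * (nrm d v)\<^sup>2" using zeta by (simp add: algebra_simps)
  finally show ?thesis by (simp add: a_def s_def c_def)
qed

lemma op_norm_line_diff:
  assumes x: "x \<in> usphere d" and y: "y \<in> usphere d"
  shows "op_norm (line_proj d y - line_proj d x) \<le> sqrt (1 - (norm (ip d y x))\<^sup>2)"
  unfolding op_norm_def
proof (rule cSUP_least)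
  have "0\<^sub>v d \<in> {v \<in> carrier_vec (dim_col (line_proj d y - line_proj d x)). vec_l2_norm v \<le> 1}"
    by (simp add: line_proj_def vec_l2_norm_def L2_set_def)
  then show "{v \<in> carrier_vec (dim_col (line_proj d y - line_proj d x)). vec_l2_norm v \<le> 1} \<noteq> {}"
    by blast
next
  fix v :: "'a vec"
  assume "v \<in> {v \<in> carrier_vec (dim_col (line_proj d y - line_proj d x)). vec_l2_norm v \<le> 1}"
  then have v: "v \<in> carrier_vec d" "vec_l2_norm v \<le> 1" by (auto simp: line_proj_def)
  define w where "w = (\<lambda>i. v $ i)"
  have w: "nrm d w \<le> 1" using v by (simp add: vec_l2_norm_def nrm_def L2_set_def w_def)
  have idx: "((line_proj d y - line_proj d x) *\<^sub>v v) $ i = ip d w y * y i - ip d w x * x i" if "i < d" for i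
  proof -
    have "((line_proj d y - line_proj d x) *\<^sub>v v) $ i = (\<Sum>j<d. (y i * cj (y j) - x i * cj (x j)) * v $ j)"
      using v that by (simp add: scalar_prod_def line_proj_def lessThan_atLeast0)
    also have "\<dots> = (\<Sum>j<d. v $ j * cj (y j)) * y i - (\<Sum>j<d. v $ j * cj (x j)) * x i"
      unfolding sum_distrib_right by (simp add: algebra_simps flip: sum_subtractf)
    finally show ?thesis by (simp add: ip_def w_def)
  qed
  have "vec_l2_norm ((line_proj d y - line_proj d x) *\<^sub>v v) = nrm d (\<lambda>i. ip d w y * y i - ip d w x * x i)"
    using idx by (simp add: vec_l2_norm_def nrm_def L2_set_def line_proj_def)
  also have "\<dots> \<le> sqrt (1 - (norm (ip d x y))\<^sup>2)"
  proof -
    have "(norm (ip d x y)) \<le> 1" using Cauchy_Schwarz[of d x y] x y by (simp add: usphere_def)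
    then have "(norm (ip d x y))\<^sup>2 \<le> 1" by (simp add: abs_square_le_1)
    then have "(1 - (norm (ip d x y))\<^sup>2) * (nrm d w)\<^sup>2 \<le> (1 - (norm (ip d x y))\<^sup>2) * 1"
      using w by (intro mult_left_mono) (auto simp: power_le_one)
    then show ?thesis using line_diff_bound[OF y x, of w] by (intro real_le_rsqrt) simp
  qed
  also have "norm (ip d x y) = norm (ip d y x)" by (metis ip_commute norm_cj)
  finally show "vec_l2_norm ((line_proj d y - line_proj d x) *\<^sub>v v) \<le> sqrt (1 - (norm (ip d y x))\<^sup>2)" .
qed

section \<open>Matrices acting on coordinate vectors\<close>

definition mv :: "nat \<Rightarrow> 'a::rc_field mat \<Rightarrow> (nat \<Rightarrow> 'a) \<Rightarrow> nat \<Rightarrow> 'a" where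
  "mv d A x = (\<lambda>i. \<Sum>j<d. A $$ (i, j) * x j)"

text \<open>
The sesquilinear form of the reflection \<open>S = 2 * P - 1\<close> attached to a projection \<open>P\<close>. Its
quadratic form \<open>q\<close> is a centred version of the measured quantity: \<open>q d P x = 2 * tr (P X) - 1\<close> for the
line \<open>X\<close> through the unit vector \<open>x\<close>. So the binary answer of \<open>P\<close> is the sign of \<open>q d P x\<close>.
\<close>

definition refl_form :: "nat \<Rightarrow> 'a::rc_field mat \<Rightarrow> (nat \<Rightarrow> 'a) \<Rightarrow> (nat \<Rightarrow> 'a) \<Rightarrow> 'a" where
  "refl_form d P x y = 2 * ip d (mv d P x) y - ip d x y"

definition q :: "nat \<Rightarrow> 'a::rc_field mat \<Rightarrow> (nat \<Rightarrow> 'a) \<Rightarrow> real" where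
  "q d P x = re (refl_form d P x x)"

definition basis_vec :: "nat \<Rightarrow> nat \<Rightarrow> 'a::rc_field" where
  "basis_vec j = (\<lambda>i. if i = j then 1 else 0)"

lemma mv_linear:
  "mv d A (\<lambda>i. x i + y i) = (\<lambda>i. mv d A x i + mv d A y i)"
  "mv d A (\<lambda>i. x i - y i) = (\<lambda>i. mv d A x i - mv d A y i)"
  "mv d A (\<lambda>i. c * x i) = (\<lambda>i. c * mv d A x i)"
  by (auto simp: mv_def algebra_simps sum.distrib sum_subtractf sum_distrib_left)

lemma mv_mult:
  assumes "A \<in> carrier_mat d d" "B \<in> carrier_mat d d" "i < d"
  shows "mv d (A * B) x i = mv d A (mv d B x) i"
proof -
  have "mv d (A * B) x i = (\<Sum>j<d. \<Sum>l<d. A $$ (i, l) * B $$ (l, j) * x j)"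
    using assms unfolding mv_def
    by (intro sum.cong refl) (simp add: scalar_prod_def lessThan_atLeast0 sum_distrib_right)
  also have "\<dots> = (\<Sum>l<d. A $$ (i, l) * (\<Sum>j<d. B $$ (l, j) * x j))"
    by (subst sum.swap) (simp add: sum_distrib_left mult.assoc)
  finally show ?thesis by (simp add: mv_def)
qed

lemma mv_cong: "(\<And>j. j < d \<Longrightarrow> x j = y j) \<Longrightarrow> mv d A x = mv d A y"
  by (simp add: mv_def)

lemma ip_mv_adjoint:
  assumes "A \<in> carrier_mat d d"
  shows "ip d (mv d A x) y = ip d x (mv d (mat_adjoint A) y)"
proof -
  have "ip d (mv d A x) y = (\<Sum>i<d. \<Sum>j<d. A $$ (i, j) * x j * cj (y i))"
    by (simp add: ip_def mv_def sum_distrib_right)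
  also have "\<dots> = (\<Sum>j<d. \<Sum>i<d. A $$ (i, j) * x j * cj (y i))" by (rule sum.swap)
  also have "\<dots> = (\<Sum>j<d. x j * cj (\<Sum>i<d. mat_adjoint A $$ (j, i) * y i))"
    using assms by (intro sum.cong refl) (simp add: cj_sum sum_distrib_left mult_ac)
  finally show ?thesis by (simp add: ip_def mv_def)
qed

lemma refl_form_cong:
  "(\<And>i. i < d \<Longrightarrow> x i = x' i) \<Longrightarrow> (\<And>i. i < d \<Longrightarrow> y i = y' i) \<Longrightarrow>
    refl_form d P x y = refl_form d P x' y'"
  unfolding refl_form_def using ip_cong[of d x x' y y'] mv_cong[of d x x' P]
    ip_cong[of d "mv d P x" "mv d P x" y y'] by metis

lemma q_cong: "(\<And>i. i < d \<Longrightarrow> x i = x' i) \<Longrightarrow> q d P x = q d P x'"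
  unfolding q_def by (metis refl_form_cong)

lemma refl_form_linear:
  "refl_form d P (\<lambda>i. x i + y i) z = refl_form d P x z + refl_form d P y z"
  "refl_form d P (\<lambda>i. x i - y i) z = refl_form d P x z - refl_form d P y z"
  "refl_form d P (\<lambda>i. c * x i) z = c * refl_form d P x z"
  "refl_form d P z (\<lambda>i. x i + y i) = refl_form d P z x + refl_form d P z y"
  "refl_form d P z (\<lambda>i. x i - y i) = refl_form d P z x - refl_form d P z y"
  "refl_form d P z (\<lambda>i. c * x i) = cj c * refl_form d P z x"
  by (simp_all add: refl_form_def mv_linear ip_linear algebra_simps)

lemma q_phase: "norm u = 1 \<Longrightarrow> q d P (\<lambda>i. u * x i) = q d P x"
proof -
  assume "norm u = 1"
  then have "u * cj u = 1" using mult_conjugate[of u] by simp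
  then have "refl_form d P (\<lambda>i. u * x i) (\<lambda>i. u * x i) = refl_form d P x x"
    by (simp add: refl_form_linear flip: mult.assoc)
  then show ?thesis by (simp add: q_def)
qed

lemma basis_vec_sums:
  assumes "j < d"
  shows "ip d x (basis_vec j) = x j" "nrm d (basis_vec j :: nat \<Rightarrow> 'a::rc_field) = 1"
    "i < d \<Longrightarrow> mv d P (basis_vec j) i = P $$ (i, j)"
  using assms by (auto simp: ip_def nrm_def mv_def basis_vec_def if_distrib[of norm] if_distrib[of cj]
      if_distrib[of "\<lambda>c. _ * c"] if_distrib[of "\<lambda>c. c\<^sup>2"] cong: if_cong)

lemma basis_vec_unit [simp]: "j < d \<Longrightarrow> basis_vec j \<in> usphere d"
  by (simp add: usphere_def basis_vec_sums)

lemma refl_form_basis: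
  assumes "i < d" "j < d"
  shows "refl_form d P (basis_vec j) (basis_vec i) = 2 * P $$ (i, j) - (if i = j then 1 else 0)"
  using assms by (simp add: refl_form_def basis_vec_sums) (simp add: basis_vec_def)

lemma refl_form_expand:
  "refl_form d P x y = (\<Sum>i<d. \<Sum>j<d. x j * cj (y i) * refl_form d P (basis_vec j) (basis_vec i))"
proof -
  have "(\<Sum>i<d. \<Sum>j<d. x j * cj (y i) * refl_form d P (basis_vec j) (basis_vec i))
    = (\<Sum>i<d. \<Sum>j<d. 2 * (P $$ (i, j) * x j * cj (y i)) - (if i = j then x j * cj (y i) else 0))"
    by (intro sum.cong refl) (auto simp: refl_form_basis algebra_simps)
  also have "\<dots> = refl_form d P x y"
    by (simp add: sum_subtractf refl_form_def ip_def mv_def sum_distrib_right flip: sum_distrib_left)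
  finally show ?thesis ..
qed

section \<open>Reflections attached to projections\<close>

lemma refl_form_hermitian:
  assumes "P \<in> Proj k d"
  shows "cj (refl_form d P x y) = refl_form d P y x"
  using ip_mv_adjoint[OF ProjD(1)[OF assms], of x y] ProjD(3)[OF assms]
  by (simp add: refl_form_def ip_commute)

lemma refl_form_real:
  assumes "P \<in> Proj k d"
  shows "refl_form d P x x = of_real (q d P x)"
  using of_real_re[OF refl_form_hermitian[OF assms, of x x]] by (simp add: q_def)

lemma refl_isometry:
  assumes P: "P \<in> Proj k d"
  shows "nrm d (\<lambda>i. 2 * mv d P x i - x i) = nrm d x"
proof -
  have "ip d (mv d P x) x = ip d (mv d (P * P) x) x" using ProjD(2)[OF P] by simp
  also have "\<dots> = ip d (mv d P (mv d P x)) x"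
    using mv_mult[OF ProjD(1)[OF P] ProjD(1)[OF P]] by (intro ip_cong) auto
  also have "\<dots> = ip d (mv d P x) (mv d P x)"
    using ip_mv_adjoint[OF ProjD(1)[OF P]] ProjD(3)[OF P] by metis
  also have "\<dots> = of_real ((nrm d (mv d P x))\<^sup>2)" by (rule ip_self)
  finally have 1: "re (ip d (mv d P x) x) = (nrm d (mv d P x))\<^sup>2" by (simp only: re_of_real)
  have "(nrm d (\<lambda>i. 2 * mv d P x i - x i))\<^sup>2 = (2 * nrm d (mv d P x))\<^sup>2 + (nrm d x)\<^sup>2 - 2 * re (2 * ip d (mv d P x) x)"
    unfolding nrm_diff_sq by (simp add: nrm_scale ip_linear)
  also have "re (2 * ip d (mv d P x) x) = 2 * re (ip d (mv d P x) x)"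
    using re_mult_of_real[of 2 "ip d (mv d P x) x"] by simp
  finally have "(nrm d (\<lambda>i. 2 * mv d P x i - x i))\<^sup>2 = (nrm d x)\<^sup>2" using 1 by (simp add: power_mult_distrib)
  then show ?thesis by (simp add: power2_eq_iff_nonneg)
qed

lemma refl_form_altdef: "refl_form d P x y = ip d (\<lambda>i. 2 * mv d P x i - x i) y"
  by (simp add: refl_form_def ip_linear)

lemma refl_form_bound:
  assumes "P \<in> Proj k d"
  shows "norm (refl_form d P x y) \<le> nrm d x * nrm d y"
  unfolding refl_form_altdef using Cauchy_Schwarz refl_isometry[OF assms] by metis

lemma q_bound:
  assumes "P \<in> Proj k d" "x \<in> usphere d"
  shows "\<bar>q d P x\<bar> \<le> 1"
  using refl_form_bound[OF assms(1), of x x] abs_re_le[of "refl_form d P x x"] usphereD[OF assms(2)]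
  by (simp add: q_def)

lemma refl_form_row_norm:
  assumes "P \<in> Proj k d" "x \<in> usphere d"
  shows "(\<Sum>j<d. (norm (refl_form d P x (basis_vec j)))\<^sup>2) = 1"
proof -
  have "(\<Sum>j<d. (norm (refl_form d P x (basis_vec j)))\<^sup>2) = (nrm d (\<lambda>i. 2 * mv d P x i - x i))\<^sup>2"
    by (simp add: nrm_sq refl_form_altdef basis_vec_sums)
  then show ?thesis using refl_isometry[OF assms(1)] usphereD[OF assms(2)] by simp
qed

lemma q_trace:
  assumes "P \<in> Proj n (2 * n)"
  shows "(\<Sum>j<2 * n. q (2 * n) P (basis_vec j)) = 0"
proof -
  have "(\<Sum>j<2 * n. q (2 * n) P (basis_vec j)) = re (\<Sum>j<2 * n. 2 * P $$ (j, j) - 1)"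
    by (simp add: re_sum q_def refl_form_basis)
  also have "(\<Sum>j<2 * n. 2 * P $$ (j, j) - 1) = 0"
    by (simp add: sum_subtractf Proj_trace[OF assms] flip: sum_distrib_left)
  finally show ?thesis by simp
qed

text \<open>
Polarization: \<open>q x - q y\<close> is the real part of the form at \<open>x - y\<close> and \<open>x + y\<close>.
\<close>

lemma q_diff_le:
  assumes P: "P \<in> Proj k d"
  shows "\<bar>q d P x - q d P y\<bar> \<le> nrm d (\<lambda>i. x i - y i) * nrm d (\<lambda>i. x i + y i)"
proof -
  have "refl_form d P (\<lambda>i. x i - y i) (\<lambda>i. x i + y i)
      = refl_form d P x x - refl_form d P y y + (refl_form d P x y - cj (refl_form d P x y))"
    by (simp add: refl_form_linear refl_form_hermitian[OF P] algebra_simps)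
  then have "re (refl_form d P (\<lambda>i. x i - y i) (\<lambda>i. x i + y i)) = q d P x - q d P y"
    by (simp add: q_def)
  then show ?thesis using refl_form_bound[OF P] abs_re_le order_trans by metis
qed

section \<open>Householder reflections\<close>

text \<open>
Householder reflections are the only unitary matrices that the proof uses. For \<open>v = 0\<close> division by
zero makes the coefficient vanish, so \<open>householder d v\<close> is the identity then and all statements
remain valid.
\<close>

definition hcoef :: "nat \<Rightarrow> (nat \<Rightarrow> 'a::rc_field) \<Rightarrow> 'a" where
  "hcoef d v = of_real (2 / (nrm d v)\<^sup>2)"

lemma cj_hcoef [simp]: "cj (hcoef d v) = hcoef d v"
  by (simp only: hcoef_def cj_of_real)

definition householder :: "nat \<Rightarrow> (nat \<Rightarrow> 'a::rc_field) \<Rightarrow> (nat \<Rightarrow> 'a) \<Rightarrow> nat \<Rightarrow> 'a" where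
  "householder d v x = (\<lambda>i. x i - (hcoef d v * ip d x v) * v i)"

definition hmat :: "nat \<Rightarrow> (nat \<Rightarrow> 'a::rc_field) \<Rightarrow> 'a mat" where
  "hmat d v = mat d d (\<lambda>(i, j). (if i = j then 1 else 0) - hcoef d v * v i * cj (v j))"

lemma hmat_carrier [simp]: "hmat d v \<in> carrier_mat d d" "dim_row (hmat d v) = d" "dim_col (hmat d v) = d"
  by (simp_all add: hmat_def)

lemma mv_hmat:
  assumes "i < d"
  shows "mv d (hmat d v) x i = householder d v x i"
proof -
  have "mv d (hmat d v) x i = (\<Sum>j<d. (if i = j then x j else 0) - hcoef d v * v i * (x j * cj (v j)))"
    unfolding mv_def using assms by (intro sum.cong refl) (auto simp: hmat_def algebra_simps)
  also have "\<dots> = x i - hcoef d v * v i * ip d x v"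
    using assms by (simp add: sum_subtractf ip_def flip: sum_distrib_left)
  finally show ?thesis by (simp add: householder_def mult_ac)
qed

lemma ip_householder_adjoint: "ip d (householder d v x) y = ip d x (householder d v y)"
  using ip_commute[of d y v]
  by (simp only: householder_def ip_linear cj_simps cj_hcoef) (simp add: mult_ac)

lemma householder_involution: "householder d v (householder d v x) i = x i"
proof (cases "nrm d v = 0")
  case False
  then have c: "hcoef d v * of_real ((nrm d v)\<^sup>2) = 2" by (simp add: hcoef_def)
  have "ip d (householder d v x) v = ip d x v - hcoef d v * of_real ((nrm d v)\<^sup>2) * ip d x v"
    unfolding householder_def ip_diff_left ip_scale_left ip_self by (simp add: mult_ac)
  also have "\<dots> = - ip d x v" unfolding c by simp
  finally show ?thesis by (simp add: householder_def)
qed (simp add: householder_def hcoef_def)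

lemma ip_householder: "ip d (householder d v x) (householder d v y) = ip d x y"
proof -
  have "ip d (householder d v x) (householder d v y) = ip d (householder d v (householder d v x)) y" by (simp only: ip_householder_adjoint)
  also have "householder d v (householder d v x) = x" by (rule ext) (rule householder_involution)
  finally show ?thesis .
qed

lemma hmat_adjoint: "mat_adjoint (hmat d v) = hmat d v"
  by (rule eq_matI) (auto simp: hmat_def)

lemma hmat_unitary: "hmat d v \<in> unitary_mats d"
proof -
  have "hmat d v * hmat d v = 1\<^sub>m d"
  proof (rule eq_matI)
    fix i j assume "i < dim_row (1\<^sub>m d :: 'a mat)" "j < dim_col (1\<^sub>m d :: 'a mat)"
    then have ij: "i < d" "j < d" by auto
    have "(hmat d v * hmat d v) $$ (i, j) = mv d (hmat d v * hmat d v) (basis_vec j) i"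
      using ij by (simp add: basis_vec_sums)
    also have "\<dots> = mv d (hmat d v) (mv d (hmat d v) (basis_vec j)) i" using ij by (intro mv_mult) auto
    also have "mv d (hmat d v) (mv d (hmat d v) (basis_vec j)) = mv d (hmat d v) (householder d v (basis_vec j))"
      by (intro mv_cong mv_hmat)
    also have "\<dots> i = basis_vec j i" using ij by (simp add: mv_hmat householder_involution)
    finally show "(hmat d v * hmat d v) $$ (i, j) = 1\<^sub>m d $$ (i, j)" using ij by (simp add: basis_vec_def)
  qed auto
  then show ?thesis by (simp add: unitary_mats_def hmat_adjoint)
qed

lemma refl_form_conj:
  assumes "P \<in> carrier_mat d d"
  shows "refl_form d (hmat d v * P * mat_adjoint (hmat d v)) x y = refl_form d P (householder d v x) (householder d v y)"
proof -
  have "ip d (mv d (hmat d v * P * mat_adjoint (hmat d v)) x) y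
    = ip d (householder d v (mv d P (householder d v x))) y"
  proof (intro ip_cong refl)
    fix i assume i: "i < d"
    have "mv d (hmat d v * P * mat_adjoint (hmat d v)) x i = mv d (hmat d v * P) (mv d (hmat d v) x) i"
      unfolding hmat_adjoint using assms i by (intro mv_mult) auto
    also have "\<dots> = mv d (hmat d v) (mv d P (mv d (hmat d v) x)) i"
      using assms i by (intro mv_mult) auto
    also have "mv d P (mv d (hmat d v) x) = mv d P (householder d v x)" by (intro mv_cong mv_hmat)
    finally show "mv d (hmat d v * P * mat_adjoint (hmat d v)) x i = householder d v (mv d P (householder d v x)) i"
      using i by (simp add: mv_hmat)
  qed
  then show ?thesis by (simp add: refl_form_def ip_householder_adjoint[of d v "mv d P (householder d v x)"] ip_householder)
qed

text \<open>
The reflection in the difference of two unit vectors swaps them if their inner product is real.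
A phase, which no quadratic form sees, takes care of the general case. In particular the unitary
group acts transitively on lines.
\<close>

lemma householder_transport:
  assumes x: "x \<in> usphere d" and y: "y \<in> usphere d"
  shows "\<exists>u v. norm u = 1 \<and> (\<forall>i<d. householder d v x i = u * y i)"
proof -
  obtain u where u: "norm u = 1" "u * ip d x y = of_real (norm (ip d x y))" using phase_exists by blast
  define c where "c = norm (ip d x y)"
  define x' where "x' = (\<lambda>i. u * x i)"
  define v where "v = (\<lambda>i. x' i - y i)"
  have uu: "cj u * u = 1" using mult_conjugate[of u] u(1) by (simp add: mult.commute)
  have x'y: "ip d x' y = of_real c" using u(2) by (simp add: x'_def ip_linear c_def)
  have x'x': "ip d x' x' = 1"
    using x u(1) ip_self[of d x'] by (simp add: x'_def nrm_scale usphere_def)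
  have vv: "(nrm d v)\<^sup>2 = 2 - 2 * c"
    unfolding v_def nrm_diff_sq x'y using x y u(1)
    by (simp add: x'_def nrm_scale usphere_def)
  have x'v: "ip d x' v = of_real (1 - c)" by (simp add: v_def ip_linear x'x' x'y)
  have "householder d v x' i = y i" if i: "i < d" for i
  proof (cases "nrm d v = 0")
    case True
    then have "v i = 0" using i nrm_eq_0_iff by blast
    then show ?thesis by (simp add: householder_def v_def)
  next
    case False
    then have "1 - c \<noteq> 0" using vv by auto
    have "hcoef d v * ip d x' v = (of_real (2 / (2 - 2 * c) * (1 - c)) :: 'a)"
      by (simp add: hcoef_def vv x'v)
    also have "2 / (2 - 2 * c) * (1 - c) = 1" using \<open>1 - c \<noteq> 0\<close> by (simp add: field_simps)
    finally show ?thesis by (simp add: householder_def) (simp add: v_def)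
  qed
  moreover have "householder d v x' i = u * householder d v x i" for i
    by (simp add: householder_def x'_def ip_linear algebra_simps)
  ultimately have "u * householder d v x i = y i" if "i < d" for i using that by metis
  then have "householder d v x i = cj u * y i" if "i < d" for i
    using that uu by (metis mult.assoc mult_1)
  then show ?thesis using u(1) by (intro exI[of _ "cj u"] exI[of _ v]) simp
qed

section \<open>Second differences and a smooth absolute value\<close>

lemma second_difference_Taylor:
  fixes g g1 g2 :: "real \<Rightarrow> real"
  assumes g: "\<And>t. (g has_real_derivative g1 t) (at t)" "\<And>t. (g1 has_real_derivative g2 t) (at t)"
  shows "\<exists>s t. \<bar>s\<bar> \<le> \<bar>h\<bar> \<and> \<bar>t\<bar> \<le> \<bar>h\<bar> \<and> g h + g (- h) - 2 * g 0 = (g2 s + g2 t) / 2 * h\<^sup>2"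
proof -
  define D where "D = (\<lambda>m::nat. if m = 0 then g else if m = 1 then g1 else g2)"
  have D: "D 0 = g" "\<forall>m x. m < 2 \<longrightarrow> (D m has_real_derivative D (Suc m) x) (at x)"
    using g by (auto simp: D_def less_2_cases_iff)
  have "\<exists>t. \<bar>t\<bar> \<le> \<bar>x\<bar> \<and> g x = g 0 + g1 0 * x + g2 t / 2 * x\<^sup>2" for x
    using Maclaurin_bi_le[of D g 2 x] D by (auto simp: D_def numeral_2_eq_2)
  from this[of h] this[of "-h"] obtain s t where
    "\<bar>s\<bar> \<le> \<bar>h\<bar>" "g h = g 0 + g1 0 * h + g2 s / 2 * h\<^sup>2"
    "\<bar>t\<bar> \<le> \<bar>h\<bar>" "g (-h) = g 0 + g1 0 * (-h) + g2 t / 2 * (-h)\<^sup>2" by auto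
  then show ?thesis by (intro exI[of _ s] exI[of _ t]) (auto simp: algebra_simps add_divide_distrib)
qed

text \<open>
Expectations of second differences are easy to control, whereas differentiating twice under the
expectation is not; this lemma and the following bound are the two hypotheses of dominated
convergence for the second difference.
\<close>

lemma second_difference_tendsto:
  fixes g g1 g2 :: "real \<Rightarrow> real"
  assumes g: "\<And>t. (g has_real_derivative g1 t) (at t)" "\<And>t. (g1 has_real_derivative g2 t) (at t)"
    and cont: "isCont g2 0"
  shows "(\<lambda>k. (g (1 / real (Suc k)) + g (- (1 / real (Suc k))) - 2 * g 0) * (real (Suc k))\<^sup>2)
    \<longlonglongrightarrow> g2 0"
proof -
  have "\<exists>s t. \<bar>s\<bar> \<le> 1 / real (Suc k) \<and> \<bar>t\<bar> \<le> 1 / real (Suc k) \<and>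
    (g (1 / real (Suc k)) + g (- (1 / real (Suc k))) - 2 * g 0) * (real (Suc k))\<^sup>2 = (g2 s + g2 t) / 2" for k
  proof -
    obtain s t where "\<bar>s\<bar> \<le> \<bar>1 / real (Suc k)\<bar>" "\<bar>t\<bar> \<le> \<bar>1 / real (Suc k)\<bar>"
      "g (1 / real (Suc k)) + g (- (1 / real (Suc k))) - 2 * g 0 = (g2 s + g2 t) / 2 * (1 / real (Suc k))\<^sup>2"
      using second_difference_Taylor[OF g] by blast
    moreover have "(1 / real (Suc k))\<^sup>2 * (real (Suc k))\<^sup>2 = 1" by (simp add: power_divide)
    ultimately show ?thesis
      by (intro exI[of _ s] exI[of _ t]) (simp only: mult.assoc, simp)
  qed
  then obtain s t where st: "\<And>k. \<bar>s k\<bar> \<le> 1 / real (Suc k)" "\<And>k. \<bar>t k\<bar> \<le> 1 / real (Suc k)"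
    "\<And>k. (g (1 / real (Suc k)) + g (- (1 / real (Suc k))) - 2 * g 0) * (real (Suc k))\<^sup>2
      = (g2 (s k) + g2 (t k)) / 2" by metis
  have lim: "(\<lambda>k. 1 / real (Suc k)) \<longlonglongrightarrow> 0" using LIMSEQ_inverse_real_of_nat by (simp add: inverse_eq_divide)
  have "s \<longlonglongrightarrow> 0" "t \<longlonglongrightarrow> 0"
    using st(1,2) by (auto intro!: tendsto_0_le[OF lim, where K = 1] always_eventually)
  then have "(\<lambda>k. (g2 (s k) + g2 (t k)) / 2) \<longlonglongrightarrow> (g2 0 + g2 0) / 2"
    using cont by (intro tendsto_intros isCont_tendsto_compose[of 0 g2]) auto
  then show ?thesis unfolding st(3) by simp
qed

lemma second_difference_bound:
  fixes g g1 g2 :: "real \<Rightarrow> real"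
  assumes g: "\<And>t. (g has_real_derivative g1 t) (at t)" "\<And>t. (g1 has_real_derivative g2 t) (at t)"
    and B: "\<And>t. \<bar>g2 t\<bar> \<le> B"
  shows "\<bar>(g h + g (- h) - 2 * g 0)\<bar> \<le> B * h\<^sup>2"
proof -
  obtain s t where st: "g h + g (- h) - 2 * g 0 = (g2 s + g2 t) / 2 * h\<^sup>2"
    using second_difference_Taylor[OF g, of h] by blast
  have "g2 s \<le> B" "- g2 s \<le> B" "g2 t \<le> B" "- g2 t \<le> B"
    using B[of s] B[of t] by (simp_all add: abs_le_iff)
  then have le: "\<bar>(g2 s + g2 t) / 2\<bar> \<le> B" by (intro abs_leI) (simp_all add: field_simps)
  show ?thesis unfolding st abs_mult abs_power2 by (rule mult_right_mono[OF le zero_le_power2])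
qed

lemma trig_form_derivs:
  fixes A c r :: real
  shows "((\<lambda>\<theta>. (cos \<theta>)\<^sup>2 * A + (sin \<theta>)\<^sup>2 * c + 2 * sin \<theta> * cos \<theta> * r) has_real_derivative
      (2 * sin \<theta> * cos \<theta> * (c - A) + 2 * ((cos \<theta>)\<^sup>2 - (sin \<theta>)\<^sup>2) * r)) (at \<theta>)"
    and "((\<lambda>\<theta>. 2 * sin \<theta> * cos \<theta> * (c - A) + 2 * ((cos \<theta>)\<^sup>2 - (sin \<theta>)\<^sup>2) * r) has_real_derivative
      (2 * ((cos \<theta>)\<^sup>2 - (sin \<theta>)\<^sup>2) * (c - A) - 8 * sin \<theta> * cos \<theta> * r)) (at \<theta>)"
  by (auto intro!: derivative_eq_intros simp: algebra_simps power2_eq_square)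

text \<open>
A smooth version of the absolute value: its derivative stays in \<open>[-1, 1]\<close> and its second
derivative is a bump of height \<open>1 / l\<close> and width about \<open>l\<close> around zero.
\<close>

lemma smooth_abs_derivs:
  fixes l :: real assumes "l > 0"
  shows "((\<lambda>u. sqrt (l\<^sup>2 + u\<^sup>2)) has_real_derivative u / sqrt (l\<^sup>2 + u\<^sup>2)) (at u)"
    and "((\<lambda>u. u / sqrt (l\<^sup>2 + u\<^sup>2)) has_real_derivative l\<^sup>2 / (sqrt (l\<^sup>2 + u\<^sup>2)) ^ 3) (at u)"
    and "continuous_on UNIV (\<lambda>u. l\<^sup>2 / (sqrt (l\<^sup>2 + u\<^sup>2)) ^ 3)"
proof -
  have pos: "l\<^sup>2 + u\<^sup>2 > 0" for u using assms by (simp add: add_pos_nonneg)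
  show d1: "((\<lambda>u. sqrt (l\<^sup>2 + u\<^sup>2)) has_real_derivative u / sqrt (l\<^sup>2 + u\<^sup>2)) (at u)" for u
  proof -
    have "((\<lambda>u. l\<^sup>2 + u\<^sup>2) has_real_derivative 2 * u) (at u)" by (auto intro!: derivative_eq_intros)
    from DERIV_chain2[OF DERIV_real_sqrt[OF pos[of u]] this] show ?thesis
      by (simp add: field_simps)
  qed
  have nz: "sqrt (l\<^sup>2 + u\<^sup>2) \<noteq> 0" for u using assms by simp
  have "(1 * sqrt (l\<^sup>2 + u\<^sup>2) - u * (u / sqrt (l\<^sup>2 + u\<^sup>2))) / (sqrt (l\<^sup>2 + u\<^sup>2) * sqrt (l\<^sup>2 + u\<^sup>2))
      = l\<^sup>2 / (sqrt (l\<^sup>2 + u\<^sup>2)) ^ 3"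
    using pos[of u] nz[of u] by (simp add: field_simps power3_eq_cube power2_eq_square)
  then show "((\<lambda>u. u / sqrt (l\<^sup>2 + u\<^sup>2)) has_real_derivative l\<^sup>2 / (sqrt (l\<^sup>2 + u\<^sup>2)) ^ 3) (at u)"
    using DERIV_divide[OF DERIV_ident d1 nz, of u] by simp
  show "continuous_on UNIV (\<lambda>u. l\<^sup>2 / (sqrt (l\<^sup>2 + u\<^sup>2)) ^ 3)"
    using nz by (intro continuous_intros) auto
qed

lemma smooth_abs_weight_continuous:
  "(l::real) > 0 \<Longrightarrow> continuous_on UNIV (\<lambda>u. l\<^sup>2 / (sqrt (l\<^sup>2 + u\<^sup>2)) ^ 3 * (1 - u\<^sup>2))"
  by (rule continuous_on_mult[OF smooth_abs_derivs(3)]) (auto intro!: continuous_intros)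

text \<open>
With \<open>w = l / sqrt (l\<^sup>2 + u\<^sup>2)\<close> the second derivative is \<open>w ^ 3 / l\<close>, and
\<open>w ^ 3 \<ge> 3 - 2 / w\<^sup>2 = 1 - 2 * u\<^sup>2 / l\<^sup>2\<close>. A lower bound by a quadratic polynomial is what the second
moment can handle.
\<close>

lemma smooth_abs_lower:
  fixes l u :: real assumes l: "l > 0" and u: "\<bar>u\<bar> \<le> 1"
  shows "(1 - u\<^sup>2 - 2 * u\<^sup>2 / l\<^sup>2) / l \<le> l\<^sup>2 / (sqrt (l\<^sup>2 + u\<^sup>2)) ^ 3 * (1 - u\<^sup>2)"
proof -
  define s where "s = sqrt (l\<^sup>2 + u\<^sup>2)"
  have s2: "s\<^sup>2 = l\<^sup>2 + u\<^sup>2" by (simp add: s_def)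
  have sl: "l \<le> s" unfolding s_def by (rule real_le_rsqrt) simp
  define w where "w = l / s"
  have w: "0 < w" "w \<le> 1" using l sl by (auto simp: w_def)
  have u1: "u\<^sup>2 \<le> 1" using u by (simp add: abs_square_le_1)
  have ul: "u\<^sup>2 / l\<^sup>2 = 1 / w\<^sup>2 - 1"
    using l sl s2 by (simp add: w_def field_simps)
  have key: "1 - 2 * (u\<^sup>2 / l\<^sup>2) \<le> w ^ 3"
  proof -
    have "w ^ 5 - 3 * w\<^sup>2 + 2 = (1 - w) * (2 + 2 * w - w\<^sup>2 - w ^ 3 - w ^ 4)"
      by (simp add: algebra_simps power_numeral_reduce)
    moreover have "w\<^sup>2 \<le> w" "w ^ 3 \<le> w" "w ^ 4 \<le> w"
      using w power_decreasing[of 1 2 w] power_decreasing[of 1 3 w] power_decreasing[of 1 4 w] by auto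
    ultimately have "0 \<le> w ^ 5 - 3 * w\<^sup>2 + 2" using w by (simp add: mult_nonneg_nonneg)
    then have "3 * w\<^sup>2 - 2 \<le> w ^ 3 * w\<^sup>2" by (simp flip: power_add)
    then show ?thesis unfolding ul using w by (simp add: field_simps)
  qed
  have "1 - u\<^sup>2 - 2 * u\<^sup>2 / l\<^sup>2 \<le> (1 - 2 * (u\<^sup>2 / l\<^sup>2)) * (1 - u\<^sup>2)"
  proof -
    have "1 - b - 2 * a \<le> (1 - 2 * a) * (1 - b)" if "0 \<le> a * b" for a b :: real
      using that by (simp add: algebra_simps)
    from this[of "u\<^sup>2 / l\<^sup>2" "u\<^sup>2"] show ?thesis by simp
  qed
  also have "\<dots> \<le> w ^ 3 * (1 - u\<^sup>2)" using key u1 by (intro mult_right_mono) auto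
  finally have "(1 - u\<^sup>2 - 2 * u\<^sup>2 / l\<^sup>2) / l \<le> w ^ 3 * (1 - u\<^sup>2) / l"
    using l by (intro divide_right_mono) auto
  also have "w ^ 3 * (1 - u\<^sup>2) / l = l\<^sup>2 / s ^ 3 * (1 - u\<^sup>2)"
    using l by (simp add: w_def power_divide power3_eq_cube power2_eq_square)
  finally show ?thesis by (simp add: s_def)
qed

section \<open>Uniformly distributed projections\<close>

text \<open>
The dimension is a parameter of its own, tied to \<open>n\<close> by an equation, so that simplification treats
it as an atom.
\<close>

locale uniform_projection =
  fixes n d :: nat and \<mu> :: "'a::rc_field mat measure"
  assumes n_pos: "1 \<le> n" and d_eq: "d = 2 * n" and unif: "uniform_Proj n d \<mu>"
begin

sublocale prob_space \<mu>
  using unif by (simp add: uniform_Proj_def)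

lemma sets_mu: "sets \<mu> = sets (Proj_borel n d)"
  using unif by (simp add: uniform_Proj_def)

lemma space_mu: "space \<mu> = Proj n d"
  using sets_eq_imp_space_eq[OF sets_mu] by (simp add: Proj_borel_def)

lemma entry_measurable [measurable]:
  assumes "i < d" "j < d"
  shows "(\<lambda>P. P $$ (i, j)) \<in> borel_measurable \<mu>"
proof -
  have "(\<lambda>P. \<lambda>ij \<in> {..<d} \<times> {..<d}. P $$ ij) \<in> measurable \<mu> (\<Pi>\<^sub>M ij \<in> {..<d} \<times> {..<d}. (borel :: 'a measure))"
    unfolding measurable_cong_sets[OF sets_mu refl] Proj_borel_def
    by (rule measurable_vimage_algebra1) (auto simp: space_PiM)
  then have "(\<lambda>P. (\<lambda>ij \<in> {..<d} \<times> {..<d}. P $$ ij) (i, j)) \<in> borel_measurable \<mu>"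
    by (rule measurable_compose[OF _ measurable_component_singleton]) (use assms in auto)
  then show ?thesis using assms by simp
qed

lemma mv_measurable [measurable]: "i < d \<Longrightarrow> (\<lambda>P. mv d P x i) \<in> borel_measurable \<mu>"
  unfolding mv_def by (intro borel_measurable_sum borel_measurable_times) auto

lemma refl_form_measurable [measurable]: "(\<lambda>P. refl_form d P x y) \<in> borel_measurable \<mu>"
  unfolding refl_form_def ip_def
  by (intro borel_measurable_sum borel_measurable_times borel_measurable_diff) auto

lemma q_measurable [measurable]: "(\<lambda>P. q d P x) \<in> borel_measurable \<mu>"
  unfolding q_def by measurable

abbreviation reflected :: "(nat \<Rightarrow> 'a) \<Rightarrow> 'a mat \<Rightarrow> 'a mat" where
  "reflected v P \<equiv> hmat d v * P * mat_adjoint (hmat d v)"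

lemma trace_mult_commute:
  assumes "A \<in> carrier_mat d d" "B \<in> carrier_mat d d"
  shows "(\<Sum>i<d. (A * B) $$ (i, i)) = (\<Sum>i<d. (B * A) $$ (i, i) :: 'a)"
proof -
  have "(\<Sum>i<d. (A * B) $$ (i, i)) = (\<Sum>i<d. \<Sum>j<d. A $$ (i, j) * B $$ (j, i))"
    using assms by (intro sum.cong) (auto simp: scalar_prod_def lessThan_atLeast0)
  also have "\<dots> = (\<Sum>j<d. \<Sum>i<d. A $$ (i, j) * B $$ (j, i))" by (rule sum.swap)
  also have "\<dots> = (\<Sum>i<d. (B * A) $$ (i, i))"
    using assms by (intro sum.cong) (auto simp: scalar_prod_def lessThan_atLeast0 mult.commute)
  finally show ?thesis .
qed

text \<open>
Conjugation preserves self-adjointness and idempotence. That it preserves the rank follows from the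
invariance of the trace, as the trace of a projection is its rank.
\<close>

lemma hmat_conj_Proj:
  assumes P: "(P :: 'a mat) \<in> Proj n d"
  shows "reflected v P \<in> Proj n d"
proof -
  let ?H = "hmat d v" let ?R = "?H * P * mat_adjoint ?H"
  have H: "?H \<in> carrier_mat d d" "mat_adjoint ?H = ?H" "?H * ?H = 1\<^sub>m d"
    using hmat_unitary[of d v] by (auto simp: hmat_adjoint unitary_mats_def)
  have Pc: "P \<in> carrier_mat d d" using ProjD[OF P] by simp
  have R: "?R \<in> carrier_mat d d" using H Pc by auto
  note assoc = assoc_mult_mat[of _ d d _ d _ d]
  have c: "?H \<in> carrier_mat d d" "P \<in> carrier_mat d d" "P * ?H \<in> carrier_mat d d"
    "?H * (P * ?H) \<in> carrier_mat d d" using H Pc by auto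
  have R': "?R = ?H * (P * ?H)" unfolding H(2) using c(1,2,1) by (rule assoc)
  have HHPH: "?H * (?H * (P * ?H)) = P * ?H"
  proof -
    have "?H * (?H * (P * ?H)) = (?H * ?H) * (P * ?H)" using c(1,1,3) by (rule assoc[symmetric])
    then show ?thesis unfolding H(3) by (simp only: left_mult_one_mat[OF c(3)])
  qed
  have idem: "?R * ?R = ?R"
  proof -
    have "?R * ?R = ?H * ((P * ?H) * (?H * (P * ?H)))" unfolding R' using c(1,3,4) by (rule assoc)
    also have "(P * ?H) * (?H * (P * ?H)) = P * (?H * (?H * (P * ?H)))" using c(2,1,4) by (rule assoc)
    also have "?H * (?H * (P * ?H)) = P * ?H" by (rule HHPH)
    also have "P * (P * ?H) = (P * P) * ?H" using c(2,2,1) by (rule assoc[symmetric])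
    finally show ?thesis using ProjD(2)[OF P] R' by simp
  qed
  have form: "?R $$ (i, j) = ip d (mv d P (householder d v (basis_vec j))) (householder d v (basis_vec i))"
    if "i < d" "j < d" for i j
  proof -
    have "2 * ?R $$ (i, j) - (if i = j then 1 else 0) = refl_form d ?R (basis_vec j) (basis_vec i)"
      using refl_form_basis[OF that, of ?R] by simp
    also have "\<dots> = 2 * ip d (mv d P (householder d v (basis_vec j))) (householder d v (basis_vec i)) - (if i = j then 1 else 0)"
      unfolding refl_form_conj[OF Pc] unfolding refl_form_def ip_householder using that
      by (simp add: basis_vec_sums) (simp add: basis_vec_def)
    finally show ?thesis by simp
  qed
  have adj: "mat_adjoint ?R = ?R"
  proof (rule eq_matI)
    fix i j assume "i < dim_row ?R" "j < dim_col ?R"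
    then have ij: "i < d" "j < d" using R by (auto simp: H)
    then have "mat_adjoint ?R $$ (i, j) = cj (?R $$ (j, i))" using R by (intro mat_adjoint_index) auto
    also have "\<dots> = ip d (householder d v (basis_vec j)) (mv d P (householder d v (basis_vec i)))"
      unfolding form[OF ij(2,1)] ip_commute ..
    also have "\<dots> = ?R $$ (i, j)"
      unfolding form[OF ij] using ip_mv_adjoint[OF Pc] ProjD(3)[OF P] by simp
    finally show "mat_adjoint ?R $$ (i, j) = ?R $$ (i, j)" .
  qed (use R in auto)
  define k where "k = vec_space.rank d ?R"
  have Rk: "?R \<in> Proj k d" using R idem adj by (simp add: Proj_def k_def)
  have "(of_nat k :: 'a) = (\<Sum>i<d. ?R $$ (i, i))" using Proj_trace[OF Rk] by simp
  also have "\<dots> = (\<Sum>i<d. ((P * ?H) * ?H) $$ (i, i))"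
    unfolding R' by (rule trace_mult_commute[OF c(1,3)])
  also have "(P * ?H) * ?H = P" using assoc[OF c(2,1,1)] c(2) by (simp only: H(3) right_mult_one_mat)
  also have "(\<Sum>i<d. P $$ (i, i)) = of_nat n" using Proj_trace[OF P] by simp
  finally have "k = n" by simp
  then show ?thesis using Rk by simp
qed

lemma hmat_conj_measurable:
  "(\<lambda>P. reflected v P) \<in> measurable \<mu> \<mu>"
proof -
  let ?T = "\<lambda>P. reflected v P"
  have ent: "(\<lambda>P. ?T P $$ (i, j)) \<in> borel_measurable \<mu>" if "i < d" "j < d" for i j
  proof -
    have m: "(\<lambda>P. (refl_form d P (householder d v (basis_vec j)) (householder d v (basis_vec i)) + (if i = j then 1 else 0)) / 2)
      \<in> borel_measurable \<mu>" by measurable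
    have e: "?T P $$ (i, j) = (refl_form d P (householder d v (basis_vec j)) (householder d v (basis_vec i)) + (if i = j then 1 else 0)) / 2"
      if P: "P \<in> space \<mu>" for P
    proof -
      have "2 * ?T P $$ (i, j) - (if i = j then 1 else 0) = refl_form d P (householder d v (basis_vec j)) (householder d v (basis_vec i))"
        using refl_form_conj[of P d v "basis_vec j" "basis_vec i"] refl_form_basis[OF \<open>i < d\<close> \<open>j < d\<close>, of "?T P"]
          ProjD(1)[of P n d] P by (metis space_mu)
      then have "2 * ?T P $$ (i, j) = refl_form d P (householder d v (basis_vec j)) (householder d v (basis_vec i)) + (if i = j then 1 else 0)"
        by (simp only: diff_eq_eq)
      then show ?thesis by (metis nonzero_mult_div_cancel_left zero_neq_numeral)
    qed
    show ?thesis using m measurable_cong[of \<mu>, OF e, of "\<lambda>P. P" borel] by simp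
  qed
  have "?T \<in> measurable \<mu> (vimage_algebra (Proj n d)
      (\<lambda>P. \<lambda>ij \<in> {..<d} \<times> {..<d}. P $$ ij) (\<Pi>\<^sub>M ij \<in> {..<d} \<times> {..<d}. (borel :: 'a measure)))"
  proof (rule measurable_vimage_algebra2)
    show "?T \<in> space \<mu> \<rightarrow> Proj n d" using hmat_conj_Proj by (simp add: space_mu)
    show "(\<lambda>P. \<lambda>ij \<in> {..<d} \<times> {..<d}. ?T P $$ ij) \<in> measurable \<mu> (\<Pi>\<^sub>M ij \<in> {..<d} \<times> {..<d}. (borel :: 'a measure))"
      by (intro measurable_restrict) (use ent in auto)
  qed
  then show ?thesis
    by (subst measurable_cong_sets[OF refl sets_mu]) (simp add: Proj_borel_def)
qed

lemma expectation_conj: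
  assumes F: "F \<in> borel_measurable \<mu>"
  shows "expectation (\<lambda>P. F (reflected v P) :: real) = expectation F"
proof -
  have "distr \<mu> \<mu> (\<lambda>P. reflected v P) = \<mu>"
    using unif hmat_unitary by (auto simp: uniform_Proj_def)
  then have "expectation F = integral\<^sup>L (distr \<mu> \<mu> (\<lambda>P. reflected v P)) F" by simp
  also have "\<dots> = expectation (\<lambda>P. F (reflected v P))"
    by (rule integral_distr[OF hmat_conj_measurable F])
  finally show ?thesis ..
qed

lemma refl_form_hmat_conj:
  "P \<in> space \<mu> \<Longrightarrow> refl_form d (reflected v P) x y = refl_form d P (householder d v x) (householder d v y)"
  using refl_form_conj ProjD(1) by (metis space_mu)

lemma q_hmat_conj:
  "P \<in> space \<mu> \<Longrightarrow> q d (reflected v P) x = q d P (householder d v x)"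
  by (simp add: q_def refl_form_hmat_conj)

text \<open>
The law of \<open>q d P x\<close> is the same for all unit vectors \<open>x\<close>. This is all that the Stein identity uses of
the invariance of the distribution.
\<close>

lemma expectation_q_transport:
  assumes x: "x \<in> usphere d" and y: "y \<in> usphere d" and G: "G \<in> borel_measurable borel"
  shows "expectation (\<lambda>P. G (q d P x) :: real) = expectation (\<lambda>P. G (q d P y))"
proof -
  obtain u v where uv: "norm u = 1" "\<forall>i<d. householder d v x i = u * y i" using householder_transport[OF x y] by blast
  have qx: "q d (reflected v P) x = q d P y" if "P \<in> space \<mu>" for P
    using q_hmat_conj[OF that] q_cong[of d "householder d v x" "\<lambda>i. u * y i"] uv q_phase by metis
  have "expectation (\<lambda>P. G (q d P x)) = expectation (\<lambda>P. G (q d (reflected v P) x))"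
    by (intro expectation_conj[symmetric] measurable_compose[OF q_measurable G])
  also have "\<dots> = expectation (\<lambda>P. G (q d P y))"
    by (intro Bochner_Integration.integral_cong) (simp_all add: qx)
  finally show ?thesis .
qed

lemma integrable_bounded:
  assumes "F \<in> borel_measurable \<mu>" "\<And>P. P \<in> Proj n d \<Longrightarrow> \<bar>F P\<bar> \<le> (B :: real)"
  shows "integrable \<mu> F"
  using assms by (intro integrable_const_bound[of _ B]) (auto simp: space_mu)

text \<open>
Rotating the first coordinate vector towards the \<open>j\<close>-th one, with a phase \<open>w\<close>, moves the quadratic form
along a trigonometric polynomial. Its first derivative at zero is twice the real part of an
off-diagonal entry of the reflection, its second derivative twice the difference of two diagonal ones.
\<close>

lemma q_rotation:
  assumes P: "(P :: 'a mat) \<in> Proj n d" and w: "norm w = 1" and j: "0 < j" "j < d"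
  defines "x \<equiv> \<lambda>\<theta> i. of_real (cos \<theta>) * basis_vec 0 i + of_real (sin \<theta>) * (w * basis_vec j i)"
  shows "q d P (x \<theta>) = (cos \<theta>)\<^sup>2 * q d P (basis_vec 0) + (sin \<theta>)\<^sup>2 * q d P (basis_vec j)
      + 2 * sin \<theta> * cos \<theta> * re (cj w * refl_form d P (basis_vec 0) (basis_vec j))"
    and "x \<theta> \<in> usphere d"
proof -
  have ww: "w * cj w = 1" using mult_conjugate[of w] w by simp
  let ?f = "refl_form d P"
  have "?f (x \<theta>) (x \<theta>) = of_real ((cos \<theta>)\<^sup>2) * ?f (basis_vec 0) (basis_vec 0)
     + of_real ((sin \<theta>)\<^sup>2) * ((w * cj w) * ?f (basis_vec j) (basis_vec j))
     + of_real (sin \<theta> * cos \<theta>) * (cj w * ?f (basis_vec 0) (basis_vec j)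
     + cj (cj w * ?f (basis_vec 0) (basis_vec j)))"
    unfolding x_def cj_simps refl_form_hermitian[OF P]
    by (simp only: refl_form_linear cj_simps cj_of_real) (simp add: algebra_simps power2_eq_square)
  then show "q d P (x \<theta>) = (cos \<theta>)\<^sup>2 * q d P (basis_vec 0) + (sin \<theta>)\<^sup>2 * q d P (basis_vec j)
      + 2 * sin \<theta> * cos \<theta> * re (cj w * refl_form d P (basis_vec 0) (basis_vec j))"
    unfolding ww q_def by (simp only: re_add re_mult_of_real re_cj mult_1) (simp add: algebra_simps)
  have d0: "0 < d" using j by simp
  have "ip d (basis_vec 0) (basis_vec j :: nat \<Rightarrow> 'a) = 0"
    using j basis_vec_sums(1)[of j d "basis_vec 0 :: nat \<Rightarrow> 'a"] by (simp add: basis_vec_def)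
  then have "(nrm d (x \<theta>))\<^sup>2 = (cos \<theta>)\<^sup>2 + (sin \<theta>)\<^sup>2"
    unfolding x_def nrm_add_sq nrm_scale ip_linear
    using w basis_vec_sums(2)[OF d0, where 'a='a] basis_vec_sums(2)[OF j(2), where 'a='a] by simp
  then show "x \<theta> \<in> usphere d" by (simp add: usphere_def power2_eq_1_iff)
     (metis nrm_nonneg neg_0_le_iff_le not_one_le_zero)
qed

section \<open>A Stein identity\<close>

lemma d_pos: "0 < d"
  using n_pos d_eq by simp

definition cross_re :: "'a \<Rightarrow> 'a mat \<Rightarrow> nat \<Rightarrow> real" where
  "cross_re w P j = re (cj w * refl_form d P (basis_vec 0) (basis_vec j))"

abbreviation q0 :: "'a mat \<Rightarrow> real" where "q0 P \<equiv> q d P (basis_vec 0)"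

lemma cross_re_measurable [measurable]: "(\<lambda>P. cross_re w P j) \<in> borel_measurable \<mu>"
  unfolding cross_re_def by measurable

lemma cross_re_bound:
  assumes P: "P \<in> Proj n d" and "norm w = 1" "j < d"
  shows "\<bar>cross_re w P j\<bar> \<le> 1"
proof -
  have "\<bar>cross_re w P j\<bar> \<le> norm (refl_form d P (basis_vec 0) (basis_vec j))"
    unfolding cross_re_def using assms(2) by (intro order_trans[OF abs_re_le]) (simp add: norm_mult)
  also have "\<dots> \<le> 1"
    using refl_form_bound[OF P, of "basis_vec 0" "basis_vec j"] d_pos assms(3) by (simp add: basis_vec_sums)
  finally show ?thesis .
qed

text \<open>
The expectation of \<open>\<phi> (q d P x)\<close> does not change when \<open>x\<close> is rotated, so its second derivative along the
rotation of \<open>q_rotation\<close> vanishes. The chain rule turns this into the stated identity.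
\<close>

lemma Stein_single:
  fixes \<phi> \<phi>1 \<phi>2 :: "real \<Rightarrow> real"
  assumes \<phi>: "\<And>u. (\<phi> has_real_derivative \<phi>1 u) (at u)" "\<And>u. (\<phi>1 has_real_derivative \<phi>2 u) (at u)"
    and cont: "continuous_on UNIV \<phi>2"
    and w: "norm w = 1" and j: "0 < j" "j < d"
  shows "expectation (\<lambda>P. 2 * \<phi>2 (q0 P) * (cross_re w P j)\<^sup>2 + \<phi>1 (q0 P) * (q d P (basis_vec j) - q0 P)) = 0"
proof -
  have contphi: "continuous_on UNIV \<phi>" "continuous_on UNIV \<phi>1"
    using \<phi> by (auto intro!: continuous_at_imp_continuous_on DERIV_isCont)
  have [measurable]: "\<phi> \<in> borel_measurable borel" "\<phi>1 \<in> borel_measurable borel" "\<phi>2 \<in> borel_measurable borel"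
    using contphi cont by (auto intro: borel_measurable_continuous_onI)
  have "bounded (\<phi>2 ` {-1..1})" "bounded (\<phi>1 ` {-1..1})"
    using cont contphi by (auto intro!: compact_imp_bounded compact_continuous_image intro: continuous_on_subset)
  then obtain B1 B2 where "\<forall>u\<in>{-1..1}. \<bar>\<phi>1 u\<bar> \<le> B1" "\<forall>u\<in>{-1..1}. \<bar>\<phi>2 u\<bar> \<le> B2"
    unfolding bounded_iff by auto
  then have B: "\<And>u. \<bar>u\<bar> \<le> 1 \<Longrightarrow> \<bar>\<phi>1 u\<bar> \<le> B1" "\<And>u. \<bar>u\<bar> \<le> 1 \<Longrightarrow> \<bar>\<phi>2 u\<bar> \<le> B2"
    by (auto simp: abs_le_iff[of _ 1])
  have "0 \<le> B1" "0 \<le> B2" using B[of 0] by auto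
  define x where "x = (\<lambda>\<theta> i. of_real (cos \<theta>) * basis_vec 0 i + of_real (sin \<theta>) * (w * basis_vec j i))"
  define h where "h = (\<lambda>P \<theta>. (cos \<theta>)\<^sup>2 * q0 P + (sin \<theta>)\<^sup>2 * q d P (basis_vec j) + 2 * sin \<theta> * cos \<theta> * cross_re w P j)"
  define h1 where "h1 = (\<lambda>P \<theta>. 2 * sin \<theta> * cos \<theta> * (q d P (basis_vec j) - q0 P)
    + 2 * ((cos \<theta>)\<^sup>2 - (sin \<theta>)\<^sup>2) * cross_re w P j)"
  define h2 where "h2 = (\<lambda>P \<theta>. 2 * ((cos \<theta>)\<^sup>2 - (sin \<theta>)\<^sup>2) * (q d P (basis_vec j) - q0 P)
    - 8 * sin \<theta> * cos \<theta> * cross_re w P j)"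
  define g where "g = (\<lambda>P \<theta>. \<phi> (h P \<theta>))"
  define g1 where "g1 = (\<lambda>P \<theta>. \<phi>1 (h P \<theta>) * h1 P \<theta>)"
  define g2 where "g2 = (\<lambda>P \<theta>. \<phi>2 (h P \<theta>) * (h1 P \<theta>)\<^sup>2 + \<phi>1 (h P \<theta>) * h2 P \<theta>)"
  have hq: "h P \<theta> = q d P (x \<theta>)" if "P \<in> Proj n d" for P \<theta>
    using q_rotation(1)[OF that w j] by (simp add: h_def x_def cross_re_def)
  have xu: "x \<theta> \<in> usphere d" for \<theta>
  proof -
    obtain P where "P \<in> space \<mu>" using not_empty by blast
    then show ?thesis unfolding x_def using q_rotation(2)[OF _ w j] by (simp add: space_mu)
  qed
  have dh: "(h P has_real_derivative h1 P \<theta>) (at \<theta>)" "(h1 P has_real_derivative h2 P \<theta>) (at \<theta>)" for P \<theta>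
    unfolding h_def h1_def h2_def by (rule trig_form_derivs)+
  have dg1: "(g P has_real_derivative g1 P \<theta>) (at \<theta>)" for P \<theta>
    unfolding g_def g1_def by (rule DERIV_chain2[OF \<phi>(1) dh(1)])
  have dg2: "(g1 P has_real_derivative g2 P \<theta>) (at \<theta>)" for P \<theta>
    unfolding g1_def g2_def
    by (rule derivative_eq_intros DERIV_chain2[OF \<phi>(2) dh(1)] dh refl)+
       (simp add: power2_eq_square)
  have cg2: "isCont (g2 P) 0" for P
  proof -
    have "isCont (h P) 0" "isCont (h1 P) 0" "isCont (h2 P) 0"
      unfolding h_def h1_def h2_def by (intro continuous_intros)+
    moreover have "isCont \<phi>1 (h P 0)" "isCont \<phi>2 (h P 0)"
      using contphi cont by (auto simp: continuous_on_eq_continuous_at)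
    ultimately have "isCont (\<lambda>\<theta>. \<phi>2 (h P \<theta>)) 0" "isCont (\<lambda>\<theta>. \<phi>1 (h P \<theta>)) 0"
        "isCont (h1 P) 0" "isCont (h2 P) 0"
      by (auto intro: isCont_o2)
    then show ?thesis unfolding g2_def by (intro isCont_add isCont_mult isCont_power)
  qed
  \<comment> \<open>Crude bounds: the first derivative of \<open>h\<close> is at most \<open>6\<close>, the second at most \<open>12\<close>.\<close>
  define B where "B = B2 * 6\<^sup>2 + B1 * 12"
  have trig: "\<bar>2 * sin \<theta> * cos \<theta>\<bar> \<le> 1" "\<bar>(cos \<theta>)\<^sup>2 - (sin \<theta>)\<^sup>2\<bar> \<le> 1" for \<theta> :: real
    by (auto simp flip: sin_double cos_double)
  have bg2: "\<bar>g2 P \<theta>\<bar> \<le> B" if P: "P \<in> Proj n d" for P \<theta>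
  proof -
    have qq: "\<bar>q0 P\<bar> \<le> 1" "\<bar>q d P (basis_vec j)\<bar> \<le> 1" "\<bar>cross_re w P j\<bar> \<le> 1"
      using q_bound[OF P] cross_re_bound[OF P w j(2)] d_pos j by auto
    have hb: "\<bar>h P \<theta>\<bar> \<le> 1" using hq[OF P] q_bound[OF P xu] by simp
    have df: "\<bar>q d P (basis_vec j) - q0 P\<bar> \<le> 2" using qq by linarith
    have m1: "\<bar>2 * sin \<theta> * cos \<theta> * (q d P (basis_vec j) - q0 P)\<bar> \<le> 1 * 2"
      unfolding abs_mult[of "2 * sin \<theta> * cos \<theta>"] by (intro mult_mono trig df) auto
    have m2: "\<bar>((cos \<theta>)\<^sup>2 - (sin \<theta>)\<^sup>2) * cross_re w P j\<bar> \<le> 1 * 1"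
      unfolding abs_mult by (intro mult_mono trig qq) auto
    have m3: "\<bar>((cos \<theta>)\<^sup>2 - (sin \<theta>)\<^sup>2) * (q d P (basis_vec j) - q0 P)\<bar> \<le> 1 * 2"
      unfolding abs_mult by (intro mult_mono trig df) auto
    have m4: "\<bar>2 * sin \<theta> * cos \<theta> * cross_re w P j\<bar> \<le> 1 * 1"
      unfolding abs_mult[of "2 * sin \<theta> * cos \<theta>"] by (intro mult_mono trig qq) auto
    have "h1 P \<theta> = 2 * sin \<theta> * cos \<theta> * (q d P (basis_vec j) - q0 P) + 2 * (((cos \<theta>)\<^sup>2 - (sin \<theta>)\<^sup>2) * cross_re w P j)"
      by (simp add: h1_def)
    then have h1b: "\<bar>h1 P \<theta>\<bar> \<le> 6" using m1 m2 by linarith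
    have "h2 P \<theta> = 2 * (((cos \<theta>)\<^sup>2 - (sin \<theta>)\<^sup>2) * (q d P (basis_vec j) - q0 P)) - 4 * (2 * sin \<theta> * cos \<theta> * cross_re w P j)"
      by (simp add: h2_def)
    then have h2b: "\<bar>h2 P \<theta>\<bar> \<le> 12" using m3 m4 by linarith
    have "\<bar>\<phi>2 (h P \<theta>) * (h1 P \<theta>)\<^sup>2\<bar> \<le> B2 * 6\<^sup>2"
      unfolding abs_mult using h1b \<open>0 \<le> B2\<close> by (intro mult_mono B hb) (auto simp: abs_le_square_iff[of _ 6, simplified])
    moreover have "\<bar>\<phi>1 (h P \<theta>) * h2 P \<theta>\<bar> \<le> B1 * 12"
      unfolding abs_mult using h2b \<open>0 \<le> B1\<close> by (intro mult_mono B hb) auto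
    ultimately show ?thesis unfolding g2_def B_def by linarith
  qed
  have gint: "integrable \<mu> (\<lambda>P. g P \<theta>)" and gE: "expectation (\<lambda>P. g P \<theta>) = expectation (\<lambda>P. g P 0)" for \<theta>
  proof -
    have "bounded (\<phi> ` {-1..1})"
      using contphi by (auto intro!: compact_imp_bounded compact_continuous_image intro: continuous_on_subset)
    then obtain B0 where "\<forall>u\<in>{-1..1}. \<bar>\<phi> u\<bar> \<le> B0"
      unfolding bounded_iff by auto
    then have B0: "\<And>u. \<bar>u\<bar> \<le> 1 \<Longrightarrow> \<bar>\<phi> u\<bar> \<le> B0" by (auto simp: abs_le_iff[of _ 1])
    show "integrable \<mu> (\<lambda>P. g P \<theta>)" for \<theta>
    proof (rule integrable_bounded[of _ B0])
      show "(\<lambda>P. g P \<theta>) \<in> borel_measurable \<mu>" unfolding g_def h_def by measurable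
      show "\<bar>g P \<theta>\<bar> \<le> B0" if "P \<in> Proj n d" for P
        unfolding g_def hq[OF that] by (intro B0 q_bound[OF that xu])
    qed
    have e: "expectation (\<lambda>P. g P \<theta>) = expectation (\<lambda>P. \<phi> (q d P (x \<theta>)))" for \<theta>
      by (intro Bochner_Integration.integral_cong) (auto simp: g_def hq space_mu)
    show "expectation (\<lambda>P. g P \<theta>) = expectation (\<lambda>P. g P 0)"
      unfolding e by (intro expectation_q_transport xu) measurable
  qed
  let ?s = "\<lambda>k P. (g P (1 / real (Suc k)) + g P (- (1 / real (Suc k))) - 2 * g P 0) * (real (Suc k))\<^sup>2"
  have "(\<lambda>k. expectation (?s k)) \<longlonglongrightarrow> expectation (\<lambda>P. g2 P 0)"
  proof (rule integral_dominated_convergence[where w = "\<lambda>_. B"])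
    show "(\<lambda>P. g2 P 0) \<in> borel_measurable \<mu>" unfolding g2_def h_def h1_def h2_def by measurable
    show "?s k \<in> borel_measurable \<mu>" for k unfolding g_def h_def by measurable
    show "AE P in \<mu>. (\<lambda>k. ?s k P) \<longlonglongrightarrow> g2 P 0"
      by (intro always_eventually allI second_difference_tendsto[OF dg1 dg2 cg2])
    show "AE P in \<mu>. norm (?s k P) \<le> B" for k
    proof (intro AE_I2)
      fix P assume "P \<in> space \<mu>"
      then have "\<bar>g P (1 / real (Suc k)) + g P (- (1 / real (Suc k))) - 2 * g P 0\<bar> \<le> B * (1 / real (Suc k))\<^sup>2"
        by (intro second_difference_bound[OF dg1 dg2 bg2]) (simp add: space_mu)
      then have "\<bar>g P (1 / real (Suc k)) + g P (- (1 / real (Suc k))) - 2 * g P 0\<bar> * (real (Suc k))\<^sup>2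
        \<le> B * (1 / real (Suc k))\<^sup>2 * (real (Suc k))\<^sup>2" by (rule mult_right_mono) simp
      also have "\<dots> = B" by (simp add: power_divide)
      finally show "norm (?s k P) \<le> B" by (simp add: abs_mult)
    qed
  qed simp
  moreover have "expectation (?s k) = 0" for k
    using gint gE[of "1 / real (Suc k)"] gE[of "- (1 / real (Suc k))"] by simp
  ultimately have e0: "expectation (\<lambda>P. g2 P 0) = 0" by (simp add: LIMSEQ_const_iff)
  have e2: "g2 P 0 = 2 * (2 * \<phi>2 (q0 P) * (cross_re w P j)\<^sup>2 + \<phi>1 (q0 P) * (q d P (basis_vec j) - q0 P))" for P
    by (simp add: g2_def h_def h1_def h2_def power_mult_distrib algebra_simps)
  have "2 * expectation (\<lambda>P. 2 * \<phi>2 (q0 P) * (cross_re w P j)\<^sup>2 + \<phi>1 (q0 P) * (q d P (basis_vec j) - q0 P))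
      = expectation (\<lambda>P. g2 P 0)"
    unfolding e2 by (rule integral_mult_right_zero[symmetric])
  then show ?thesis unfolding e0 by simp
qed

lemma integrable_q:
  assumes "continuous_on UNIV f" "x \<in> usphere d"
  shows "integrable \<mu> (\<lambda>P. f (q d P x) :: real)"
proof -
  have [measurable]: "f \<in> borel_measurable borel"
    using assms by (auto intro: borel_measurable_continuous_onI)
  have "bounded (f ` {-1..1})"
    using assms by (auto intro!: compact_imp_bounded compact_continuous_image intro: continuous_on_subset)
  then obtain B where "\<forall>u\<in>{-1..1}. \<bar>f u\<bar> \<le> B" unfolding bounded_iff by auto
  then show ?thesis
    using q_bound[of _ n d x] assms(2) by (intro integrable_bounded[of _ B]) (force simp: abs_le_iff)+
qed

lemma integrable_mult_bounded:
  assumes "integrable \<mu> f" "g \<in> borel_measurable \<mu>" "\<And>P. P \<in> Proj n d \<Longrightarrow> \<bar>g P\<bar> \<le> (B::real)"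
  shows "integrable \<mu> (\<lambda>P. f P * g P)"
proof (rule Bochner_Integration.integrable_bound[where f = "\<lambda>P. B * f P"])
  show "AE P in \<mu>. norm (f P * g P) \<le> norm (B * f P)"
  proof (rule AE_I2)
    fix P assume "P \<in> space \<mu>"
    then have "\<bar>g P\<bar> \<le> \<bar>B\<bar>" using assms(3)[of P] by (simp add: space_mu)
    then have "\<bar>f P\<bar> * \<bar>g P\<bar> \<le> \<bar>f P\<bar> * \<bar>B\<bar>" by (rule mult_left_mono) simp
    then show "norm (f P * g P) \<le> norm (B * f P)" by (simp add: abs_mult mult.commute)
  qed
qed (use assms in auto)

text \<open>
The off-diagonal part of the first row of the reflection, seen from the two phases \<open>1\<close> and \<open>rot\<close>.
It agrees with the squared norm of that part up to a factor of at most \<open>2\<close>, and the rows of a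
reflection are unit vectors.
\<close>

definition cross_sq :: "'a mat \<Rightarrow> real" where
  "cross_sq P = (\<Sum>j\<in>{1..<d}. (cross_re 1 P j)\<^sup>2 + (cross_re (cj rot) P j)\<^sup>2)"

lemma cross_sq_bounds:
  assumes P: "P \<in> Proj n d"
  shows "1 - (q0 P)\<^sup>2 \<le> cross_sq P" "cross_sq P \<le> 2 * (1 - (q0 P)\<^sup>2)"
proof -
  let ?s = "\<lambda>j. refl_form d P (basis_vec 0) (basis_vec j)"
  have split: "{..<d} = insert 0 {1..<d}" using d_pos by auto
  have "norm (?s 0) = \<bar>q0 P\<bar>" unfolding refl_form_real[OF P] by simp
  then have sum1: "(\<Sum>j\<in>{1..<d}. (norm (?s j))\<^sup>2) = 1 - (q0 P)\<^sup>2"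
    using refl_form_row_norm[OF P basis_vec_unit[OF d_pos]] unfolding split by simp
  have cross_re: "cross_re 1 P j = re (?s j)" "cross_re (cj rot) P j = re (rot * ?s j)" for j
    by (simp_all add: cross_re_def)
  show "1 - (q0 P)\<^sup>2 \<le> cross_sq P"
    unfolding cross_sq_def sum1[symmetric] cross_re by (intro sum_mono norm_le_re_rot)
  have "(re z)\<^sup>2 + (re (rot * z))\<^sup>2 \<le> 2 * (norm z)\<^sup>2" for z :: 'a
  proof -
    have "\<bar>re z\<bar>\<^sup>2 \<le> (norm z)\<^sup>2" "\<bar>re (rot * z)\<bar>\<^sup>2 \<le> (norm (rot * z))\<^sup>2"
      by (intro power_mono abs_re_le abs_ge_zero)+
    then show ?thesis by (simp add: norm_mult norm_rot)
  qed
  then show "cross_sq P \<le> 2 * (1 - (q0 P)\<^sup>2)"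
    unfolding cross_sq_def sum1[symmetric] cross_re sum_distrib_left by (intro sum_mono)
qed

lemma cross_sq_measurable [measurable]: "cross_sq \<in> borel_measurable \<mu>"
  unfolding cross_sq_def by measurable

lemma cross_sq_integrable:
  assumes "continuous_on UNIV f"
  shows "integrable \<mu> (\<lambda>P. f (q0 P) * cross_sq P)"
proof (rule integrable_mult_bounded[OF integrable_q[OF assms basis_vec_unit[OF d_pos]], where B = 2])
  fix P :: "'a mat" assume "P \<in> Proj n d"
  then show "\<bar>cross_sq P\<bar> \<le> 2"
    using cross_sq_bounds[of P] by (simp add: abs_le_iff) 
      (smt (verit) q_bound basis_vec_unit d_pos abs_square_le_1 zero_le_power2)
qed measurable

text \<open>
Summing \<open>Stein_single\<close> over all coordinates and both phases removes everything but the first diagonal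
entry: the remaining diagonal entries add up to \<open>- q0 P\<close>, because the reflection has trace zero.
This is an integration by parts for the law of \<open>q\<close>, which is concentrated like a Gaussian of variance
about \<open>1 / n\<close>.
\<close>

lemma Stein_identity:
  fixes \<phi> \<phi>1 \<phi>2 :: "real \<Rightarrow> real"
  assumes \<phi>: "\<And>u. (\<phi> has_real_derivative \<phi>1 u) (at u)" "\<And>u. (\<phi>1 has_real_derivative \<phi>2 u) (at u)"
    and cont: "continuous_on UNIV \<phi>2"
  shows "expectation (\<lambda>P. \<phi>2 (q0 P) * cross_sq P) = 2 * real n * expectation (\<lambda>P. \<phi>1 (q0 P) * q0 P)"
proof -
  have cont1: "continuous_on UNIV \<phi>1"
    using \<phi> by (auto intro!: continuous_at_imp_continuous_on DERIV_isCont)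
  note u0 = basis_vec_unit[OF d_pos]
  have nrot: "norm (cj rot :: 'a) = 1" by (simp add: norm_rot)
  define T where "T = (\<lambda>w P j. 2 * \<phi>2 (q0 P) * (cross_re w P j)\<^sup>2 + \<phi>1 (q0 P) * (q d P (basis_vec j) - q0 P))"
  have int: "integrable \<mu> (\<lambda>P. T w P j)" if w: "norm w = 1" and j: "j < d" for w j
    unfolding T_def
  proof (intro Bochner_Integration.integrable_add)
    show "integrable \<mu> (\<lambda>P. 2 * \<phi>2 (q0 P) * (cross_re w P j)\<^sup>2)"
      by (rule integrable_mult_bounded[where B = 1])
        (use cross_re_bound[OF _ w j] in \<open>auto intro!: integrable_q[OF cont u0] simp: abs_square_le_1\<close>)
    show "integrable \<mu> (\<lambda>P. \<phi>1 (q0 P) * (q d P (basis_vec j) - q0 P))"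
    proof (rule integrable_mult_bounded[where B = 2])
      show "\<bar>q d P (basis_vec j) - q0 P\<bar> \<le> 2" if "P \<in> Proj n d" for P :: "'a mat"
        using q_bound[OF that basis_vec_unit[OF j]] q_bound[OF that u0] by linarith
    qed (auto intro: integrable_q[OF cont1 u0])
  qed
  have z: "expectation (\<lambda>P. T w P j) = 0" if "norm w = 1" "j \<in> {1..<d}" for w j
    unfolding T_def using that by (intro Stein_single[OF \<phi> cont]) auto
  have "expectation (\<lambda>P. \<Sum>j\<in>{1..<d}. T 1 P j + T (cj rot) P j) = 
    (\<Sum>j\<in>{1..<d}. expectation (\<lambda>P. T 1 P j) + expectation (\<lambda>P. T (cj rot) P j))"
    using int nrot by (subst Bochner_Integration.integral_sum) auto
  also have "\<dots> = 0" using z nrot by simp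
  finally have 0: "expectation (\<lambda>P. \<Sum>j\<in>{1..<d}. T 1 P j + T (cj rot) P j) = 0" .
  have "expectation (\<lambda>P. \<Sum>j\<in>{1..<d}. T 1 P j + T (cj rot) P j) =
    expectation (\<lambda>P. 2 * (\<phi>2 (q0 P) * cross_sq P) - 4 * real n * (\<phi>1 (q0 P) * q0 P))"
  proof (intro Bochner_Integration.integral_cong refl)
    fix P assume "P \<in> space \<mu>"
    then have P: "P \<in> Proj n d" by (simp add: space_mu)
    have "{..<d} = insert 0 {1..<d}" using d_pos by auto
    then have "(\<Sum>j\<in>{1..<d}. q d P (basis_vec j)) = - q0 P"
      using q_trace[of P n] P by (simp add: d_eq)
    then have dsum: "(\<Sum>j\<in>{1..<d}. q d P (basis_vec j) - q0 P) = - (2 * real n * q0 P)"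
      using n_pos by (simp add: sum_subtractf d_eq of_nat_diff algebra_simps)
    have "(\<Sum>j\<in>{1..<d}. T 1 P j + T (cj rot) P j)
      = (\<Sum>j\<in>{1..<d}. 2 * \<phi>2 (q0 P) * ((cross_re 1 P j)\<^sup>2 + (cross_re (cj rot) P j)\<^sup>2)
          + 2 * \<phi>1 (q0 P) * (q d P (basis_vec j) - q0 P))"
      by (intro sum.cong) (auto simp: T_def algebra_simps)
    also have "\<dots> = 2 * \<phi>2 (q0 P) * cross_sq P + 2 * \<phi>1 (q0 P) * (\<Sum>j\<in>{1..<d}. q d P (basis_vec j) - q0 P)"
      by (simp only: sum.distrib cross_sq_def flip: sum_distrib_left)
    finally show "(\<Sum>j\<in>{1..<d}. T 1 P j + T (cj rot) P j)
      = 2 * (\<phi>2 (q0 P) * cross_sq P) - 4 * real n * (\<phi>1 (q0 P) * q0 P)"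
      unfolding dsum by simp
  qed
  also have "\<dots> = 2 * expectation (\<lambda>P. \<phi>2 (q0 P) * cross_sq P) - 4 * real n * expectation (\<lambda>P. \<phi>1 (q0 P) * q0 P)"
  proof -
    have "integrable \<mu> (\<lambda>P. \<phi>1 (q0 P) * q0 P)"
      by (rule integrable_q[OF _ u0]) (intro continuous_on_mult cont1 continuous_on_id)
    then show ?thesis
      using cross_sq_integrable[OF cont] by (subst Bochner_Integration.integral_diff) auto
  qed
  finally show ?thesis using 0 by simp
qed

lemma q0_sq_integrable: "integrable \<mu> (\<lambda>P. (q0 P)\<^sup>2)"
  by (rule integrable_q[OF _ basis_vec_unit[OF d_pos]]) (intro continuous_intros)

lemma q0_abs_integrable: "integrable \<mu> (\<lambda>P. \<bar>q0 P\<bar>)"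
  by (rule integrable_q[OF _ basis_vec_unit[OF d_pos]]) (intro continuous_intros)

section \<open>Mean size and small-ball probability\<close>

lemma second_moment_le: "expectation (\<lambda>P. (q0 P)\<^sup>2) \<le> 1 / (real n + 1)"
proof -
  note u0 = basis_vec_unit[OF d_pos]
  have "expectation (\<lambda>P. 1 * cross_sq P) = 2 * real n * expectation (\<lambda>P. q0 P * q0 P)"
    by (rule Stein_identity[of "\<lambda>u. u\<^sup>2 / 2" "\<lambda>u. u" "\<lambda>_. 1"])
      (auto intro!: derivative_eq_intros)
  moreover have "expectation (\<lambda>P. 1 * cross_sq P) \<le> expectation (\<lambda>P. 2 * (1 - (q0 P)\<^sup>2))"
  proof (rule integral_mono)
    show "integrable \<mu> (\<lambda>P. 1 * cross_sq P)" by (rule cross_sq_integrable) simp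
    show "integrable \<mu> (\<lambda>P. 2 * (1 - (q0 P)\<^sup>2))"
      by (rule integrable_q[OF _ u0]) (intro continuous_intros)
  qed (use cross_sq_bounds in \<open>simp add: space_mu\<close>)
  moreover have "expectation (\<lambda>P. 2 * (1 - (q0 P)\<^sup>2)) = 2 * (1 - expectation (\<lambda>P. (q0 P)\<^sup>2))"
    using q0_sq_integrable by (simp add: prob_space)
  ultimately have "(real n + 1) * expectation (\<lambda>P. (q0 P)\<^sup>2) \<le> 1"
    by (simp add: power2_eq_square algebra_simps)
  then show ?thesis by (simp add: field_simps)
qed

text \<open>
The Stein identity for the smooth absolute value. The left-hand side is large when \<open>q\<close> has much mass
within distance \<open>l\<close> of zero. Read from left to right it bounds this mass; read from right to left
it bounds the mean of \<open>\<bar>q\<bar>\<close> from below.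
\<close>

lemma Stein_smooth_abs:
  assumes l: "l > 0"
  shows "expectation (\<lambda>P. l\<^sup>2 / (sqrt (l\<^sup>2 + (q0 P)\<^sup>2)) ^ 3 * (1 - (q0 P)\<^sup>2))
    \<le> 2 * real n * expectation (\<lambda>P. \<bar>q0 P\<bar>)"
proof -
  note u0 = basis_vec_unit[OF d_pos]
  note D = smooth_abs_derivs[OF l]
  have c1: "continuous_on UNIV (\<lambda>u. u / sqrt (l\<^sup>2 + u\<^sup>2))"
    using D(2) by (auto intro!: continuous_at_imp_continuous_on DERIV_isCont)
  have "expectation (\<lambda>P. l\<^sup>2 / (sqrt (l\<^sup>2 + (q0 P)\<^sup>2)) ^ 3 * (1 - (q0 P)\<^sup>2))
    \<le> expectation (\<lambda>P. l\<^sup>2 / (sqrt (l\<^sup>2 + (q0 P)\<^sup>2)) ^ 3 * cross_sq P)"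
  proof (rule integral_mono)
    show "integrable \<mu> (\<lambda>P. l\<^sup>2 / (sqrt (l\<^sup>2 + (q0 P)\<^sup>2)) ^ 3 * (1 - (q0 P)\<^sup>2))"
      by (rule integrable_q[OF _ u0]) (rule smooth_abs_weight_continuous[OF l])
    show "integrable \<mu> (\<lambda>P. l\<^sup>2 / (sqrt (l\<^sup>2 + (q0 P)\<^sup>2)) ^ 3 * cross_sq P)"
      by (rule cross_sq_integrable[OF D(3)])
    fix P assume "P \<in> space \<mu>"
    then show "l\<^sup>2 / (sqrt (l\<^sup>2 + (q0 P)\<^sup>2)) ^ 3 * (1 - (q0 P)\<^sup>2) \<le> l\<^sup>2 / (sqrt (l\<^sup>2 + (q0 P)\<^sup>2)) ^ 3 * cross_sq P"
      using cross_sq_bounds(1) by (intro mult_left_mono) (auto simp: space_mu)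
  qed
  also have "\<dots> = 2 * real n * expectation (\<lambda>P. q0 P / sqrt (l\<^sup>2 + (q0 P)\<^sup>2) * q0 P)"
    by (rule Stein_identity[OF D])
  also have "\<dots> \<le> 2 * real n * expectation (\<lambda>P. \<bar>q0 P\<bar>)"
  proof (intro mult_left_mono integral_mono)
    show "integrable \<mu> (\<lambda>P. q0 P / sqrt (l\<^sup>2 + (q0 P)\<^sup>2) * q0 P)"
      by (rule integrable_q[OF _ u0]) (intro continuous_on_mult c1 continuous_on_id)
    show "integrable \<mu> (\<lambda>P. \<bar>q0 P\<bar>)"
      by (rule q0_abs_integrable)
    fix P
    have s: "\<bar>q0 P\<bar> \<le> sqrt (l\<^sup>2 + (q0 P)\<^sup>2)" "0 < sqrt (l\<^sup>2 + (q0 P)\<^sup>2)"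
      using l by (auto intro!: real_le_rsqrt add_pos_nonneg)
    have "q0 P / sqrt (l\<^sup>2 + (q0 P)\<^sup>2) * q0 P = \<bar>q0 P\<bar> / sqrt (l\<^sup>2 + (q0 P)\<^sup>2) * \<bar>q0 P\<bar>"
      by (simp flip: abs_mult)
    also have "\<dots> \<le> 1 * \<bar>q0 P\<bar>" using s by (intro mult_right_mono) (auto simp: divide_le_eq_1)
    finally show "q0 P / sqrt (l\<^sup>2 + (q0 P)\<^sup>2) * q0 P \<le> \<bar>q0 P\<bar>" by simp
  qed simp
  finally show ?thesis .
qed

text \<open>
At scale \<open>l = 2 / sqrt n\<close> the second moment bound shows that a fixed fraction of the mass of \<open>q\<close> lies in
the bump, which makes the left-hand side of \<open>Stein_smooth_abs\<close> at least of order \<open>sqrt n\<close>.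
\<close>

lemma mean_abs_ge_basis: "1 / (16 * sqrt (real n)) \<le> expectation (\<lambda>P. \<bar>q0 P\<bar>)"
proof -
  note u0 = basis_vec_unit[OF d_pos]
  define l where "l = 2 / sqrt (real n)"
  have n: "real n > 0" using n_pos by simp
  have l: "l > 0" using n by (simp add: l_def)
  have l2: "2 / l\<^sup>2 = real n / 2" using n by (simp add: l_def power_divide)
  note intq = q0_sq_integrable
  have "sqrt (real n) / 8 = (1 / l) * (1 / 4)" by (simp add: l_def)
  also have "\<dots> \<le> (1 / l) * (1 - (1 + real n / 2) * (1 / (real n + 1)))"
  proof (intro mult_left_mono)
    have "(1 + real n / 2) * (1 / (real n + 1)) \<le> 3 / 4" using n_pos by (simp add: field_simps)
    then show "1 / 4 \<le> 1 - (1 + real n / 2) * (1 / (real n + 1))" by simp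
  qed (use l in simp)
  also have "\<dots> \<le> (1 / l) * (1 - (1 + real n / 2) * expectation (\<lambda>P. (q0 P)\<^sup>2))"
    using second_moment_le l by (intro mult_left_mono diff_left_mono) auto
  also have "\<dots> = expectation (\<lambda>P. (1 / l) * (1 - (1 + 2 / l\<^sup>2) * (q0 P)\<^sup>2))"
    using intq by (simp add: prob_space l2)
  also have "\<dots> = expectation (\<lambda>P. (1 - (q0 P)\<^sup>2 - 2 * (q0 P)\<^sup>2 / l\<^sup>2) / l)"
    using l by (intro Bochner_Integration.integral_cong refl) (simp add: field_simps)
  also have "\<dots> \<le> expectation (\<lambda>P. l\<^sup>2 / (sqrt (l\<^sup>2 + (q0 P)\<^sup>2)) ^ 3 * (1 - (q0 P)\<^sup>2))"
  proof (rule integral_mono)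
    show "integrable \<mu> (\<lambda>P. (1 - (q0 P)\<^sup>2 - 2 * (q0 P)\<^sup>2 / l\<^sup>2) / l)" using intq by simp
    show "integrable \<mu> (\<lambda>P. l\<^sup>2 / (sqrt (l\<^sup>2 + (q0 P)\<^sup>2)) ^ 3 * (1 - (q0 P)\<^sup>2))"
      by (rule integrable_q[OF _ u0]) (rule smooth_abs_weight_continuous[OF l])
    fix P assume "P \<in> space \<mu>"
    then show "(1 - (q0 P)\<^sup>2 - 2 * (q0 P)\<^sup>2 / l\<^sup>2) / l \<le> l\<^sup>2 / (sqrt (l\<^sup>2 + (q0 P)\<^sup>2)) ^ 3 * (1 - (q0 P)\<^sup>2)"
      by (intro smooth_abs_lower[OF l] q_bound[OF _ u0]) (simp add: space_mu)
  qed
  also have "\<dots> \<le> 2 * real n * expectation (\<lambda>P. \<bar>q0 P\<bar>)" by (rule Stein_smooth_abs[OF l])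
  finally have le: "sqrt (real n) \<le> 16 * real n * expectation (\<lambda>P. \<bar>q0 P\<bar>)" by simp
  define c M where "c = sqrt (real n)" and "M = expectation (\<lambda>P. \<bar>q0 P\<bar>)"
  have c: "real n = c * c" "c > 0" using n by (simp_all add: c_def)
  have "c * 1 \<le> c * (16 * c * M)"
    using le unfolding c_def[symmetric] M_def[symmetric] unfolding c(1) by (simp add: mult_ac)
  then have "1 \<le> 16 * c * M" using c(2) by (rule mult_left_le_imp_le)
  then show ?thesis using c(2) unfolding c_def[symmetric] M_def[symmetric] by (simp add: field_simps)
qed

lemma mean_abs_ge:
  assumes "x \<in> usphere d"
  shows "1 / (16 * sqrt (real n)) \<le> expectation (\<lambda>P. \<bar>q d P x\<bar>)"
  using mean_abs_ge_basis expectation_q_transport[OF assms basis_vec_unit[OF d_pos], of abs] by simp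

text \<open>
The second derivative of the smooth absolute value dominates \<open>1 / (4 * l)\<close> times the indicator of
\<open>[-l, l]\<close>. The final estimate sees this bound only through a logarithm, so the power of \<open>n\<close> is
immaterial.
\<close>

lemma anticoncentration:
  assumes x: "x \<in> usphere d" and l: "0 < l" "l \<le> 1"
  shows "prob {P \<in> space \<mu>. \<bar>q d P x\<bar> \<le> l} \<le> 12 * real n * l"
proof -
  note u0 = basis_vec_unit[OF d_pos]
  let ?f = "\<lambda>u. l\<^sup>2 / (sqrt (l\<^sup>2 + u\<^sup>2)) ^ 3"
  have sqrt_pos: "0 < sqrt (l\<^sup>2 + u\<^sup>2)" for u using l by (auto intro!: add_pos_nonneg)
  have cf: "continuous_on UNIV ?f" by (rule smooth_abs_derivs(3)[OF l(1)])
  have f1: "indicator {-l..l} u \<le> 4 * l * ?f u" for u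
  proof (cases "\<bar>u\<bar> \<le> l")
    case True
    let ?s = "sqrt (l\<^sup>2 + u\<^sup>2)"
    have "u\<^sup>2 \<le> l\<^sup>2" using True l by (simp add: abs_le_square_iff[symmetric])
    then have "?s\<^sup>2 \<le> 2 * l\<^sup>2" by simp
    moreover have "?s \<le> 2 * l" 
    proof (rule real_le_lsqrt)
      have "l\<^sup>2 + u\<^sup>2 \<le> 4 * l\<^sup>2" using \<open>u\<^sup>2 \<le> l\<^sup>2\<close> zero_le_power2[of l] by linarith
      then show "l\<^sup>2 + u\<^sup>2 \<le> (2 * l)\<^sup>2" by (simp add: power_mult_distrib)
    qed (use l in auto)
    ultimately have "?s * ?s\<^sup>2 \<le> (2 * l) * (2 * l\<^sup>2)" using l by (intro mult_mono) auto
    moreover have "?s ^ 3 = ?s * ?s\<^sup>2" by (simp only: power3_eq_cube power2_eq_square mult.assoc)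
    ultimately have "?s ^ 3 \<le> 4 * l * l\<^sup>2" by (simp only: mult_ac)
    then have "1 \<le> 4 * l * ?f u" using sqrt_pos[of u] by (simp add: field_simps)
    then show ?thesis using True by (auto simp: indicator_def)
  next
    case False
    then show ?thesis using l sqrt_pos[of u] by (auto simp: indicator_def abs_le_iff)
  qed
  have f2: "?f u \<le> ?f u * (1 - u\<^sup>2) + l" for u
  proof -
    let ?s = "sqrt (l\<^sup>2 + u\<^sup>2)"
    have "l \<le> ?s" by (rule real_le_rsqrt) simp
    then have "l * u\<^sup>2 \<le> ?s * ?s\<^sup>2" using l by (intro mult_mono) auto
    then have "l * (l * u\<^sup>2) \<le> l * (?s * ?s\<^sup>2)" using l by (intro mult_left_mono) auto
    moreover have "?s ^ 3 = ?s * ?s\<^sup>2" by (simp only: power3_eq_cube power2_eq_square mult.assoc)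
    ultimately have "l\<^sup>2 * u\<^sup>2 \<le> l * ?s ^ 3" by (simp only: power2_eq_square mult.assoc)
    then have "?f u * u\<^sup>2 \<le> l" using sqrt_pos[of u] by (simp add: pos_divide_le_eq)
    then show ?thesis unfolding right_diff_distrib by simp
  qed
  have if1: "integrable \<mu> (\<lambda>P. ?f (q0 P))" using integrable_q[OF cf u0] .
  have if2: "integrable \<mu> (\<lambda>P. ?f (q0 P) * (1 - (q0 P)\<^sup>2))"
    by (rule integrable_q[OF _ u0]) (rule smooth_abs_weight_continuous[OF l(1)])
  note iabs = q0_abs_integrable
  have "prob {P \<in> space \<mu>. \<bar>q d P x\<bar> \<le> l} = expectation (indicator {P \<in> space \<mu>. \<bar>q d P x\<bar> \<le> l})"
    by simp
  also have "\<dots> = expectation (\<lambda>P. indicator {-l..l} (q d P x))"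
    by (intro Bochner_Integration.integral_cong) (auto simp: indicator_def abs_le_iff)
  also have "\<dots> = expectation (\<lambda>P. indicator {-l..l} (q0 P))"
    by (intro expectation_q_transport x u0) simp
  also have "\<dots> \<le> expectation (\<lambda>P. 4 * l * ?f (q0 P))"
  proof (rule integral_mono)
    show "integrable \<mu> (\<lambda>P. indicator {-l..l} (q0 P) :: real)"
      by (rule integrable_bounded[of _ 1]) (auto simp: indicator_def)
    show "integrable \<mu> (\<lambda>P. 4 * l * ?f (q0 P))" by (rule integrable_mult_right) (rule if1)
  qed (rule f1)
  also have "\<dots> = 4 * l * expectation (\<lambda>P. ?f (q0 P))" by (rule integral_mult_right_zero)
  also have "\<dots> \<le> 4 * l * expectation (\<lambda>P. ?f (q0 P) * (1 - (q0 P)\<^sup>2) + l)"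
    using if1 if2 l by (intro mult_left_mono integral_mono f2) auto
  also have "\<dots> \<le> 4 * l * (3 * real n)"
  proof (rule mult_left_mono)
    have "expectation (\<lambda>P. \<bar>q0 P\<bar>) \<le> expectation (\<lambda>_. 1)"
      using iabs q_bound u0 by (intro integral_mono) (auto simp: space_mu)
    then have "2 * real n * expectation (\<lambda>P. \<bar>q0 P\<bar>) \<le> 2 * real n * 1"
      by (intro mult_left_mono) (auto simp: prob_space)
    moreover have "expectation (\<lambda>P. ?f (q0 P) * (1 - (q0 P)\<^sup>2)) \<le> 2 * real n * expectation (\<lambda>P. \<bar>q0 P\<bar>)"
      by (rule Stein_smooth_abs[OF l(1)])
    moreover have "expectation (\<lambda>P. ?f (q0 P) * (1 - (q0 P)\<^sup>2) + l) = expectation (\<lambda>P. ?f (q0 P) * (1 - (q0 P)\<^sup>2)) + l"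
      using if2 by (simp add: prob_space)
    moreover have "l \<le> real n" using l n_pos by linarith
    ultimately show "expectation (\<lambda>P. ?f (q0 P) * (1 - (q0 P)\<^sup>2) + l) \<le> 3 * real n" by linarith
  qed (use l in simp)
  finally show ?thesis using l by (simp add: mult_ac)
qed

end

section \<open>The mean gain of the true line\<close>

text \<open>
The sign with value \<open>1\<close> at zero, in accordance with the tie rule of \<open>phi\<close>.
\<close>

definition sg :: "real \<Rightarrow> real" where "sg u = (if 0 \<le> u then 1 else -1)"

lemma sg_measurable [measurable]: "sg \<in> borel_measurable borel"
  unfolding sg_def by measurable

lemma sg_simps: "sg u * u = \<bar>u\<bar>" "\<bar>sg u\<bar> = 1" "sg u = 1 \<or> sg u = -1"
  by (auto simp: sg_def)

context uniform_projection
begin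

definition sgn_corr :: "'a \<Rightarrow> nat \<Rightarrow> nat \<Rightarrow> real" where
  "sgn_corr c i j = expectation (\<lambda>P. sg (q0 P) * re (c * refl_form d P (basis_vec j) (basis_vec i)))"

lemma sgn_form_integrable:
  "integrable \<mu> (\<lambda>P. sg (q0 P) * re (c * refl_form d P x y))"
proof (rule integrable_bounded[where B = "norm c * (nrm d x * nrm d y)"])
  fix P :: "'a mat" assume P: "P \<in> Proj n d"
  have "\<bar>re (c * refl_form d P x y)\<bar> \<le> norm c * norm (refl_form d P x y)"
    by (rule order_trans[OF abs_re_le]) (simp add: norm_mult)
  also have "\<dots> \<le> norm c * (nrm d x * nrm d y)"
    by (intro mult_left_mono refl_form_bound[OF P]) auto
  finally show "\<bar>sg (q0 P) * re (c * refl_form d P x y)\<bar> \<le> norm c * (nrm d x * nrm d y)"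
    by (simp add: abs_mult sg_simps)
qed measurable

lemma sgn_form_conj:
  assumes "\<And>i. i < d \<Longrightarrow> householder d v (basis_vec 0) i = basis_vec 0 i"
  shows "expectation (\<lambda>P. sg (q0 P) * re (c * refl_form d P (householder d v x) (householder d v y)))
    = expectation (\<lambda>P. sg (q0 P) * re (c * refl_form d P x y))"
proof -
  have "q d P (householder d v (basis_vec 0)) = q0 P" for P by (intro q_cong assms)
  then have "expectation (\<lambda>P. sg (q0 P) * re (c * refl_form d P (householder d v x) (householder d v y)))
    = expectation (\<lambda>P. (\<lambda>P. sg (q0 P) * re (c * refl_form d P x y)) (reflected v P))"
    by (intro Bochner_Integration.integral_cong refl) (simp add: q_hmat_conj refl_form_hmat_conj)
  also have "\<dots> = expectation (\<lambda>P. sg (q0 P) * re (c * refl_form d P x y))"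
    by (rule expectation_conj) measurable
  finally show ?thesis .
qed

text \<open>
The reflection in the coordinate vector with index \<open>k\<close> changes the sign of the \<open>k\<close>-th row and column and
leaves \<open>q0\<close> alone if \<open>k \<noteq> 0\<close>.
\<close>

lemma sgn_corr_off_diagonal:
  assumes ij: "i < d" "j < d" "i \<noteq> j"
  shows "sgn_corr c i j = 0"
proof -
  define k where "k = (if i = 0 then j else i)"
  have k: "0 < k" "k < d" "k = i \<or> k = j" using ij by (auto simp: k_def)
  define v :: "nat \<Rightarrow> 'a" where "v = basis_vec k"
  have hc: "hcoef d v = 2" using k by (simp add: hcoef_def v_def basis_vec_sums)
  have h: "householder d v (basis_vec l) i' = (if l = k then - basis_vec l i' else basis_vec l i')" for l i'
    using k by (simp only: householder_def hc) (simp add: v_def basis_vec_sums; auto simp: basis_vec_def)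
  have h': "householder d v (basis_vec l) = (\<lambda>i'. (if l = k then -1 else 1) * basis_vec l i')" for l
    by (rule ext) (simp add: h)
  have "sgn_corr c i j = expectation (\<lambda>P. sg (q0 P) * re (c * refl_form d P (householder d v (basis_vec j)) (householder d v (basis_vec i))))"
    unfolding sgn_corr_def using k by (intro sgn_form_conj[symmetric]) (simp add: h)
  also have "\<dots> = expectation (\<lambda>P. - (sg (q0 P) * re (c * refl_form d P (basis_vec j) (basis_vec i))))"
  proof (intro Bochner_Integration.integral_cong refl)
    fix P
    have "(if j = k then -1 else 1) * cj (if i = k then -1 else 1) = (-1 :: 'a)"
      using k(3) ij(3) by auto
    moreover have "refl_form d P (householder d v (basis_vec j)) (householder d v (basis_vec i))
      = ((if j = k then -1 else 1) * cj (if i = k then -1 else 1)) * refl_form d P (basis_vec j) (basis_vec i)"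
      unfolding h' refl_form_linear(3,6) by (simp only: mult.assoc)
    ultimately show "sg (q0 P) * re (c * refl_form d P (householder d v (basis_vec j)) (householder d v (basis_vec i))) =
      - (sg (q0 P) * re (c * refl_form d P (basis_vec j) (basis_vec i)))" by simp
  qed
  also have "\<dots> = - sgn_corr c i j" by (simp add: sgn_corr_def)
  finally show ?thesis by simp
qed

text \<open>
The reflection in the difference of two coordinate vectors swaps them.
\<close>

lemma sgn_corr_diagonal_eq:
  assumes i: "0 < i" "i < d" and k: "0 < k" "k < d"
  shows "sgn_corr 1 i i = sgn_corr 1 k k"
proof (cases "i = k")
  case False
  define v :: "nat \<Rightarrow> 'a" where "v = (\<lambda>l. basis_vec i l - basis_vec k l)"
  have bi: "ip d (basis_vec l) (basis_vec l') = (if l = l' then 1 else 0 :: 'a)" if "l' < d" for l l'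
    using that by (simp add: basis_vec_sums) (simp add: basis_vec_def)
  have "(nrm d v)\<^sup>2 = 2" unfolding v_def nrm_diff_sq using i k False by (simp add: basis_vec_sums) (simp add: basis_vec_def)
  then have hc: "hcoef d v = 1" by (simp add: hcoef_def)
  have ipv: "ip d x v = x i - x k" for x using i k by (simp add: v_def ip_linear basis_vec_sums)
  have h0: "householder d v (basis_vec 0) l = basis_vec 0 l" for l
    unfolding householder_def ipv using i k by (simp add: basis_vec_def)
  have "householder d v (basis_vec i) = basis_vec k"
    unfolding householder_def ipv hc using False by (auto simp: v_def basis_vec_def)
  then show ?thesis
    using sgn_form_conj[of v 1 "basis_vec i" "basis_vec i"] h0 by (simp add: sgn_corr_def)
qed simp

text \<open>
The reflection has trace zero, the first diagonal entry correlates nonnegatively with its own sign,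
and the others all have the same correlation with it.
\<close>

lemma sgn_corr_diagonal_nonpos:
  assumes i: "0 < i" "i < d"
  shows "sgn_corr 1 i i \<le> 0"
proof -
  have "(\<Sum>j<d. sgn_corr 1 j j) = expectation (\<lambda>P. \<Sum>j<d. sg (q0 P) * q d P (basis_vec j))"
    using sgn_form_integrable[of 1]
    by (subst Bochner_Integration.integral_sum) (auto simp: sgn_corr_def q_def)
  also have "\<dots> = expectation (\<lambda>P. 0)"
    by (intro Bochner_Integration.integral_cong refl)
       (simp add: space_mu d_eq q_trace flip: sum_distrib_left)
  finally have "(\<Sum>j<d. sgn_corr 1 j j) = 0" by simp
  moreover have "{..<d} = insert 0 {1..<d}" using d_pos by auto
  moreover have "(\<Sum>j\<in>{1..<d}. sgn_corr 1 j j) = (\<Sum>j\<in>{1..<d}. sgn_corr 1 i i)"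
    using i by (intro sum.cong refl sgn_corr_diagonal_eq) auto
  ultimately have "real (d - 1) * sgn_corr 1 i i = - sgn_corr 1 0 0" by simp
  moreover have "0 \<le> sgn_corr 1 0 0"
    unfolding sgn_corr_def by (intro Bochner_Integration.integral_nonneg) (simp add: sg_simps flip: q_def)
  ultimately have "real (d - 1) * sgn_corr 1 i i \<le> 0" by simp
  moreover have "0 < real (d - 1)" using i by simp
  ultimately show ?thesis by (simp add: mult_le_0_iff)
qed

lemma sgn_q_basis_le:
  "expectation (\<lambda>P. sg (q0 P) * q d P y) \<le> (norm (y 0))\<^sup>2 * expectation (\<lambda>P. \<bar>q0 P\<bar>)"
proof -
  have "expectation (\<lambda>P. sg (q0 P) * q d P y)
    = expectation (\<lambda>P. \<Sum>i<d. \<Sum>j<d. sg (q0 P) * re (y j * cj (y i) * refl_form d P (basis_vec j) (basis_vec i)))"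
    by (subst q_def, subst refl_form_expand) (simp add: re_sum sum_distrib_left)
  also have "\<dots> = (\<Sum>i<d. \<Sum>j<d. sgn_corr (y j * cj (y i)) i j)"
    unfolding sgn_corr_def
    by (subst Bochner_Integration.integral_sum)
       (auto intro!: Bochner_Integration.integrable_sum sgn_form_integrable sum.cong
         Bochner_Integration.integral_sum)
  also have "\<dots> = (\<Sum>i<d. \<Sum>j<d. if i = j then sgn_corr (y i * cj (y i)) i i else 0)"
    by (intro sum.cong refl) (auto simp: sgn_corr_off_diagonal)
  also have "\<dots> = (\<Sum>i<d. (norm (y i))\<^sup>2 * sgn_corr 1 i i)"
  proof -
    have "sgn_corr (y i * cj (y i)) i i = (norm (y i))\<^sup>2 * sgn_corr 1 i i" for i
    proof -
      have "sgn_corr (y i * cj (y i)) i i = expectation (\<lambda>P. (norm (y i))\<^sup>2 * (sg (q0 P) * re (1 * refl_form d P (basis_vec i) (basis_vec i))))"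
        unfolding sgn_corr_def mult_conjugate re_mult_of_real by (simp add: mult_ac)
      then show ?thesis unfolding sgn_corr_def by (simp only: integral_mult_right_zero)
    qed
    then show ?thesis by (simp add: sum.delta)
  qed
  also have "\<dots> \<le> (\<Sum>i<d. if i = 0 then (norm (y 0))\<^sup>2 * sgn_corr 1 0 0 else 0)"
    by (intro sum_mono) (auto simp: mult_le_0_iff sgn_corr_diagonal_nonpos)
  also have "\<dots> = (norm (y 0))\<^sup>2 * sgn_corr 1 0 0" using d_pos by simp
  also have "sgn_corr 1 0 0 = expectation (\<lambda>P. \<bar>q0 P\<bar>)"
    by (simp add: sgn_corr_def sg_simps flip: q_def)
  finally show ?thesis .
qed

text \<open>
In mean, the true line \<open>x\<close> beats any other line \<open>y\<close> by a multiple of the squared distance. By symmetry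
the mean of \<open>sg (q d P x)\<close> times the reflection is a diagonal matrix in a basis that starts with \<open>x\<close>;
its first entry is the mean of \<open>\<bar>q\<bar>\<close> and the others are not positive.
\<close>

lemma sgn_gap:
  assumes x: "x \<in> usphere d" and y: "y \<in> usphere d"
  shows "(1 - (norm (ip d x y))\<^sup>2) * expectation (\<lambda>P. \<bar>q d P x\<bar>)
    \<le> expectation (\<lambda>P. sg (q d P x) * (q d P x - q d P y))"
proof -
  note u0 = basis_vec_unit[OF d_pos]
  obtain u v where uv: "norm u = 1" "\<forall>i<d. householder d v x i = u * basis_vec 0 i"
    using householder_transport[OF x u0] by blast
  define y' where "y' = householder d v y"
  have qx: "q d P (householder d v x) = q0 P" for P
    using q_cong[of d "householder d v x" "\<lambda>i. u * basis_vec 0 i" P] uv q_phase by metis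
  have "ip d x y = ip d (householder d v x) y'" by (simp add: y'_def ip_householder)
  also have "\<dots> = ip d (\<lambda>i. u * basis_vec 0 i) y'" using uv by (intro ip_cong) auto
  also have "\<dots> = u * cj (y' 0)"
    using basis_vec_sums(1)[OF d_pos, of y'] ip_commute[of d y' "basis_vec 0"] by (simp add: ip_linear)
  finally have nip: "norm (ip d x y) = norm (y' 0)" using uv by (simp add: norm_mult)
  note i1 = q0_abs_integrable
  have i2: "integrable \<mu> (\<lambda>P. sg (q0 P) * q d P y')"
    using sgn_form_integrable[of 1 y' y'] by (simp add: q_def)
  have "expectation (\<lambda>P. sg (q d P x) * (q d P x - q d P y))
    = expectation (\<lambda>P. (\<lambda>P. sg (q d P x) * (q d P x - q d P y)) (reflected v P))"
    by (rule expectation_conj[symmetric]) measurable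
  also have "\<dots> = expectation (\<lambda>P. \<bar>q0 P\<bar> - sg (q0 P) * q d P y')"
    by (intro Bochner_Integration.integral_cong refl)
       (simp add: q_hmat_conj qx y'_def right_diff_distrib sg_simps)
  also have "\<dots> = expectation (\<lambda>P. \<bar>q0 P\<bar>) - expectation (\<lambda>P. sg (q0 P) * q d P y')"
    by (rule Bochner_Integration.integral_diff[OF i1 i2])
  finally have "expectation (\<lambda>P. sg (q d P x) * (q d P x - q d P y))
    = expectation (\<lambda>P. \<bar>q0 P\<bar>) - expectation (\<lambda>P. sg (q0 P) * q d P y')" .
  moreover have "expectation (\<lambda>P. \<bar>q0 P\<bar>) = expectation (\<lambda>P. \<bar>q d P x\<bar>)"
    using expectation_q_transport[OF u0 x, of abs] by simp
  ultimately show ?thesis using sgn_q_basis_le[of y'] by (simp add: nip left_diff_distrib)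
qed

end

section \<open>A net of the unit sphere\<close>

text \<open>
Labels of the squares (over the reals, intervals) of a grid of mesh \<open>\<eta>\<close>.
\<close>

definition cell :: "real \<Rightarrow> 'a::rc_field \<Rightarrow> int \<times> int" where
  "cell \<eta> z = (\<lfloor>re z / \<eta>\<rfloor>, \<lfloor>re (rot * z) / \<eta>\<rfloor>)"

lemma floor_div_eq_close:
  assumes "\<eta> > 0" "\<lfloor>a / \<eta>\<rfloor> = \<lfloor>b / \<eta>\<rfloor>"
  shows "(a - b)\<^sup>2 \<le> (\<eta>::real)\<^sup>2"
proof -
  have "\<bar>a / \<eta> - b / \<eta>\<bar> < 1" using assms(2) by linarith
  then have "\<bar>a - b\<bar> \<le> \<bar>\<eta>\<bar>" using assms(1) by (simp add: field_simps flip: diff_divide_distrib)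
  then show ?thesis by (simp only: abs_le_square_iff)
qed

lemma cell_close:
  assumes "\<eta> > 0" "cell \<eta> z = cell \<eta> z'"
  shows "(norm (z - z'))\<^sup>2 \<le> 2 * \<eta>\<^sup>2"
proof -
  have "(re (z - z'))\<^sup>2 \<le> \<eta>\<^sup>2" "(re (rot * (z - z')))\<^sup>2 \<le> \<eta>\<^sup>2"
    using assms by (auto simp: cell_def right_diff_distrib intro!: floor_div_eq_close)
  then show ?thesis using norm_le_re_rot[of "z - z'"] by linarith
qed

lemma cell_range:
  assumes "\<eta> > 0" "norm z \<le> 1"
  shows "cell \<eta> z \<in> {\<lfloor>- (1 / \<eta>)\<rfloor>..\<lfloor>1 / \<eta>\<rfloor>} \<times> {\<lfloor>- (1 / \<eta>)\<rfloor>..\<lfloor>1 / \<eta>\<rfloor>}"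
proof -
  have "\<lfloor>re w / \<eta>\<rfloor> \<in> {\<lfloor>- (1 / \<eta>)\<rfloor>..\<lfloor>1 / \<eta>\<rfloor>}" if "norm w \<le> 1" for w :: 'a
  proof -
    have "\<bar>re w\<bar> \<le> 1" using abs_re_le[of w] that by simp
    then have "re w / \<eta> \<le> 1 / \<eta>" "- (1 / \<eta>) \<le> re w / \<eta>"
      using assms(1) by (auto simp: abs_le_iff field_simps)
    then show ?thesis by (auto intro: floor_mono)
  qed
  then show ?thesis using assms(2) by (simp add: cell_def norm_mult norm_rot)
qed

lemma norm_coord_le: "i < d \<Longrightarrow> norm (x i) \<le> nrm d x"
proof -
  assume "i < d"
  then have "(norm (x i))\<^sup>2 \<le> (nrm d x)\<^sup>2" unfolding nrm_sq by (intro member_le_sum) auto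
  then show ?thesis by (rule power2_le_imp_le) simp
qed

text \<open>
One representative is chosen for every combination of grid cells that meets the sphere. The resulting
cardinality is far from optimal, but only its logarithm matters.
\<close>

lemma usphere_net:
  assumes \<eta>: "\<eta> > 0"
  shows "\<exists>N. finite N \<and> N \<subseteq> (usphere d :: (nat \<Rightarrow> 'a::rc_field) set) \<and> real (card N) \<le> (2 / \<eta> + 3) ^ (2 * d) \<and>
    (\<forall>x\<in>usphere d. \<exists>y\<in>N. (nrm d (\<lambda>i. x i - y i))\<^sup>2 \<le> real d * (2 * \<eta>\<^sup>2))"
proof -
  define S where "S = {\<lfloor>- (1 / \<eta>)\<rfloor>..\<lfloor>1 / \<eta>\<rfloor>}"
  define F :: "(nat \<Rightarrow> 'a) \<Rightarrow> nat \<Rightarrow> int \<times> int" where "F = (\<lambda>x. \<lambda>i\<in>{..<d}. cell \<eta> (x i))"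
  define g where "g = (\<lambda>f. SOME x. x \<in> usphere d \<and> F x = f)"
  define N where "N = g ` F ` usphere d"
  have g: "g f \<in> usphere d \<and> F (g f) = f" if f: "f \<in> F ` usphere d" for f
  proof -
    obtain x where "x \<in> usphere d" "F x = f" using f by auto
    then show ?thesis unfolding g_def by (intro someI[of "\<lambda>x. x \<in> usphere d \<and> F x = f" x]) simp
  qed
  have FS: "F ` usphere d \<subseteq> (\<Pi>\<^sub>E i\<in>{..<d}. S \<times> S)"
  proof
    fix f assume "f \<in> F ` usphere d"
    then obtain x where x: "x \<in> usphere d" "f = F x" by auto
    have "cell \<eta> (x i) \<in> S \<times> S" if "i < d" for i
      unfolding S_def using norm_coord_le[OF that, of x] usphereD[OF x(1)] by (intro cell_range \<eta>) simp
    then show "f \<in> (\<Pi>\<^sub>E i\<in>{..<d}. S \<times> S)" unfolding x(2) F_def by auto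
  qed
  have finS: "finite S" by (simp add: S_def)
  have fin: "finite (\<Pi>\<^sub>E i\<in>{..<d}. S \<times> S)" using finS by (intro finite_PiE) auto
  have finF: "finite (F ` usphere d)" using FS fin by (rule finite_subset)
  have "card N \<le> card (F ` usphere d)" unfolding N_def by (rule card_image_le[OF finF])
  also have "\<dots> \<le> card (\<Pi>\<^sub>E i\<in>{..<d}. S \<times> S)" by (rule card_mono[OF fin FS])
  also have "\<dots> = card S ^ (2 * d)"
    by (simp add: card_PiE card_cartesian_product power_mult power2_eq_square)
  finally have "real (card N) \<le> real (card S) ^ (2 * d)" by (metis of_nat_le_iff of_nat_power)
  also have "\<dots> \<le> (2 / \<eta> + 3) ^ (2 * d)"
  proof (rule power_mono)
    have "real (card S) = real_of_int (\<lfloor>1 / \<eta>\<rfloor> + 1 - \<lfloor>- (1 / \<eta>)\<rfloor>)"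
    proof -
      have "\<lfloor>- (1 / \<eta>)\<rfloor> \<le> \<lfloor>1 / \<eta>\<rfloor>" using \<eta> by (intro floor_mono) (simp add: order_trans[of _ 0])
      then show ?thesis unfolding S_def by simp
    qed
    also have "\<dots> \<le> 2 / \<eta> + 3" by simp linarith
    finally show "real (card S) \<le> 2 / \<eta> + 3" .
  qed simp
  finally have card: "real (card N) \<le> (2 / \<eta> + 3) ^ (2 * d)" .
  have close: "\<exists>y\<in>N. (nrm d (\<lambda>i. x i - y i))\<^sup>2 \<le> real d * (2 * \<eta>\<^sup>2)" if x: "x \<in> usphere d" for x
  proof (rule bexI)
    have Fg: "F (g (F x)) = F x" using g x by auto
    have "cell \<eta> (x i) = cell \<eta> (g (F x) i)" if "i < d" for i
      using fun_cong[OF Fg, of i] that by (simp add: F_def)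
    then have "(nrm d (\<lambda>i. x i - g (F x) i))\<^sup>2 \<le> (\<Sum>i<d. 2 * \<eta>\<^sup>2)"
      unfolding nrm_sq by (intro sum_mono cell_close[OF \<eta>]) auto
    then show "(nrm d (\<lambda>i. x i - g (F x) i))\<^sup>2 \<le> real d * (2 * \<eta>\<^sup>2)" by simp
    show "g (F x) \<in> N" using x by (auto simp: N_def)
  qed
  have "finite N" "N \<subseteq> usphere d" using finF g by (auto simp: N_def)
  then show ?thesis using card close by (intro exI[of _ N]) simp
qed

section \<open>Concentration for independent samples\<close>

lemma PiM_coordinates_indep:
  assumes M: "prob_space M" and I: "I \<noteq> {}"
  shows "prob_space.indep_vars (PiM I (\<lambda>_. M)) (\<lambda>_. M) (\<lambda>i \<omega>. \<omega> i) I"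
proof -
  have Q0: "prob_space (PiM I (\<lambda>_. M))" by (rule prob_space_PiM) (rule M)
  have "distr (PiM I (\<lambda>_. M)) (PiM I (\<lambda>_. M)) (\<lambda>x. \<lambda>i\<in>I. x i) = distr (PiM I (\<lambda>_. M)) (PiM I (\<lambda>_. M)) (\<lambda>x. x)"
    by (intro distr_cong refl) (auto simp: space_PiM PiE_def extensional_restrict)
  also have "\<dots> = PiM I (\<lambda>_. M)" by simp
  also have "\<dots> = (\<Pi>\<^sub>M i\<in>I. distr (PiM I (\<lambda>_. M)) M (\<lambda>x. x i))"
    by (intro PiM_cong refl distr_PiM_component[symmetric]) (rule M)
  finally show ?thesis
    by (subst prob_space.indep_vars_iff_distr_eq_PiM'[OF Q0 I]) (auto intro: measurable_component_singleton)
qed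

lemma Hoeffding_sample_mean:
  assumes M: "prob_space M" and G [measurable]: "G \<in> borel_measurable M"
    and bnd: "\<And>x. x \<in> space M \<Longrightarrow> G x \<in> {a..b}" and ab: "a < b" and m: "m \<ge> 1" and t: "t \<ge> 0"
  shows "measure (\<Pi>\<^sub>M j\<in>{..<m}. M) {\<omega> \<in> space (\<Pi>\<^sub>M j\<in>{..<m}. M).
      (\<Sum>j<m. G (\<omega> j)) \<le> real m * integral\<^sup>L M G - real m * t}
    \<le> exp (- 2 * real m * t\<^sup>2 / (b - a)\<^sup>2)"
proof -
  let ?M = "\<Pi>\<^sub>M j\<in>{..<m}. M"
  have Q0: "prob_space ?M" by (rule prob_space_PiM) (rule M)
  have "0 \<in> {..<m}" using m by simp
  then have ne: "{..<m} \<noteq> {}" by blast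
  have exp_eq: "integral\<^sup>L ?M (\<lambda>\<omega>. G (\<omega> j)) = integral\<^sup>L M G" if "j < m" for j
  proof -
    have "integral\<^sup>L M G = integral\<^sup>L (distr ?M M (\<lambda>\<omega>. \<omega> j)) G"
      using that M by (subst distr_PiM_component) auto
    also have "\<dots> = integral\<^sup>L ?M (\<lambda>\<omega>. G (\<omega> j))"
      using that by (intro integral_distr) auto
    finally show ?thesis ..
  qed
  have ind: "prob_space.indep_vars ?M (\<lambda>_. borel) (\<lambda>j \<omega>. G (\<omega> j)) {..<m}"
    by (rule prob_space.indep_vars_compose2[OF Q0 PiM_coordinates_indep[OF M ne]]) (rule G)
  have H: "Hoeffding_ineq ?M {..<m} (\<lambda>j \<omega>. G (\<omega> j)) (\<lambda>_. a) (\<lambda>_. b)"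
  proof (intro Hoeffding_ineq.intro indep_interval_bounded_random_variables.intro
      indep_interval_bounded_random_variables_axioms.intro Q0 ind)
    show "AE \<omega> in ?M. G (\<omega> j) \<in> {a..b}" if "j \<in> {..<m}" for j
      using that bnd by (intro AE_I2) (auto simp: space_PiM PiE_def Pi_def)
  qed simp
  have pos: "(\<Sum>j<m. (b - a)\<^sup>2) > 0" using ab m by simp
  have mean: "(\<Sum>j<m. integral\<^sup>L ?M (\<lambda>\<omega>. G (\<omega> j))) = real m * integral\<^sup>L M G"
    by (simp add: exp_eq)
  have "measure ?M {\<omega> \<in> space ?M. (\<Sum>j<m. G (\<omega> j)) \<le> real m * integral\<^sup>L M G - real m * t}
    \<le> exp (- 2 * (real m * t)\<^sup>2 / (\<Sum>j<m. (b - a)\<^sup>2))"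
    using Hoeffding_ineq.Hoeffding_ineq_le[OF H _ pos, of "real m * t"] t unfolding mean by simp
  also have "- 2 * (real m * t)\<^sup>2 / (\<Sum>j<m. (b - a)\<^sup>2) = - 2 * real m * t\<^sup>2 / (b - a)\<^sup>2"
    using m by (simp add: power_mult_distrib power2_eq_square)
  finally show ?thesis .
qed

section \<open>The robust gain\<close>

lemma overlap_sq_le_1:
  assumes "x \<in> usphere d" "y \<in> usphere d"
  shows "(norm (ip d x y))\<^sup>2 \<le> 1"
  using Cauchy_Schwarz[of d x y] assms by (simp add: usphere_def abs_square_le_1)

text \<open>
After a change of phase the inner product \<open>c\<close> of \<open>x\<close> and \<open>y\<close> is real and nonnegative. Then
\<open>norm (x - y) * norm (x + y)\<close> equals twice the square root of \<open>1 - c\<^sup>2\<close>.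
\<close>

lemma q_diff_le_sine:
  assumes P: "P \<in> Proj k d" and x: "x \<in> usphere d" and y: "y \<in> usphere d"
  shows "\<bar>q d P x - q d P y\<bar> \<le> 2 * sqrt (1 - (norm (ip d x y))\<^sup>2)"
proof -
  obtain u where u: "norm u = 1" "u * ip d x y = of_real (norm (ip d x y))" using phase_exists by blast
  define c where "c = norm (ip d x y)"
  define x' where "x' = (\<lambda>i. u * x i)"
  have c: "re (ip d x' y) = c" using u(2) by (simp add: x'_def ip_linear c_def)
  have x': "nrm d x' = 1" using u(1) usphereD[OF x] by (simp add: x'_def nrm_scale)
  have c1: "c\<^sup>2 \<le> 1" unfolding c_def by (rule overlap_sq_le_1[OF x y])
  have "\<bar>q d P x - q d P y\<bar> \<le> nrm d (\<lambda>i. x' i - y i) * nrm d (\<lambda>i. x' i + y i)"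
    using q_diff_le[OF P, of x' y] q_phase[OF u(1), of d P x] by (simp add: x'_def)
  also have "\<dots> = 2 * sqrt (1 - c\<^sup>2)"
  proof -
    have "(nrm d (\<lambda>i. x' i - y i) * nrm d (\<lambda>i. x' i + y i))\<^sup>2 = (2 * sqrt (1 - c\<^sup>2))\<^sup>2"
      using c1 unfolding power_mult_distrib nrm_diff_sq nrm_add_sq c x' usphereD[OF y]
      by (simp add: algebra_simps power2_eq_square)
    then show ?thesis using c1 by (subst (asm) power2_eq_iff_nonneg) auto
  qed
  finally show ?thesis by (simp add: c_def)
qed

lemma q_diff_le_dist:
  assumes P: "P \<in> Proj k d" and x: "x \<in> usphere d" and y: "y \<in> usphere d"
  shows "\<bar>q d P x - q d P y\<bar> \<le> 2 * nrm d (\<lambda>i. x i - y i)"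
proof -
  have "nrm d (\<lambda>i. x i + y i) \<le> 2" using nrm_triangle[of d x y] usphereD[OF x] usphereD[OF y] by simp
  then have "nrm d (\<lambda>i. x i - y i) * nrm d (\<lambda>i. x i + y i) \<le> nrm d (\<lambda>i. x i - y i) * 2"
    by (intro mult_left_mono) auto
  then show ?thesis using q_diff_le[OF P, of x y] by linarith
qed

lemma overlap_perturb:
  assumes x: "x \<in> usphere d" "y \<in> usphere d" "x' \<in> usphere d" "y' \<in> usphere d"
  shows "(norm (ip d x' y'))\<^sup>2 \<le> (norm (ip d x y))\<^sup>2 + 2 * (nrm d (\<lambda>i. x i - x' i) + nrm d (\<lambda>i. y i - y' i))"
proof -
  let ?e = "nrm d (\<lambda>i. x i - x' i) + nrm d (\<lambda>i. y i - y' i)"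
  have "norm (ip d x y - ip d x' y') = norm (ip d (\<lambda>i. x i - x' i) y + ip d x' (\<lambda>i. y i - y' i))"
    by (simp add: ip_linear)
  also have "\<dots> \<le> norm (ip d (\<lambda>i. x i - x' i) y) + norm (ip d x' (\<lambda>i. y i - y' i))" by (rule norm_triangle_ineq)
  also have "\<dots> \<le> ?e"
    using Cauchy_Schwarz[of d "\<lambda>i. x i - x' i" y] Cauchy_Schwarz[of d x' "\<lambda>i. y i - y' i"] x
    by (simp add: usphere_def)
  finally have *: "norm (ip d x' y') - norm (ip d x y) \<le> ?e"
    using norm_triangle_ineq2[of "ip d x' y'" "ip d x y"] by (simp add: norm_minus_commute)
  have le1: "norm (ip d x y) \<le> 1" "norm (ip d x' y') \<le> 1"
    using overlap_sq_le_1[OF x(1,2)] overlap_sq_le_1[OF x(3,4)] by (simp_all add: abs_square_le_1)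
  have "(norm (ip d x' y'))\<^sup>2 - (norm (ip d x y))\<^sup>2
      = (norm (ip d x' y') - norm (ip d x y)) * (norm (ip d x' y') + norm (ip d x y))"
    by (simp add: power2_eq_square algebra_simps)
  also have "\<dots> \<le> ?e * (norm (ip d x' y') + norm (ip d x y))" using * by (intro mult_right_mono) auto
  also have "\<dots> \<le> ?e * 2" using le1 by (intro mult_left_mono) auto
  finally show ?thesis by linarith
qed

text \<open>
The gain of a line over another one in a single measurement, with a penalty if the measured value
is within \<open>\<epsilon>\<close> of the threshold. Only then can a perturbation of size \<open>\<epsilon>\<close> flip the answer, and a flip
costs at most twice the difference of the two values. Thus a bound for net points carries over to all
lines, although the answers depend discontinuously on the line. The penalty is proportional to the
distance of the two lines; a constant one would spoil the dependence on \<open>\<delta>\<close>.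
\<close>

definition robust_gain :: "nat \<Rightarrow> real \<Rightarrow> (nat \<Rightarrow> 'a::rc_field) \<Rightarrow> (nat \<Rightarrow> 'a) \<Rightarrow> 'a mat \<Rightarrow> real" where
  "robust_gain d \<epsilon> x y P = sg (q d P x) * (q d P x - q d P y)
    - 2 * \<bar>q d P x - q d P y\<bar> * indicator {-\<epsilon>..\<epsilon>} (q d P x)"

lemma gain_ge_robust_gain:
  assumes "\<bar>q d P x - q d P x'\<bar> \<le> \<epsilon>" "\<bar>q d P y - q d P y'\<bar> \<le> \<epsilon>"
  shows "robust_gain d \<epsilon> x' y' P - 2 * \<epsilon> \<le> sg (q d P x) * (q d P x - q d P y)"
proof (cases "sg (q d P x) = sg (q d P x')")
  case True
  have "robust_gain d \<epsilon> x' y' P \<le> sg (q d P x') * (q d P x' - q d P y')"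
    by (simp add: robust_gain_def)
  then show ?thesis unfolding True using assms sg_simps(3)[of "q d P x'"] by (auto simp: abs_le_iff)
next
  case False
  then have "indicator {-\<epsilon>..\<epsilon>} (q d P x') = (1::real)"
    using assms(1) by (auto simp: sg_def indicator_def abs_le_iff split: if_splits)
  then have "robust_gain d \<epsilon> x' y' P \<le> - \<bar>q d P x' - q d P y'\<bar>"
    using sg_simps(3)[of "q d P x'"] by (auto simp: robust_gain_def)
  then show ?thesis using assms sg_simps(3)[of "q d P x"] by (elim disjE; simp; linarith)
qed

context uniform_projection
begin

lemma robust_gain_measurable [measurable]: "robust_gain d \<epsilon> x y \<in> borel_measurable \<mu>"
  unfolding robust_gain_def by measurable

lemma robust_gain_range:
  assumes P: "P \<in> Proj n d" and x: "x \<in> usphere d" and y: "y \<in> usphere d"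
  defines "r \<equiv> sqrt (1 - (norm (ip d x y))\<^sup>2)"
  shows "robust_gain d \<epsilon> x y P \<in> {-6 * r .. 2 * r}"
proof -
  have D: "\<bar>q d P x - q d P y\<bar> \<le> 2 * r" unfolding r_def by (rule q_diff_le_sine[OF P x y])
  have "indicator {-\<epsilon>..\<epsilon>} (q d P x) = (0::real) \<or> indicator {-\<epsilon>..\<epsilon>} (q d P x) = (1::real)"
    by (auto simp: indicator_def)
  then show ?thesis using D sg_simps(3)[of "q d P x"] unfolding robust_gain_def by (auto simp: abs_le_iff abs_if)
qed

text \<open>
The smallness assumption makes the penalty consume at most a quarter of the lower bound that \<open>sgn_gap\<close>
gives for the mean gain: the penalty is at most \<open>4 * r\<close> and occurs with probability at most \<open>12 * n * \<epsilon>\<close>.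
\<close>

lemma robust_gain_expectation:
  assumes x: "x \<in> usphere d" and y: "y \<in> usphere d" and \<epsilon>: "0 < \<epsilon>" "\<epsilon> \<le> 1"
  defines "r \<equiv> sqrt (1 - (norm (ip d x y))\<^sup>2)"
  assumes small: "12 * real n * \<epsilon> \<le> r / (256 * sqrt (real n))"
  shows "3 / 4 * (expectation (\<lambda>P. \<bar>q d P x\<bar>) * r\<^sup>2) \<le> expectation (robust_gain d \<epsilon> x y)"
proof -
  define \<alpha> where "\<alpha> = expectation (\<lambda>P. \<bar>q d P x\<bar>)"
  have r0: "0 \<le> r" and r2: "r\<^sup>2 = 1 - (norm (ip d x y))\<^sup>2"
    using overlap_sq_le_1[OF x y] by (auto simp: r_def)
  have \<alpha>: "1 / (16 * sqrt (real n)) \<le> \<alpha>" unfolding \<alpha>_def by (rule mean_abs_ge[OF x])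
  let ?I = "\<lambda>P. indicator {-\<epsilon>..\<epsilon>} (q d P x) :: real"
  have D: "\<bar>q d P x - q d P y\<bar> \<le> 2 * r" if "P \<in> Proj n d" for P unfolding r_def by (rule q_diff_le_sine[OF that x y])
  have i1: "integrable \<mu> (\<lambda>P. sg (q d P x) * (q d P x - q d P y))"
    by (rule integrable_bounded[of _ "2 * r"]) (use D in \<open>auto simp: abs_mult sg_simps\<close>)
  have i2: "integrable \<mu> ?I" by (rule integrable_bounded[of _ 1]) (auto simp: indicator_def)
  have "expectation ?I = expectation (indicator {P \<in> space \<mu>. \<bar>q d P x\<bar> \<le> \<epsilon>})"
    by (intro Bochner_Integration.integral_cong) (auto simp: indicator_def abs_le_iff)
  also have "\<dots> = prob {P \<in> space \<mu>. \<bar>q d P x\<bar> \<le> \<epsilon>}" by simp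
  also have "\<dots> \<le> 12 * real n * \<epsilon>" by (rule anticoncentration[OF x \<epsilon>])
  also have "\<dots> \<le> \<alpha> * r / 16"
  proof -
    have "1 / (16 * sqrt (real n)) * r \<le> \<alpha> * r" using \<alpha> r0 by (rule mult_right_mono)
    then show ?thesis using small by simp
  qed
  finally have I: "expectation ?I \<le> \<alpha> * r / 16" .
  have "3 / 4 * (\<alpha> * r\<^sup>2) = r\<^sup>2 * \<alpha> - 4 * r * (\<alpha> * r / 16)" by (simp add: power2_eq_square)
  also have "\<dots> \<le> r\<^sup>2 * \<alpha> - 4 * r * expectation ?I"
    using I r0 by (intro diff_left_mono mult_left_mono) auto
  also have "\<dots> \<le> expectation (\<lambda>P. sg (q d P x) * (q d P x - q d P y)) - 4 * r * expectation ?I"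
    using sgn_gap[OF x y] unfolding r2 \<alpha>_def by simp
  also have "\<dots> = expectation (\<lambda>P. sg (q d P x) * (q d P x - q d P y) - 4 * r * ?I P)"
    using i1 i2 by simp
  also have "\<dots> \<le> expectation (robust_gain d \<epsilon> x y)"
  proof (rule integral_mono)
    show "integrable \<mu> (\<lambda>P. sg (q d P x) * (q d P x - q d P y) - 4 * r * ?I P)" using i1 i2 by simp
    show "integrable \<mu> (robust_gain d \<epsilon> x y)"
      using robust_gain_range[OF _ x y, of _ \<epsilon>] r0 unfolding r_def[symmetric]
      by (intro integrable_bounded[of _ "6 * r"] robust_gain_measurable) (force simp: abs_le_iff)
    fix P assume "P \<in> space \<mu>"
    then have "2 * \<bar>q d P x - q d P y\<bar> * ?I P \<le> 2 * (2 * r) * ?I P"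
      using D by (intro mult_right_mono mult_left_mono) (auto simp: space_mu)
    then show "sg (q d P x) * (q d P x - q d P y) - 4 * r * ?I P \<le> robust_gain d \<epsilon> x y P"
      unfolding robust_gain_def by simp
  qed
  finally show ?thesis unfolding \<alpha>_def .
qed

text \<open>
Both the mean gain and the range of the gain scale with the distance \<open>\<rho>\<close> of the lines, the former like
\<open>\<rho>\<^sup>2 / sqrt n\<close> and the latter like \<open>\<rho>\<close>. Hoeffding's inequality therefore gives an exponent of order
\<open>m * \<rho>\<^sup>2 / n\<close>, and \<open>\<rho>\<close> is at least \<open>\<delta> / 2\<close>. The choice of \<open>\<epsilon>\<close> keeps both the penalty and the loss
\<open>2 * \<epsilon>\<close> of the later perturbation below fixed fractions of the mean gain.
\<close>

lemma robust_gain_tail: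
  assumes x: "x \<in> usphere d" and y: "y \<in> usphere d" and \<delta>: "0 < \<delta>" "\<delta> \<le> 1" and m: "m \<ge> 1"
    and r: "\<delta>\<^sup>2 / 4 \<le> 1 - (norm (ip d x y))\<^sup>2"
  defines "\<epsilon> \<equiv> \<delta>\<^sup>2 / (8192 * (real n)\<^sup>2)"
  shows "measure (\<Pi>\<^sub>M j\<in>{..<m}. \<mu>) {\<omega> \<in> space (\<Pi>\<^sub>M j\<in>{..<m}. \<mu>).
      (\<Sum>j<m. robust_gain d \<epsilon> x y (\<omega> j)) \<le> real m * (2 * \<epsilon>)}
    \<le> exp (- (real m * \<delta>\<^sup>2 / (524288 * real n)))"
proof -
  define \<alpha> where "\<alpha> = expectation (\<lambda>P. \<bar>q d P x\<bar>)"
  define \<rho> where "\<rho> = sqrt (1 - (norm (ip d x y))\<^sup>2)"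
  define c where "c = sqrt (real n)"
  have c: "1 \<le> c" "real n = c\<^sup>2" using n_pos by (simp_all add: c_def)
  have \<rho>2: "\<rho>\<^sup>2 = 1 - (norm (ip d x y))\<^sup>2" using overlap_sq_le_1[OF x y] by (simp add: \<rho>_def)
  have \<rho>: "\<delta> / 2 \<le> \<rho>" unfolding \<rho>_def using r by (intro real_le_rsqrt) (simp add: power_divide)
  then have \<rho>0: "0 < \<rho>" using \<delta> by linarith
  have \<alpha>: "1 / (16 * c) \<le> \<alpha>" unfolding \<alpha>_def c_def by (rule mean_abs_ge[OF x])
  have \<alpha>0: "0 < \<alpha>" using \<alpha> c by (smt (verit) divide_pos_pos)
  have d2: "\<delta>\<^sup>2 \<le> \<delta>" using \<delta> by (simp add: power2_eq_square mult_left_le)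
  have eps: "\<epsilon> = \<delta>\<^sup>2 / (8192 * c ^ 4)" unfolding \<epsilon>_def c(2) by simp
  have cp: "c \<le> c ^ 4" "1 \<le> c ^ 4" "c ^ 3 \<le> c ^ 4"
    using c power_increasing[of 1 4 c] power_increasing[of 0 4 c] power_increasing[of 3 4 c] by auto
  have \<epsilon>: "0 < \<epsilon>" "\<epsilon> \<le> 1"
  proof -
    show "0 < \<epsilon>" unfolding eps using \<delta> c by simp
    have "\<delta>\<^sup>2 \<le> 8192 * c ^ 4" using d2 \<delta> cp by linarith
    then show "\<epsilon> \<le> 1" unfolding eps using c by (simp add: divide_le_eq_1)
  qed
  have small: "12 * real n * \<epsilon> \<le> \<rho> / (256 * sqrt (real n))"
  proof -
    have "12 * real n * \<epsilon> = (12 / 8192) * (\<delta>\<^sup>2 * (1 / c\<^sup>2))"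
      unfolding eps c(2) using c(1) by (simp add: power4_eq_xxxx power2_eq_square)
    also have "\<dots> \<le> (12 / 8192) * (\<delta> * (1 / c))"
    proof (intro mult_left_mono mult_mono)
      show "1 / c\<^sup>2 \<le> 1 / c" using c(1) by (intro divide_left_mono) (auto simp: power2_eq_square)
    qed (use d2 \<delta> c in auto)
    also have "\<dots> \<le> (1 / 512) * (\<delta> * (1 / c))" using \<delta> c by (intro mult_right_mono) auto
    also have "\<dots> = \<delta> / 2 / (256 * c)" by simp
    also have "\<dots> \<le> \<rho> / (256 * c)" using \<rho> c by (intro divide_right_mono) auto
    finally show ?thesis by (simp add: c_def)
  qed
  define t where "t = \<alpha> * \<rho>\<^sup>2 / 4"
  have t: "0 \<le> t" using \<alpha>0 by (simp add: t_def)
  have e2: "2 * \<epsilon> \<le> \<alpha> * \<rho>\<^sup>2 / 4"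
  proof -
    have "2 * \<epsilon> \<le> (1 / (16 * c)) * (\<delta>\<^sup>2 / 4) / 4"
    proof -
      have "\<delta>\<^sup>2 / (4096 * c ^ 4) \<le> \<delta>\<^sup>2 / (256 * c)" using c cp by (intro divide_left_mono) auto
      then show ?thesis unfolding eps by simp
    qed
    also have "\<dots> \<le> \<alpha> * \<rho>\<^sup>2 / 4"
      using \<alpha> \<alpha>0 r c unfolding \<rho>2 by (intro divide_right_mono mult_mono) auto
    finally show ?thesis .
  qed
  have mean: "2 * \<epsilon> \<le> expectation (robust_gain d \<epsilon> x y) - t"
  proof -
    have "3 / 4 * w \<le> E \<Longrightarrow> e \<le> w / 4 \<Longrightarrow> 0 < w \<Longrightarrow> e \<le> E - w / 4" for w E e :: real by simp
    moreover have "0 < \<alpha> * \<rho>\<^sup>2" using \<alpha>0 \<rho>0 by simp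
    ultimately show ?thesis
      using robust_gain_expectation[OF x y \<epsilon> small[unfolded \<rho>_def]] e2
      unfolding t_def \<alpha>_def[symmetric] \<rho>_def[symmetric] by blast
  qed
  have Q: "prob_space (\<Pi>\<^sub>M j\<in>{..<m}. \<mu>)" by (rule prob_space_PiM) (rule prob_space_axioms)
  have "measure (\<Pi>\<^sub>M j\<in>{..<m}. \<mu>) {\<omega> \<in> space (\<Pi>\<^sub>M j\<in>{..<m}. \<mu>).
      (\<Sum>j<m. robust_gain d \<epsilon> x y (\<omega> j)) \<le> real m * (2 * \<epsilon>)}
    \<le> measure (\<Pi>\<^sub>M j\<in>{..<m}. \<mu>) {\<omega> \<in> space (\<Pi>\<^sub>M j\<in>{..<m}. \<mu>).
      (\<Sum>j<m. robust_gain d \<epsilon> x y (\<omega> j)) \<le> real m * expectation (robust_gain d \<epsilon> x y) - real m * t}"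
  proof (rule finite_measure.finite_measure_mono[OF prob_space.finite_measure[OF Q]])
    have "real m * (2 * \<epsilon>) \<le> real m * expectation (robust_gain d \<epsilon> x y) - real m * t"
      using mult_left_mono[OF mean, of "real m"] by (simp add: right_diff_distrib)
    then show "{\<omega> \<in> space (\<Pi>\<^sub>M j\<in>{..<m}. \<mu>). (\<Sum>j<m. robust_gain d \<epsilon> x y (\<omega> j)) \<le> real m * (2 * \<epsilon>)}
      \<subseteq> {\<omega> \<in> space (\<Pi>\<^sub>M j\<in>{..<m}. \<mu>).
      (\<Sum>j<m. robust_gain d \<epsilon> x y (\<omega> j)) \<le> real m * expectation (robust_gain d \<epsilon> x y) - real m * t}" by auto
  qed measurable
  also have "\<dots> \<le> exp (- 2 * real m * t\<^sup>2 / (2 * \<rho> - -6 * \<rho>)\<^sup>2)"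
    using robust_gain_range[OF _ x y, of _ \<epsilon>] \<rho>0 unfolding \<rho>_def[symmetric]
    by (intro Hoeffding_sample_mean[OF prob_space_axioms] robust_gain_measurable m t) (auto simp: space_mu)
  also have "\<dots> \<le> exp (- (real m * \<delta>\<^sup>2 / (524288 * real n)))"
  proof -
    have eq: "2 * real m * t\<^sup>2 / (2 * \<rho> - -6 * \<rho>)\<^sup>2 = real m * (\<alpha>\<^sup>2 * \<rho>\<^sup>2) / 512"
      using \<rho>0 by (simp add: t_def power_mult_distrib power_divide power2_eq_square field_simps)
    have "(1 / (16 * c))\<^sup>2 * (\<delta> / 2)\<^sup>2 \<le> \<alpha>\<^sup>2 * \<rho>\<^sup>2"
      using \<alpha> \<rho> c \<delta> by (intro mult_mono power_mono) auto
    moreover have "(1 / (16 * c))\<^sup>2 * (\<delta> / 2)\<^sup>2 = \<delta>\<^sup>2 / (1024 * real n)"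
      unfolding c(2) by (simp add: power_divide power_mult_distrib)
    ultimately have "\<delta>\<^sup>2 / (1024 * real n) \<le> \<alpha>\<^sup>2 * \<rho>\<^sup>2" by simp
    then have "real m * (\<delta>\<^sup>2 / (1024 * real n)) / 512 \<le> 2 * real m * t\<^sup>2 / (2 * \<rho> - -6 * \<rho>)\<^sup>2"
      unfolding eq by (intro divide_right_mono mult_left_mono) auto
    then show ?thesis by simp
  qed
  finally show ?thesis .
qed

section \<open>The union bound\<close>

text \<open>
With \<open>R = n / \<delta>\<close> the number of pairs of net points is at most \<open>R\<close> to the power \<open>296 * n\<close>, and \<open>m\<close> is so
large that a single tail bound beats this number and leaves \<open>exp (- n)\<close> over. The assumption that
\<open>R\<^sup>2\<close> is at least \<open>2\<close> keeps \<open>ln R\<close> away from zero, so that all absolute constants can be absorbed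
into it.
\<close>

lemma net_size_bound:
  assumes \<delta>: "0 < \<delta>" "\<delta> \<le> 1" and R: "2 \<le> (real n / \<delta>)\<^sup>2"
    and mC: "200000000 * (1 / \<delta>)\<^sup>2 * (real n)\<^sup>2 * ln (1 / \<delta> * real n) \<le> real m"
  defines "\<eta> \<equiv> \<delta>\<^sup>2 / (32768 * (real n) ^ 3)"
  shows "((2 / \<eta> + 3) ^ (2 * d))\<^sup>2 * exp (- (real m * \<delta>\<^sup>2 / (524288 * real n))) \<le> exp (- real n)"
proof -
  define R where "R = real n / \<delta>"
  define L where "L = ln R"
  have n: "1 \<le> real n" using n_pos by simp
  have Rp: "1 \<le> R" unfolding R_def using \<delta> n by (simp add: field_simps)
  have R2: "2 \<le> R\<^sup>2" using R by (simp add: R_def)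
  have "ln 2 \<le> ln (R\<^sup>2)" using R2 by (intro iffD2[OF ln_le_cancel_iff]) auto
  then have L: "1 / 3 \<le> L" using ln2_ge_two_thirds Rp by (simp add: L_def ln_realpow)
  have "2 / \<eta> = 65536 * (real n) ^ 3 / \<delta>\<^sup>2" by (simp add: \<eta>_def)
  also have "\<dots> \<le> 65536 * R ^ 3"
  proof -
    have "\<delta> ^ 3 \<le> \<delta>\<^sup>2" using \<delta> power_decreasing[of 2 3 \<delta>] by simp
    then have "(real n) ^ 3 / \<delta>\<^sup>2 \<le> (real n) ^ 3 / \<delta> ^ 3" using \<delta> by (intro divide_left_mono) auto
    then show ?thesis by (simp add: R_def power_divide)
  qed
  also have "65536 * R ^ 3 + 3 \<le> 2 ^ 17 * R ^ 3" using one_le_power[OF Rp, of 3] by simp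
  also have "\<dots> \<le> (R\<^sup>2) ^ 17 * R ^ 3" using R2 Rp by (intro mult_right_mono power_mono) auto
  also have "\<dots> = R ^ 37" by (simp flip: power_mult power_add)
  finally have base: "2 / \<eta> + 3 \<le> R ^ 37" by simp
  have "0 \<le> 2 / \<eta> + 3" using n by (simp add: \<eta>_def)
  then have "((2 / \<eta> + 3) ^ (2 * d))\<^sup>2 \<le> ((R ^ 37) ^ (2 * d))\<^sup>2"
    using base by (intro power_mono) auto
  also have "\<dots> = R ^ (296 * n)" by (simp add: d_eq flip: power_mult)
  also have "\<dots> = exp (real (296 * n) * L)" unfolding L_def using Rp by (subst exp_of_nat_mult) simp
  finally have "((2 / \<eta> + 3) ^ (2 * d))\<^sup>2 * exp (- (real m * \<delta>\<^sup>2 / (524288 * real n)))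
    \<le> exp (real (296 * n) * L) * exp (- (real m * \<delta>\<^sup>2 / (524288 * real n)))"
    by (intro mult_right_mono) auto
  also have "\<dots> = exp (real (296 * n) * L - real m * \<delta>\<^sup>2 / (524288 * real n))"
    by (simp flip: exp_add)
  also have "\<dots> \<le> exp (- real n)"
  proof -
    have RL: "1 / \<delta> * real n = R" by (simp add: R_def)
    have "200000000 * (real n)\<^sup>2 * L = (200000000 * (1 / \<delta>)\<^sup>2 * (real n)\<^sup>2 * ln (1 / \<delta> * real n)) * \<delta>\<^sup>2"
      unfolding RL L_def using \<delta> by (simp add: power_divide)
    also have "\<dots> \<le> real m * \<delta>\<^sup>2" using mC by (intro mult_right_mono) auto
    finally have "200000000 * (real n)\<^sup>2 * L / (524288 * real n) \<le> real m * \<delta>\<^sup>2 / (524288 * real n)"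
      using n by (intro divide_right_mono) auto
    moreover have "200000000 * (real n)\<^sup>2 * L / (524288 * real n) = (200000000 / 524288) * (real n * L)"
      using n by (simp add: power2_eq_square)
    \<comment> \<open>\<open>296\<close> for the net, and \<open>3\<close> more to pay for \<open>exp (- n)\<close>, since \<open>L\<close> is at least \<open>1 / 3\<close>.\<close>
    moreover have "299 * (real n * L) \<le> (200000000 / 524288) * (real n * L)"
      using n L by (intro mult_right_mono) auto
    moreover have "real n * (1 / 3) \<le> real n * L" using L n by (intro mult_left_mono) auto
    ultimately show ?thesis by simp
  qed
  finally show ?thesis .
qed

text \<open>
The union bound over all pairs of net points at distance at least \<open>\<delta> / 2\<close>, followed by the passage from
net points to arbitrary lines.
\<close>

lemma uniform_gain_event:
  assumes \<delta>: "0 < \<delta>" "\<delta> \<le> 1" and R: "2 \<le> (real n / \<delta>)\<^sup>2" and m: "m \<ge> 1"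
    and mC: "200000000 * (1 / \<delta>)\<^sup>2 * (real n)\<^sup>2 * ln (1 / \<delta> * real n) \<le> real m"
  shows "\<exists>E \<in> sets (\<Pi>\<^sub>M j\<in>{..<m}. \<mu>). measure (\<Pi>\<^sub>M j\<in>{..<m}. \<mu>) E \<ge> 1 - exp (- real n) \<and>
    (\<forall>P\<in>E. \<forall>x\<in>usphere d. \<forall>y\<in>usphere d. \<delta>\<^sup>2 \<le> 1 - (norm (ip d x y))\<^sup>2 \<longrightarrow>
      0 < (\<Sum>j<m. sg (q d (P j) x) * (q d (P j) x - q d (P j) y)))"
proof -
  let ?M = "\<Pi>\<^sub>M j\<in>{..<m}. \<mu>"
  have Q: "prob_space ?M" by (rule prob_space_PiM) (rule prob_space_axioms)
  have n: "1 \<le> real n" using n_pos by simp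
  define \<epsilon> where "\<epsilon> = \<delta>\<^sup>2 / (8192 * (real n)\<^sup>2)"
  define \<eta> where "\<eta> = \<delta>\<^sup>2 / (32768 * (real n) ^ 3)"
  have \<epsilon>0: "0 < \<epsilon>" and \<eta>0: "0 < \<eta>" using \<delta> n by (simp_all add: \<epsilon>_def \<eta>_def)
  have \<eta>\<epsilon>: "\<eta> = \<epsilon> / (4 * real n)" by (simp add: \<eta>_def \<epsilon>_def power3_eq_cube power2_eq_square)
  \<comment> \<open>Net points are within \<open>\<epsilon> / 2\<close> of every unit vector, so the values of \<open>q\<close> change by at most \<open>\<epsilon>\<close>.\<close>
  have mesh: "real d * (2 * \<eta>\<^sup>2) \<le> (\<epsilon> / 2)\<^sup>2"
  proof -
    have "real d * (2 * \<eta>\<^sup>2) = \<epsilon>\<^sup>2 / 4 / real n"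
      using n by (simp add: \<eta>\<epsilon> d_eq power_divide power2_eq_square)
    also have "\<dots> \<le> \<epsilon>\<^sup>2 / 4 / 1" using n by (intro divide_left_mono) auto
    finally show ?thesis by (simp add: power_divide)
  qed
  have eps_small: "2 * \<epsilon> \<le> \<delta>\<^sup>2 / 4"
  proof -
    have "\<delta>\<^sup>2 / (4096 * (real n)\<^sup>2) \<le> \<delta>\<^sup>2 / 4" 
    proof (rule divide_left_mono)
      show "4 \<le> 4096 * (real n)\<^sup>2" using one_le_power[OF n, of 2] by linarith
    qed (use n_pos in auto)
    then show ?thesis by (simp add: \<epsilon>_def)
  qed
  obtain N :: "(nat \<Rightarrow> 'a) set" where N: "finite N" "N \<subseteq> usphere d" "real (card N) \<le> (2 / \<eta> + 3) ^ (2 * d)"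
    "\<And>x. x \<in> usphere d \<Longrightarrow> \<exists>y\<in>N. (nrm d (\<lambda>i. x i - y i))\<^sup>2 \<le> real d * (2 * \<eta>\<^sup>2)"
    using usphere_net[OF \<eta>0, of d, where 'a='a] by metis
  define Z where "Z = {z \<in> N \<times> N. \<delta>\<^sup>2 / 4 \<le> 1 - (norm (ip d (fst z) (snd z)))\<^sup>2}"
  define Bad where "Bad = (\<lambda>z. {\<omega> \<in> space ?M. (\<Sum>j<m. robust_gain d \<epsilon> (fst z) (snd z) (\<omega> j)) \<le> real m * (2 * \<epsilon>)})"
  define E where "E = space ?M - (\<Union>z\<in>Z. Bad z)"
  have finZ: "finite Z" unfolding Z_def using N(1) by (intro finite_Collect_conjI disjI1) auto
  have Bad_sets: "Bad z \<in> sets ?M" for z unfolding Bad_def by measurable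
  have E_sets: "E \<in> sets ?M" unfolding E_def by (intro sets.Diff sets.top sets.finite_UN finZ Bad_sets)
  have "measure ?M (\<Union>z\<in>Z. Bad z) \<le> (\<Sum>z\<in>Z. measure ?M (Bad z))"
    by (rule measure_UNION_le[OF finZ Bad_sets])
  also have "\<dots> \<le> (\<Sum>z\<in>Z. exp (- (real m * \<delta>\<^sup>2 / (524288 * real n))))"
  proof (rule sum_mono)
    fix z assume "z \<in> Z"
    then show "measure ?M (Bad z) \<le> exp (- (real m * \<delta>\<^sup>2 / (524288 * real n)))"
      unfolding Bad_def \<epsilon>_def using N(2) by (intro robust_gain_tail \<delta> m) (auto simp: Z_def)
  qed
  also have "\<dots> = real (card Z) * exp (- (real m * \<delta>\<^sup>2 / (524288 * real n)))" by simp
  also have "\<dots> \<le> ((2 / \<eta> + 3) ^ (2 * d))\<^sup>2 * exp (- (real m * \<delta>\<^sup>2 / (524288 * real n)))"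
  proof (rule mult_right_mono)
    have "card Z \<le> card (N \<times> N)" unfolding Z_def using N(1) by (intro card_mono) auto
    then have "real (card Z) \<le> real (card N) * real (card N)"
      by (metis card_cartesian_product of_nat_le_iff of_nat_mult)
    also have "\<dots> \<le> ((2 / \<eta> + 3) ^ (2 * d))\<^sup>2"
      unfolding power2_eq_square using N(3) \<eta>0 by (intro mult_mono) auto
    finally show "real (card Z) \<le> ((2 / \<eta> + 3) ^ (2 * d))\<^sup>2" .
  qed simp
  also have "\<dots> \<le> exp (- real n)"
    unfolding \<eta>_def by (rule net_size_bound[OF \<delta> R mC])
  finally have "measure ?M (\<Union>z\<in>Z. Bad z) \<le> exp (- real n)" .
  moreover have "measure ?M E = 1 - measure ?M (\<Union>z\<in>Z. Bad z)"
    unfolding E_def by (intro prob_space.prob_compl[OF Q] sets.finite_UN finZ Bad_sets)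
  ultimately have measE: "measure ?M E \<ge> 1 - exp (- real n)" by simp
  have "0 < (\<Sum>j<m. sg (q d (P j) x) * (q d (P j) x - q d (P j) y))"
    if P: "P \<in> E" and x: "x \<in> usphere d" and y: "y \<in> usphere d"
      and far: "\<delta>\<^sup>2 \<le> 1 - (norm (ip d x y))\<^sup>2" for P x y
  proof -
    have PP: "P j \<in> Proj n d" if "j < m" for j
      using P that by (auto simp: E_def space_PiM space_mu)
    obtain x0 where x0: "x0 \<in> N" "(nrm d (\<lambda>i. x i - x0 i))\<^sup>2 \<le> real d * (2 * \<eta>\<^sup>2)" using N(4)[OF x] by auto
    obtain y0 where y0: "y0 \<in> N" "(nrm d (\<lambda>i. y i - y0 i))\<^sup>2 \<le> real d * (2 * \<eta>\<^sup>2)" using N(4)[OF y] by auto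
    have u0: "x0 \<in> usphere d" "y0 \<in> usphere d" using x0 y0 N(2) by auto
    have dx: "nrm d (\<lambda>i. x i - x0 i) \<le> \<epsilon> / 2" and dy: "nrm d (\<lambda>i. y i - y0 i) \<le> \<epsilon> / 2"
      using order_trans[OF x0(2) mesh] order_trans[OF y0(2) mesh] \<epsilon>0 by (auto intro: power2_le_imp_le)
    have "(norm (ip d x0 y0))\<^sup>2 \<le> (norm (ip d x y))\<^sup>2 + 2 * (nrm d (\<lambda>i. x i - x0 i) + nrm d (\<lambda>i. y i - y0 i))"
      by (rule overlap_perturb[OF x y u0])
    moreover have "D / 4 \<le> 1 - a" if "a \<le> b + 2 * (t + t')" "t \<le> e / 2" "t' \<le> e / 2" "D \<le> 1 - b"
      "2 * e \<le> D / 4" "0 \<le> D" for a b t t' e D :: real using that by (simp add: field_simps)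
    ultimately have "\<delta>\<^sup>2 / 4 \<le> 1 - (norm (ip d x0 y0))\<^sup>2"
      using dx dy far eps_small zero_le_power2[of \<delta>] by blast
    then have "(x0, y0) \<in> Z" using x0 y0 by (simp add: Z_def)
    then have "P \<notin> Bad (x0, y0)" "P \<in> space ?M" using P by (auto simp: E_def)
    then have "real m * (2 * \<epsilon>) < (\<Sum>j<m. robust_gain d \<epsilon> x0 y0 (P j))" by (auto simp: Bad_def)
    then have "0 < (\<Sum>j<m. robust_gain d \<epsilon> x0 y0 (P j) - 2 * \<epsilon>)" by (simp add: sum_subtractf)
    also have "\<dots> \<le> (\<Sum>j<m. sg (q d (P j) x) * (q d (P j) x - q d (P j) y))"
    proof (rule sum_mono)
      fix j assume "j \<in> {..<m}"
      then have j: "P j \<in> Proj n d" using PP by simp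
      show "robust_gain d \<epsilon> x0 y0 (P j) - 2 * \<epsilon> \<le> sg (q d (P j) x) * (q d (P j) x - q d (P j) y)"
        using q_diff_le_dist[OF j x u0(1)] q_diff_le_dist[OF j y u0(2)] dx dy
        by (intro gain_ge_robust_gain) auto
    qed
    finally show ?thesis .
  qed
  then show ?thesis using E_sets measE by blast
qed

end

section \<open>The principal eigenspace program\<close>

lemma line_proj_mv: "i < d \<Longrightarrow> mv d (line_proj d x) v i = ip d v x * x i"
  by (simp add: mv_def ip_def sum_distrib_left mult_ac)

lemma mat_trace_mult_line_proj:
  assumes "A \<in> carrier_mat d d"
  shows "mat_trace (A * line_proj d x) = ip d (mv d A x) x"
proof -
  have "mat_trace (A * line_proj d x) = (\<Sum>i<d. \<Sum>j<d. A $$ (i, j) * (x j * cj (x i)))"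
    using assms unfolding mat_trace_def
    by (intro sum.cong) (auto simp: scalar_prod_def lessThan_atLeast0 line_proj_def)
  then show ?thesis by (simp add: ip_def mv_def sum_distrib_right mult.assoc)
qed

lemma mat_vec_mv: "A \<in> carrier_mat d d \<Longrightarrow> v \<in> carrier_vec d \<Longrightarrow> i < d \<Longrightarrow> (A *\<^sub>v v) $ i = mv d A (\<lambda>i. v $ i) i"
  by (simp add: mv_def scalar_prod_def lessThan_atLeast0)

lemma line_proj_feasible:
  assumes x: "x \<in> usphere d"
  shows "pep_feasible d (line_proj d x)"
  unfolding pep_feasible_def psd_def
proof (intro conjI ballI)
  show "line_proj d x \<in> carrier_mat d d" by simp
  show "mat_adjoint (line_proj d x) = line_proj d x"
    by (rule eq_matI) (auto simp: line_proj_def)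
  fix v :: "'a vec" assume v: "v \<in> carrier_vec d"
  have "(line_proj d x *\<^sub>v v) \<bullet>c v = ip d (\<lambda>i. ip d (\<lambda>i. v $ i) x * x i) (\<lambda>i. v $ i)"
  proof -
    have "(line_proj d x *\<^sub>v v) \<bullet>c v = (\<Sum>i<d. (line_proj d x *\<^sub>v v) $ i * cj (v $ i))"
      using v by (simp add: scalar_prod_def lessThan_atLeast0)
    then show ?thesis
      unfolding ip_def[of d "\<lambda>i. ip d (\<lambda>i. v $ i) x * x i"]
      using mat_vec_mv[OF line_proj_carrier v] line_proj_mv[of _ d x "\<lambda>i. v $ i"] by simp
  qed
  also have "\<dots> = ip d (\<lambda>i. v $ i) x * cj (ip d (\<lambda>i. v $ i) x)" by (simp add: ip_linear ip_commute)
  also have "\<dots> = of_real ((norm (ip d (\<lambda>i. v $ i) x))\<^sup>2)" by (rule mult_conjugate)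
  finally show "0 \<le> (line_proj d x *\<^sub>v v) \<bullet>c v"
    using of_real_le_iff'[of 0 "(norm (ip d (\<lambda>i. v $ i) x))\<^sup>2", where 'a='a] by simp
next
  have "mat_trace (line_proj d x) = ip d x x" by (simp add: mat_trace_def line_proj_def ip_def)
  then show "mat_trace (line_proj d x) \<le> 1" using x by (simp add: ip_self usphere_def)
qed

lemma mv_ip_refl_form: "2 * ip d (mv d P x) y = ip d x y + refl_form d P x y"
  by (simp add: refl_form_def)

lemma phi_line_proj:
  assumes P: "P \<in> Proj k d" and x: "x \<in> usphere d"
  shows "phi P (line_proj d x) = (if 0 \<le> q d P x then 1 else 0)"
proof -
  have "2 * mat_trace (P * line_proj d x) = of_real (1 + q d P x)"
    unfolding mat_trace_mult_line_proj[OF ProjD(1)[OF P]] mv_ip_refl_form refl_form_real[OF P]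
    using x by (simp add: ip_self usphere_def)
  then have "mat_trace (P * line_proj d x) = of_real ((1 + q d P x) / 2)"
    by (simp add: eq_divide_eq mult.commute)
  moreover have "(1 / 2 :: 'a) = of_real (1 / 2)" by simp
  ultimately have "1 / 2 \<le> mat_trace (P * line_proj d x) \<longleftrightarrow> 1 / 2 \<le> (1 + q d P x) / 2"
    by (simp only: of_real_le_iff')
  then show ?thesis by (simp add: phi_def)
qed

text \<open>
Each summand \<open>P\<close> or \<open>1 - P\<close> of the program's matrix equals \<open>(1 + sg (q d P x) * S) / 2\<close>, where \<open>S\<close> is the
reflection attached to \<open>P\<close>.
\<close>

lemma pep_matrix_form:
  assumes P: "\<And>j. j < m \<Longrightarrow> P j \<in> Proj k d" and x: "x \<in> usphere d"
  defines "Q \<equiv> pep_matrix d m P (Phi m P (line_proj d x))"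
  shows "ip d (mv d Q z) w
    = (1 / of_nat m) * (\<Sum>j<m. (ip d z w + of_real (sg (q d (P j) x)) * refl_form d (P j) z w) / 2)"
proof -
  let ?R = "\<lambda>j. if Phi m P (line_proj d x) j = 1 then P j else 1\<^sub>m d - P j"
  have one: "mv d (1\<^sub>m d - P j) z i = z i - mv d (P j) z i" if "i < d" "j < m" for i j
  proof -
    have "mv d (1\<^sub>m d - P j) z i = (\<Sum>l<d. (if i = l then z l else 0) - P j $$ (i, l) * z l)"
      unfolding mv_def using that ProjD(1)[OF P[OF that(2)]] by (intro sum.cong) (auto simp: algebra_simps)
    then show ?thesis using that by (simp add: sum_subtractf mv_def)
  qed
  have "ip d (mv d Q z) w = ip d (\<lambda>i. (1 / of_nat m) * (\<Sum>j<m. mv d (?R j) z i)) w"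
  proof (intro ip_cong refl)
    fix i assume i: "i < d"
    have "mv d Q z i = (\<Sum>l<d. (1 / of_nat m) * (\<Sum>j<m. ?R j $$ (i, l) * z l))"
      unfolding mv_def Q_def pep_matrix_def using i
      by (intro sum.cong refl) (simp add: sum_distrib_right)
    also have "\<dots> = (1 / of_nat m) * (\<Sum>j<m. mv d (?R j) z i)"
      unfolding mv_def sum_distrib_left[symmetric] by (subst sum.swap) (rule refl)
    finally show "mv d Q z i = (1 / of_nat m) * (\<Sum>j<m. mv d (?R j) z i)" .
  qed
  also have "\<dots> = (1 / of_nat m) * (\<Sum>j<m. ip d (mv d (?R j) z) w)"
    unfolding ip_scale_left ip_def sum_distrib_right by (subst sum.swap) (rule refl)
  also have "(\<Sum>j<m. ip d (mv d (?R j) z) w)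
    = (\<Sum>j<m. (ip d z w + of_real (sg (q d (P j) x)) * refl_form d (P j) z w) / 2)"
  proof (rule sum.cong[OF refl])
    fix j assume "j \<in> {..<m}"
    then have j: "j < m" by simp
    have b: "Phi m P (line_proj d x) j = (if 0 \<le> q d (P j) x then 1 else 0)"
      using j phi_line_proj[OF P[OF j] x] by (simp add: Phi_def)
    show "ip d (mv d (?R j) z) w = (ip d z w + of_real (sg (q d (P j) x)) * refl_form d (P j) z w) / 2"
    proof (cases "0 \<le> q d (P j) x")
      case True
      then show ?thesis using b by (simp add: sg_def flip: mv_ip_refl_form)
    next
      case False
      have "ip d (mv d (1\<^sub>m d - P j) z) w = ip d (\<lambda>i. z i - mv d (P j) z i) w"
        using one j by (intro ip_cong) auto
      also have "\<dots> = (ip d z w - refl_form d (P j) z w) / 2"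
        by (simp add: ip_linear refl_form_def)
      finally show ?thesis using b False by (simp add: sg_def)
    qed
  qed
  finally show ?thesis .
qed

lemma pep_matrix_carrier: "pep_matrix d m P b \<in> carrier_mat d d"
  by (simp add: pep_matrix_def)

text \<open>
The true line is a competitor in the program, so the solution must do at least as well.
\<close>

lemma pep_solution_gain:
  assumes P: "\<And>j. j < m \<Longrightarrow> P j \<in> Proj k d" and m: "m \<ge> 1" and x: "x \<in> usphere d" and y: "y \<in> usphere d"
    and sol: "pep_solution d m P (Phi m P (line_proj d x)) (line_proj d y)"
  shows "(\<Sum>j<m. sg (q d (P j) x) * (q d (P j) x - q d (P j) y)) \<le> 0"
proof -
  let ?Q = "pep_matrix d m P (Phi m P (line_proj d x))"
  have tr: "mat_trace (?Q * line_proj d z) = (of_real (1 / real m * (\<Sum>j<m. (1 + sg (q d (P j) x) * q d (P j) z) / 2)) :: 'a)"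
    if z: "z \<in> usphere d" for z
  proof -
    have "mat_trace (?Q * line_proj d z) = (1 / of_nat m) * (\<Sum>j<m. (ip d z z + of_real (sg (q d (P j) x)) * refl_form d (P j) z z) / 2)"
      unfolding mat_trace_mult_line_proj[OF pep_matrix_carrier] by (rule pep_matrix_form[OF P x])
    also have "(\<Sum>j<m. (ip d z z + of_real (sg (q d (P j) x)) * refl_form d (P j) z z) / 2)
      = (\<Sum>j<m. of_real ((1 + sg (q d (P j) x) * q d (P j) z) / 2))"
      using z refl_form_real[OF P] by (intro sum.cong) (auto simp: ip_self usphere_def)
    finally show ?thesis by simp
  qed
  have "mat_trace (?Q * line_proj d x) \<le> mat_trace (?Q * line_proj d y)"
    using sol line_proj_feasible[OF x] by (auto simp: pep_solution_def pep_maximizer_def Let_def)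
  then have "1 / real m * (\<Sum>j<m. (1 + sg (q d (P j) x) * q d (P j) x) / 2)
    \<le> 1 / real m * (\<Sum>j<m. (1 + sg (q d (P j) x) * q d (P j) y) / 2)"
    unfolding tr[OF x] tr[OF y] of_real_le_iff' .
  then have "(\<Sum>j<m. (1 + sg (q d (P j) x) * q d (P j) x) / 2) \<le> (\<Sum>j<m. (1 + sg (q d (P j) x) * q d (P j) y) / 2)"
    using m by (simp add: divide_le_cancel)
  then have "(\<Sum>j<m. sg (q d (P j) x) * q d (P j) x) \<le> (\<Sum>j<m. sg (q d (P j) x) * q d (P j) y)"
    by (simp add: sum.distrib flip: sum_divide_distrib)
  then show ?thesis by (simp add: right_diff_distrib sum_subtractf)
qed

text \<open>
The solution spans an eigenline of the program's matrix, hence of the signed sum of the reflections.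
\<close>

lemma pep_solution_eigen:
  assumes P: "\<And>j. j < m \<Longrightarrow> P j \<in> Proj k d" and m: "m \<ge> 1" and x: "x \<in> usphere d" and y: "y \<in> usphere d"
    and sol: "pep_solution d m P (Phi m P (line_proj d x)) (line_proj d y)"
  shows "\<exists>c. \<forall>z. (\<Sum>j<m. of_real (sg (q d (P j) x)) * refl_form d (P j) y z) = c * ip d y z"
proof -
  let ?Q = "pep_matrix d m P (Phi m P (line_proj d x))"
  obtain l where l: "\<And>v. v \<in> carrier_vec d \<Longrightarrow> ?Q *\<^sub>v (line_proj d y *\<^sub>v v) = l \<cdot>\<^sub>v (line_proj d y *\<^sub>v v)"
    using sol by (auto simp: pep_solution_def Let_def)
  have Yy: "line_proj d y *\<^sub>v vec d y = vec d y"
  proof (rule eq_vecI)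
    fix i assume "i < dim_vec (vec d y)"
    then have i: "i < d" by simp
    have "(line_proj d y *\<^sub>v vec d y) $ i = mv d (line_proj d y) (\<lambda>i. vec d y $ i) i"
      using i by (intro mat_vec_mv) auto
    also have "\<dots> = ip d (\<lambda>i. vec d y $ i) y * y i" by (rule line_proj_mv[OF i])
    also have "ip d (\<lambda>i. vec d y $ i) y = ip d y y" by (intro ip_cong) auto
    finally show "(line_proj d y *\<^sub>v vec d y) $ i = vec d y $ i" using i y by (simp add: ip_self usphere_def)
  qed (simp add: line_proj_def)
  have Qy: "mv d ?Q y i = l * y i" if i: "i < d" for i
  proof -
    have "mv d ?Q y i = mv d ?Q (\<lambda>i. vec d y $ i) i" by (intro fun_cong[OF mv_cong]) simp
    also have "\<dots> = (?Q *\<^sub>v vec d y) $ i" using i pep_matrix_carrier by (intro mat_vec_mv[symmetric]) auto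
    also have "\<dots> = l * y i" using l[of "vec d y"] i unfolding Yy by simp
    finally show ?thesis .
  qed
  have "(\<Sum>j<m. of_real (sg (q d (P j) x)) * refl_form d (P j) y z) = (2 * of_nat m * l - of_nat m) * ip d y z" for z
  proof -
    have "l * ip d y z = ip d (mv d ?Q y) z"
      using ip_cong[of d "mv d ?Q y" "\<lambda>i. l * y i" z z] Qy by (simp add: ip_linear)
    also have "\<dots> = (1 / of_nat m) * (\<Sum>j<m. (ip d y z + of_real (sg (q d (P j) x)) * refl_form d (P j) y z) / 2)"
      by (rule pep_matrix_form[OF P x])
    also have "\<dots> = (1 / of_nat m) * ((of_nat m * ip d y z + (\<Sum>j<m. of_real (sg (q d (P j) x)) * refl_form d (P j) y z)) / 2)"
      by (simp add: sum.distrib flip: sum_divide_distrib)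
    finally have "of_nat m * (2 * (l * ip d y z)) = of_nat m * ip d y z + (\<Sum>j<m. of_real (sg (q d (P j) x)) * refl_form d (P j) y z)"
      using m by simp
    then show ?thesis by (simp add: algebra_simps)
  qed
  then show ?thesis by blast
qed

section \<open>The planar case\<close>

text \<open>
In dimension two this completes a unit vector to an orthonormal basis.
\<close>

definition perp :: "(nat \<Rightarrow> 'a::rc_field) \<Rightarrow> nat \<Rightarrow> 'a" where
  "perp y = (\<lambda>i. if i = 0 then - cj (y 1) else cj (y 0))"

lemma sum_lessThan_2: "(\<Sum>i<2. f i) = f 0 + f (1::nat)"
  by (simp add: numeral_2_eq_2)

lemma unit_2:
  assumes "y \<in> usphere 2"
  shows "y 0 * cj (y 0) + y 1 * cj (y 1) = 1"
  using ip_self[of 2 y] usphereD[OF assms] by (simp add: ip_def sum_lessThan_2)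

lemma perp_decomp:
  assumes y: "y \<in> usphere 2" and i: "i < 2"
  shows "x i = ip 2 x y * y i + ip 2 x (perp y) * perp y i"
proof -
  note u = unit_2[OF y]
  have "x 0 * (y 0 * cj (y 0) + y 1 * cj (y 1)) = ip 2 x y * y 0 + ip 2 x (perp y) * perp y 0"
    "x 1 * (y 0 * cj (y 0) + y 1 * cj (y 1)) = ip 2 x y * y 1 + ip 2 x (perp y) * perp y 1"
    by (simp_all add: ip_def sum_lessThan_2 perp_def algebra_simps)
  then show ?thesis unfolding u using i by (auto simp: less_2_cases_iff)
qed

lemma perp_orthogonal: "ip 2 y (perp y) = 0"
  by (simp add: ip_def sum_lessThan_2 perp_def mult.commute)

lemma q_perp:
  assumes P: "P \<in> Proj 1 2" and y: "y \<in> usphere 2"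
  shows "q 2 P (perp y) = - q 2 P y"
proof -
  have tr: "refl_form 2 P (basis_vec 0) (basis_vec 0) + refl_form 2 P (basis_vec 1) (basis_vec 1) = 0"
  proof -
    have "q 2 P (basis_vec 0) + q 2 P (basis_vec 1) = 0"
      using q_trace[of P 1] P by (simp add: sum_lessThan_2)
    then show ?thesis unfolding refl_form_real[OF P] by (metis of_real_0 of_real_add)
  qed
  have "refl_form 2 P (perp y) (perp y) + refl_form 2 P y y
    = (y 0 * cj (y 0) + y 1 * cj (y 1)) *
      (refl_form 2 P (basis_vec 0) (basis_vec 0) + refl_form 2 P (basis_vec 1) (basis_vec 1))"
    by (subst (1 2) refl_form_expand) (simp add: sum_lessThan_2 perp_def algebra_simps)
  then have "refl_form 2 P (perp y) (perp y) + refl_form 2 P y y = 0" unfolding tr by simp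
  then have "of_real (q 2 P (perp y) + q 2 P y) = (0 :: 'a)" by (simp add: refl_form_real[OF P])
  then show ?thesis by (simp only: of_real_eq_0_iff)
qed

text \<open>
In the plane the signed sum \<open>D\<close> of the reflections is Hermitian with trace zero, so in the basis given by
its eigenvector \<open>y\<close> and \<open>perp y\<close> it is \<open>diag (K, -K)\<close>. The value of its form at \<open>x\<close> is nonnegative, as a
sum of absolute values, and equals \<open>K\<close> times the difference of the squared components of \<open>x\<close>. If
\<open>K > 0\<close>, the component along \<open>y\<close> is the larger one.
\<close>

lemma planar_overlap:
  fixes x y :: "nat \<Rightarrow> 'a::rc_field" and m :: nat
  assumes P: "\<And>j. j < m \<Longrightarrow> P j \<in> Proj 1 2" and x: "x \<in> usphere 2" and y: "y \<in> usphere 2"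
    and s: "\<And>j. j < m \<Longrightarrow> s j * q 2 (P j) x = \<bar>q 2 (P j) x\<bar>"
    and gain: "(\<Sum>j<m. s j * q 2 (P j) x) \<le> (\<Sum>j<m. s j * q 2 (P j) y)"
    and eigen: "\<And>z. (\<Sum>j<m. of_real (s j) * refl_form 2 (P j) y z) = c * ip 2 y z"
    and nondeg: "\<exists>k<2. \<exists>l<2. (\<Sum>j<m. of_real (s j) * refl_form 2 (P j) (basis_vec k) (basis_vec l)) \<noteq> 0"
  shows "1 / 2 \<le> (norm (ip 2 x y))\<^sup>2"
proof -
  define D where "D = (\<lambda>u v. \<Sum>j<m. of_real (s j) * refl_form 2 (P j) u v)"
  define K where "K = (\<Sum>j<m. s j * q 2 (P j) y)"
  have D_herm: "cj (D u v) = D v u" for u v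
    unfolding D_def cj_sum by (intro sum.cong) (auto simp: refl_form_hermitian[OF P])
  have D_diag: "D u u = of_real (\<Sum>j<m. s j * q 2 (P j) u)" for u
    unfolding D_def of_real_sum by (intro sum.cong) (auto simp: refl_form_real[OF P])
  have D_comb: "D (\<lambda>i. a * u i + b * v i) w = a * D u w + b * D v w" for a b u v w
    unfolding D_def refl_form_linear by (simp add: sum.distrib sum_distrib_left algebra_simps)
  have D_comb2: "D w (\<lambda>i. a * u i + b * v i) = cj a * D w u + cj b * D w v" for a b u v w
    unfolding D_def refl_form_linear by (simp add: sum.distrib sum_distrib_left algebra_simps)
  have D_cong: "D u v = D u' v'" if "\<And>i. i < 2 \<Longrightarrow> u i = u' i" "\<And>i. i < 2 \<Longrightarrow> v i = v' i" for u u' v v'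
    unfolding D_def by (intro sum.cong refl arg_cong2[of _ _ _ _ "(*)"] refl_form_cong that)
  let ?p = "perp y"
  have Dyp: "D y ?p = 0" using eigen[of ?p] by (simp add: D_def perp_orthogonal)
  then have Dpy: "D ?p y = 0" using D_herm[of y ?p] by simp
  have Dyy: "D y y = of_real K" by (simp add: D_diag K_def)
  have "(\<Sum>j<m. s j * q 2 (P j) ?p) = (\<Sum>j<m. - (s j * q 2 (P j) y))"
    by (intro sum.cong) (auto simp: q_perp[OF P y])
  then have Dpp: "D ?p ?p = of_real (- K)" by (simp add: D_diag K_def sum_negf)
  have dec: "D u v = of_real K * (ip 2 u y * cj (ip 2 v y) - ip 2 u ?p * cj (ip 2 v ?p))" for u v
  proof -
    have "D u v = D (\<lambda>i. ip 2 u y * y i + ip 2 u ?p * ?p i) (\<lambda>i. ip 2 v y * y i + ip 2 v ?p * ?p i)"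
      by (intro D_cong perp_decomp[OF y])
    then show ?thesis unfolding D_comb D_comb2 Dyp Dpy Dyy Dpp by (simp add: algebra_simps)
  qed
  have "K \<noteq> 0"
  proof
    assume "K = 0"
    then have "D u v = 0" for u v using dec by simp
    then show False using nondeg by (simp add: D_def)
  qed
  moreover have Kx: "0 \<le> (\<Sum>j<m. s j * q 2 (P j) x)" using s by (intro sum_nonneg) auto
  moreover have "(\<Sum>j<m. s j * q 2 (P j) x) \<le> K" using gain by (simp add: K_def)
  ultimately have K: "0 < K" by simp
  have "of_real (\<Sum>j<m. s j * q 2 (P j) x) = (of_real (K * ((norm (ip 2 x y))\<^sup>2 - (norm (ip 2 x ?p))\<^sup>2)) :: 'a)"
    unfolding D_diag[symmetric] dec mult_conjugate by simp
  then have "(\<Sum>j<m. s j * q 2 (P j) x) = K * ((norm (ip 2 x y))\<^sup>2 - (norm (ip 2 x ?p))\<^sup>2)"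
    by (simp only: of_real_eq_iff)
  then have "0 \<le> (norm (ip 2 x y))\<^sup>2 - (norm (ip 2 x ?p))\<^sup>2" using Kx K by (simp add: zero_le_mult_iff)
  moreover have "(norm (ip 2 x y))\<^sup>2 + (norm (ip 2 x ?p))\<^sup>2 = 1"
  proof -
    have "1 = ip 2 x x" using x by (simp add: ip_self usphere_def)
    also have "\<dots> = ip 2 (\<lambda>i. ip 2 x y * y i + ip 2 x ?p * ?p i) x"
      by (intro ip_cong perp_decomp[OF y] refl)
    also have "\<dots> = ip 2 x y * cj (ip 2 x y) + ip 2 x ?p * cj (ip 2 x ?p)"
      by (simp add: ip_linear ip_commute)
    also have "\<dots> = of_real ((norm (ip 2 x y))\<^sup>2 + (norm (ip 2 x ?p))\<^sup>2)"
      unfolding mult_conjugate by simp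
    finally show ?thesis by (metis of_real_1 of_real_eq_iff)
  qed
  moreover have "1 / 2 \<le> a" if "0 \<le> a - b" "a + b = 1" for a b :: real using that by simp
  ultimately show ?thesis by blast
qed

context uniform_projection
begin

text \<open>
For \<open>n = 1\<close> the condition \<open>q d P a = 1\<close> says that \<open>P\<close> projects onto the line through \<open>a\<close>. These events
have the same probability for all lines and are disjoint for different ones, and there are
infinitely many lines.
\<close>

lemma planar_no_atom:
  assumes n1: "n = 1" and a: "a \<in> usphere d"
  shows "prob {P \<in> space \<mu>. q d P a = 1} = 0"
proof -
  have d2: "d = 2" using n1 d_eq by simp
  define b :: "nat \<Rightarrow> nat \<Rightarrow> 'a" where
    "b = (\<lambda>k i. of_real (cos (1 / real (Suc k))) * basis_vec 0 i + of_real (sin (1 / real (Suc k))) * (1 * basis_vec 1 i))"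
  define S where "S = (\<lambda>k. {P \<in> space \<mu>. q d P (b k) = 1})"
  have b: "b k \<in> usphere d" for k
  proof -
    obtain P where "P \<in> space \<mu>" using not_empty by blast
    then show ?thesis unfolding b_def using d2 by (intro q_rotation(2)) (auto simp: space_mu)
  qed
  have qb: "q d P (b k) = cos (2 / real (Suc k)) * q0 P + sin (2 / real (Suc k)) * cross_re 1 P 1" if P: "P \<in> Proj n d" for P k
  proof -
    have "q0 P + q d P (basis_vec 1) = 0"
      using q_trace[of P n] P by (simp add: d_eq n1 sum_lessThan_2)
    then have "q d P (basis_vec 1) = - q0 P" by simp
    moreover have "q d P (b k) = (cos (1 / real (Suc k)))\<^sup>2 * q0 P + (sin (1 / real (Suc k)))\<^sup>2 * q d P (basis_vec 1)
      + 2 * sin (1 / real (Suc k)) * cos (1 / real (Suc k)) * cross_re 1 P 1"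
      unfolding b_def cross_re_def using d2 by (intro q_rotation(1)[OF P]) auto
    moreover have "2 / real (Suc k) = 2 * (1 / real (Suc k))" by simp
    moreover have "A = (C\<^sup>2 - S\<^sup>2) * a + (2 * S * C) * r"
      if "b = - a" "A = C\<^sup>2 * a + S\<^sup>2 * b + 2 * S * C * r" for A C S a b r :: real
      using that by (simp add: algebra_simps)
    ultimately show ?thesis by (simp only: cos_double sin_double)
  qed
  have cs: "(q0 P)\<^sup>2 + (cross_re 1 P 1)\<^sup>2 \<le> 1" if P: "P \<in> Proj n d" for P
  proof -
    have "norm (refl_form d P (basis_vec 0) (basis_vec 0)) = \<bar>q0 P\<bar>" unfolding refl_form_real[OF P] by simp
    then have "(q0 P)\<^sup>2 + (norm (refl_form d P (basis_vec 0) (basis_vec 1)))\<^sup>2 = 1"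
      using refl_form_row_norm[OF P basis_vec_unit[OF d_pos]] by (simp add: d2 sum_lessThan_2)
    moreover have "\<bar>cross_re 1 P 1\<bar>\<^sup>2 \<le> (norm (refl_form d P (basis_vec 0) (basis_vec 1)))\<^sup>2"
      unfolding cross_re_def by (intro power_mono) (simp_all add: abs_re_le)
    ultimately show ?thesis by simp
  qed
  have disj: "S k \<inter> S l = {}" if "k \<noteq> l" for k l
  proof (rule ccontr)
    assume "S k \<inter> S l \<noteq> {}"
    then obtain P where P: "P \<in> Proj n d" "q d P (b k) = 1" "q d P (b l) = 1"
      by (auto simp: S_def space_mu)
    \<comment> \<open>A vector in the unit disc whose inner product with a unit vector is \<open>1\<close> equals that vector.\<close>
    have angle: "q0 P = cos t \<and> cross_re 1 P 1 = sin t" if "cos t * q0 P + sin t * cross_re 1 P 1 = 1" for t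
    proof -
      have "(q0 P - cos t)\<^sup>2 + (cross_re 1 P 1 - sin t)\<^sup>2
        = (q0 P)\<^sup>2 + (cross_re 1 P 1)\<^sup>2 + ((cos t)\<^sup>2 + (sin t)\<^sup>2) - 2 * (cos t * q0 P + sin t * cross_re 1 P 1)"
        by (simp add: power2_eq_square algebra_simps)
      also have "\<dots> \<le> 0" unfolding that using cs[OF P(1)] by simp
      finally show ?thesis by (simp add: sum_power2_le_zero_iff)
    qed
    have "q0 P = cos (2 / real (Suc k))" "q0 P = cos (2 / real (Suc l))"
      using angle[of "2 / real (Suc k)"] angle[of "2 / real (Suc l)"] P(2,3) qb[OF P(1)] by auto
    then have cos_eq: "cos (2 / real (Suc k)) = cos (2 / real (Suc l))" by simp
    have le_pi: "2 / real (Suc i) \<le> pi" for i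
    proof (rule order_trans[of _ "2 / 1"])
      show "2 / real (Suc i) \<le> 2 / 1" by (intro divide_left_mono) auto
      show "2 / 1 \<le> pi" using pi_ge_two by simp
    qed
    have "2 / real (Suc k) = 2 / real (Suc l)"
      by (rule cos_inj_pi[OF _ le_pi _ le_pi cos_eq]) auto
    then show False using that by simp
  qed
  define p where "p = prob {P \<in> space \<mu>. q d P a = 1}"
  have S_sets: "S k \<in> sets \<mu>" for k unfolding S_def by measurable
  have pS: "prob (S k) = p" for k
  proof -
    have ind: "expectation (\<lambda>P. indicator {1} (q d P x)) = prob {P \<in> space \<mu>. q d P x = 1}" for x
    proof -
      have "expectation (\<lambda>P. indicator {1} (q d P x) :: real) = expectation (indicator {P \<in> space \<mu>. q d P x = 1})"
        by (intro Bochner_Integration.integral_cong) (auto simp: indicator_def)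
      then show ?thesis by simp
    qed
    have "prob (S k) = expectation (\<lambda>P. indicator {1} (q d P (b k)))" by (simp add: S_def ind)
    also have "\<dots> = expectation (\<lambda>P. indicator {1} (q d P a))"
      by (rule expectation_q_transport[OF b a]) simp
    also have "\<dots> = p" by (simp add: p_def ind)
    finally show ?thesis .
  qed
  have "real K * p \<le> 1" for K
  proof -
    have "real K * p = (\<Sum>k<K. prob (S k))" by (simp add: pS)
    also have "\<dots> = prob (\<Union>k<K. S k)"
      using S_sets disj by (intro finite_measure_finite_Union[symmetric]) (auto simp: disjoint_family_on_def)
    finally show ?thesis by simp
  qed
  then have "p \<le> 0" using reals_Archimedean3[of p] by (metis not_le mult.commute)
  then show ?thesis using measure_nonneg[of \<mu>] by (simp add: p_def order_antisym)
qed

lemma planar_no_atom_form: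
  assumes n1: "n = 1"
  shows "emeasure \<mu> {P \<in> space \<mu>. \<forall>k<2. \<forall>l<2. refl_form d P (basis_vec k) (basis_vec l) = A k l} = 0"
proof (cases "{P \<in> space \<mu>. \<forall>k<2. \<forall>l<2. refl_form d P (basis_vec k) (basis_vec l) = A k l} = {}")
  case False
  have d2: "d = 2" using n1 d_eq by simp
  obtain P0 where P0: "P0 \<in> Proj n d" "\<forall>k<2. \<forall>l<2. refl_form d P0 (basis_vec k) (basis_vec l) = A k l"
    using False by (auto simp: space_mu)
  obtain a where a: "a \<in> usphere d" "P0 = line_proj d a"
    using Proj_1_obtain_unit[of P0 d] P0(1) n1 by auto
  have "q d P a = 1" if P: "\<forall>k<2. \<forall>l<2. refl_form d P (basis_vec k) (basis_vec l) = A k l" for P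
  proof -
    have "refl_form d P a a = refl_form d P0 a a"
      by (subst (1 2) refl_form_expand) (use P P0(2) d2 in auto)
    also have "\<dots> = 1"
    proof -
      have "ip d (mv d P0 a) a = ip d (\<lambda>i. ip d a a * a i) a"
        unfolding a(2) by (intro ip_cong line_proj_mv refl)
      then show ?thesis using a(1) by (simp add: refl_form_def ip_linear ip_self usphere_def)
    qed
    finally show ?thesis by (simp add: q_def)
  qed
  then have "{P \<in> space \<mu>. \<forall>k<2. \<forall>l<2. refl_form d P (basis_vec k) (basis_vec l) = A k l} \<subseteq> {P \<in> space \<mu>. q d P a = 1}"
    by auto
  then have "emeasure \<mu> {P \<in> space \<mu>. \<forall>k<2. \<forall>l<2. refl_form d P (basis_vec k) (basis_vec l) = A k l}
    \<le> emeasure \<mu> {P \<in> space \<mu>. q d P a = 1}" by (intro emeasure_mono) measurable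
  also have "\<dots> = 0" using planar_no_atom[OF n1 a(1)] by (simp add: emeasure_eq_measure)
  finally show ?thesis by simp
qed (simp only: emeasure_empty)

text \<open>
If a signed sum of the reflections vanishes, the first reflection is determined by the others. As the
distribution has no atoms, this has probability zero by Fubini's theorem, for each of the finitely
many choices of signs.
\<close>

lemma planar_nondegenerate:
  fixes m :: nat
  assumes n1: "n = 1" and m: "m \<ge> 1"
  shows "\<exists>E \<in> sets (\<Pi>\<^sub>M j\<in>{..<m}. \<mu>). measure (\<Pi>\<^sub>M j\<in>{..<m}. \<mu>) E = 1 \<and>
    (\<forall>P\<in>E. \<forall>s. (\<forall>j<m. s j = 1 \<or> s j = (-1::real)) \<longrightarrow>
      (\<exists>k<2. \<exists>l<2. (\<Sum>j<m. of_real (s j) * refl_form d (P j) (basis_vec k) (basis_vec l)) \<noteq> 0))"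
proof -
  let ?M = "\<Pi>\<^sub>M j\<in>{..<m}. \<mu>"
  have Q: "prob_space ?M" by (rule prob_space_PiM) (rule prob_space_axioms)
  define T where "T = (\<lambda>(s :: nat \<Rightarrow> real) (P :: nat \<Rightarrow> 'a mat) k l. \<Sum>j<m. of_real (s j) * refl_form d (P j) (basis_vec k) (basis_vec l))"
  define Bad where "Bad = (\<lambda>s. {P \<in> space ?M. \<forall>k<2. \<forall>l<2. T s P k l = 0})"
  define \<Sigma> where "\<Sigma> = (\<Pi>\<^sub>E j\<in>{..<m}. {1, -1 :: real})"
  have fin\<Sigma>: "finite \<Sigma>" unfolding \<Sigma>_def by (intro finite_PiE) auto
  have T_meas [measurable]: "(\<lambda>P. T s P k l) \<in> borel_measurable ?M" for s k l
  proof -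
    have "(\<lambda>P. refl_form d (P j) (basis_vec k) (basis_vec l)) \<in> borel_measurable ?M" if "j < m" for j
      by (rule measurable_compose[where f = "\<lambda>P. P j" and N = \<mu>, OF measurable_component_singleton refl_form_measurable])
         (use that in simp)
    then show ?thesis unfolding T_def
      by (intro borel_measurable_sum borel_measurable_times borel_measurable_const) auto
  qed
  have Bad_sets: "Bad s \<in> sets ?M" for s unfolding Bad_def by measurable
  have Bad_null: "emeasure ?M (Bad s) = 0" if s: "s \<in> \<Sigma>" for s
  proof -
    have I: "{..<m} = insert 0 {1..<m}" using m by auto
    interpret product_sigma_finite "\<lambda>_::nat. \<mu>"
      by standard
    have s0: "s 0 = 1 \<or> s 0 = -1" using s m by (auto simp: \<Sigma>_def PiE_def Pi_def)
    have inner: "(\<integral>\<^sup>+ y. indicator (Bad s) (x(0 := y)) \<partial>\<mu>) = 0" for x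
    proof -
      \<comment> \<open>The value that the first reflection must have; \<open>s 0\<close> is its own inverse.\<close>
      define A where "A = (\<lambda>k l. - of_real (s 0) * (\<Sum>j\<in>{1..<m}. of_real (s j) * refl_form d (x j) (basis_vec k) (basis_vec l)))"
      let ?N = "{y \<in> space \<mu>. \<forall>k<2. \<forall>l<2. refl_form d y (basis_vec k) (basis_vec l) = A k l}"
      have "indicator (Bad s) (x(0 := y)) \<le> (indicator ?N y :: ennreal)" if y: "y \<in> space \<mu>" for y
      proof (cases "x(0 := y) \<in> Bad s")
        case True
        have "refl_form d y (basis_vec k) (basis_vec l) = A k l" if "k < 2" "l < 2" for k l
        proof -
          have "T s (x(0 := y)) k l = 0" using True that by (auto simp: Bad_def)
          then have "of_real (s 0) * refl_form d y (basis_vec k) (basis_vec l)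
             + (\<Sum>j\<in>{1..<m}. of_real (s j) * refl_form d (x j) (basis_vec k) (basis_vec l)) = 0"
            unfolding T_def I by simp
          then have "of_real (s 0) * refl_form d y (basis_vec k) (basis_vec l)
             = - (\<Sum>j\<in>{1..<m}. of_real (s j) * refl_form d (x j) (basis_vec k) (basis_vec l))"
            by (simp add: add_eq_0_iff2)
          then show ?thesis using s0 by (auto simp: A_def)
        qed
        then show ?thesis using y by (simp add: indicator_def)
      qed simp
      then have "(\<integral>\<^sup>+ y. indicator (Bad s) (x(0 := y)) \<partial>\<mu>) \<le> (\<integral>\<^sup>+ y. indicator ?N y \<partial>\<mu>)"
        by (rule nn_integral_mono)
      also have "\<dots> = emeasure \<mu> ?N" by (rule nn_integral_indicator) measurable
      also have "\<dots> = 0" by (rule planar_no_atom_form[OF n1])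
      finally show ?thesis by simp
    qed
    have "emeasure ?M (Bad s) = (\<integral>\<^sup>+ P. indicator (Bad s) P \<partial>?M)" using Bad_sets by simp
    also have "\<dots> = (\<integral>\<^sup>+ x. (\<integral>\<^sup>+ y. indicator (Bad s) (x(0 := y)) \<partial>\<mu>) \<partial>(\<Pi>\<^sub>M j\<in>{1..<m}. \<mu>))"
      unfolding I using Bad_sets[of s] unfolding I by (intro product_nn_integral_insert) auto
    also have "\<dots> = 0" unfolding inner by simp
    finally show ?thesis .
  qed
  define E where "E = space ?M - (\<Union>s\<in>\<Sigma>. Bad s)"
  have "emeasure ?M (\<Union>s\<in>\<Sigma>. Bad s) = 0"
    using null_sets_UN'[OF countable_finite[OF fin\<Sigma>], of Bad ?M] Bad_null Bad_sets by (auto simp: null_sets_def)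
  then have "measure ?M (\<Union>s\<in>\<Sigma>. Bad s) = 0" by (simp add: measure_def)
  then have "measure ?M E = 1"
    unfolding E_def by (subst prob_space.prob_compl[OF Q]) (auto intro: sets.finite_UN fin\<Sigma> Bad_sets)
  moreover have "E \<in> sets ?M" unfolding E_def by (intro sets.Diff sets.top sets.finite_UN fin\<Sigma> Bad_sets)
  moreover have "\<exists>k<2. \<exists>l<2. T s P k l \<noteq> 0" if P: "P \<in> E" and s: "\<forall>j<m. s j = 1 \<or> s j = -1" for P s
  proof -
    \<comment> \<open>Cutting the signs off outside of the index range leaves finitely many choices.\<close>
    define s' where "s' = restrict s {..<m}"
    have "s' \<in> \<Sigma>" using s by (auto simp: s'_def \<Sigma>_def)
    then have "P \<notin> Bad s'" "P \<in> space ?M" using P by (auto simp: E_def)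
    then obtain k l where "k < 2" "l < 2" "T s' P k l \<noteq> 0" by (auto simp: Bad_def)
    moreover have "T s' P k l = T s P k l" unfolding T_def by (intro sum.cong) (auto simp: s'_def)
    ultimately show ?thesis by auto
  qed
  ultimately show ?thesis unfolding T_def by blast
qed

section \<open>Recovery\<close>

text \<open>
The union bound covers the case in which \<open>ln (n / \<delta>)\<close> is bounded away from zero. What remains is the case
\<open>\<delta> > 1\<close>, which exceeds the distance of any two lines, and the case \<open>n = 1\<close> with \<open>\<delta>\<^sup>2 > 1 / 2\<close>. In the latter
the hypothesis on \<open>m\<close> is nearly void, but in the plane the squared overlap is at least one half
almost surely, whatever \<open>m\<close> is.
\<close>

lemma recovery_event:
  assumes \<delta>: "0 < \<delta>" and m: "1 \<le> m"
    and mC: "200000000 * (1 / \<delta>) ^ 2 * real n ^ 2 * ln ((1 / \<delta>) * real n) \<le> real m"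
  shows "\<exists>E \<in> sets (\<Pi>\<^sub>M j \<in> {..<m}. \<mu>).
    measure (\<Pi>\<^sub>M j \<in> {..<m}. \<mu>) E \<ge> 1 - exp (- real n) \<and>
    (\<forall>P \<in> E. \<forall>X \<in> Proj 1 d. \<forall>Xhat.
      pep_solution d m P (Phi m P X) Xhat \<longrightarrow> op_norm (Xhat - X) < \<delta>)"
proof -
  let ?M = "\<Pi>\<^sub>M j\<in>{..<m}. \<mu>"
  define good where "good = (\<lambda>P :: nat \<Rightarrow> 'a mat. \<forall>x\<in>usphere d. \<forall>y\<in>usphere d.
    pep_solution d m P (Phi m P (line_proj d x)) (line_proj d y) \<longrightarrow> sqrt (1 - (norm (ip d x y))\<^sup>2) < \<delta>)"
  have "\<exists>E \<in> sets ?M. measure ?M E \<ge> 1 - exp (- real n) \<and> (\<forall>P\<in>E. good P)"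
  proof -
    have space_Proj: "P j \<in> Proj n d" if "P \<in> space ?M" "j < m" for P j
      using that by (auto simp: space_PiM space_mu)
    have sub: "P \<in> space ?M" if "P \<in> E" "E \<in> sets ?M" for P E
      using sets.sets_into_space[OF that(2)] that(1) by auto
    consider "1 < \<delta>" | "\<delta> \<le> 1" "2 \<le> (real n / \<delta>)\<^sup>2" | "\<delta> \<le> 1" "(real n / \<delta>)\<^sup>2 < 2" by linarith
    then show ?thesis
    proof cases
      case 1
      have "sqrt (1 - (norm (ip d x y))\<^sup>2) \<le> 1" for x y :: "nat \<Rightarrow> 'a" by simp
      then have "good P" for P unfolding good_def using 1 by (meson le_less_trans)
      moreover have "measure ?M (space ?M) = 1"
        by (rule prob_space.prob_space, rule prob_space_PiM, rule prob_space_axioms)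
      ultimately show ?thesis by (intro bexI[of _ "space ?M"]) auto
    next
      case 2
      obtain E where E: "E \<in> sets ?M" "measure ?M E \<ge> 1 - exp (- real n)"
        "\<And>P x y. P \<in> E \<Longrightarrow> x \<in> usphere d \<Longrightarrow> y \<in> usphere d \<Longrightarrow> \<delta>\<^sup>2 \<le> 1 - (norm (ip d x y))\<^sup>2 \<Longrightarrow>
          0 < (\<Sum>j<m. sg (q d (P j) x) * (q d (P j) x - q d (P j) y))"
        using uniform_gain_event[OF \<delta> 2 m mC] by blast
      have "good P" if P: "P \<in> E" for P
        unfolding good_def
      proof (intro ballI impI)
        fix x y :: "nat \<Rightarrow> 'a"
        assume x: "x \<in> usphere d" and y: "y \<in> usphere d"
          and sol: "pep_solution d m P (Phi m P (line_proj d x)) (line_proj d y)"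
        have "(\<Sum>j<m. sg (q d (P j) x) * (q d (P j) x - q d (P j) y)) \<le> 0"
          by (rule pep_solution_gain[OF space_Proj[OF sub[OF P E(1)]] m x y sol])
        then have "1 - (norm (ip d x y))\<^sup>2 < \<delta>\<^sup>2" using E(3)[OF P x y] by linarith
        then show "sqrt (1 - (norm (ip d x y))\<^sup>2) < \<delta>" using \<delta> by (intro real_less_lsqrt) auto
      qed
      then show ?thesis using E by blast
    next
      case 3
      have n1: "n = 1"
      proof (rule ccontr)
        assume "n \<noteq> 1"
        then have "2 \<le> real n" using n_pos by simp
        then have "2 \<le> real n / \<delta>" using 3(1) \<delta> by (simp add: field_simps)
        then have "2\<^sup>2 \<le> (real n / \<delta>)\<^sup>2" by (intro power_mono) auto
        then show False using 3(2) by simp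
      qed
      then have d2: "d = 2" using d_eq by simp
      have half: "1 / 2 < \<delta>\<^sup>2" using 3(2) \<delta> n1 by (simp add: power_divide field_simps)
      obtain E where E: "E \<in> sets ?M" "measure ?M E = 1"
        "\<And>P s. P \<in> E \<Longrightarrow> (\<And>j. j < m \<Longrightarrow> s j = 1 \<or> s j = (-1::real)) \<Longrightarrow>
          \<exists>k<2. \<exists>l<2. (\<Sum>j<m. of_real (s j) * refl_form d (P j) (basis_vec k) (basis_vec l)) \<noteq> 0"
        using planar_nondegenerate[OF n1 m] by blast
      have "good P" if P: "P \<in> E" for P
        unfolding good_def
      proof (intro ballI impI)
        fix x y :: "nat \<Rightarrow> 'a"
        assume x: "x \<in> usphere d" and y: "y \<in> usphere d"
          and sol: "pep_solution d m P (Phi m P (line_proj d x)) (line_proj d y)"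
        note PP = space_Proj[OF sub[OF P E(1)]]
        have "(\<Sum>j<m. sg (q d (P j) x) * (q d (P j) x - q d (P j) y)) \<le> 0"
          by (rule pep_solution_gain[OF PP m x y sol])
        then have gain: "(\<Sum>j<m. sg (q d (P j) x) * q d (P j) x) \<le> (\<Sum>j<m. sg (q d (P j) x) * q d (P j) y)"
          by (simp add: right_diff_distrib sum_subtractf)
        obtain c where c: "\<And>z. (\<Sum>j<m. of_real (sg (q d (P j) x)) * refl_form d (P j) y z) = c * ip d y z"
          using pep_solution_eigen[OF PP m x y sol] by blast
        have "1 / 2 \<le> (norm (ip 2 x y))\<^sup>2"
        proof (rule planar_overlap[where s = "\<lambda>j. sg (q 2 (P j) x)" and c = c])
          show "P j \<in> Proj 1 2" if "j < m" for j using PP[OF that] by (simp add: n1 d2)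
          show "\<exists>k<2. \<exists>l<2. (\<Sum>j<m. of_real (sg (q 2 (P j) x)) * refl_form 2 (P j) (basis_vec k) (basis_vec l)) \<noteq> 0"
            using E(3)[OF P, of "\<lambda>j. sg (q d (P j) x)"] sg_simps(3) by (simp add: d2)
        qed (use x y gain c in \<open>auto simp: d2 sg_simps\<close>)
        then have "1 - (norm (ip d x y))\<^sup>2 < \<delta>\<^sup>2" using half by (simp add: d2)
        then show "sqrt (1 - (norm (ip d x y))\<^sup>2) < \<delta>" using \<delta> by (intro real_less_lsqrt) auto
      qed
      moreover have "1 - exp (- real n) \<le> measure ?M E" using E(2) by simp
      ultimately show ?thesis using E(1) by blast
    qed
  qed
  then obtain E where E: "E \<in> sets ?M" "measure ?M E \<ge> 1 - exp (- real n)" "\<And>P. P \<in> E \<Longrightarrow> good P" by blast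
  have "op_norm (Xhat - X) < \<delta>"
    if P: "P \<in> E" and X: "X \<in> Proj 1 d" and sol: "pep_solution d m P (Phi m P X) Xhat" for P X Xhat
  proof -
    obtain x where x: "x \<in> usphere d" "X = line_proj d x" using Proj_1_obtain_unit[OF X] .
    have "Xhat \<in> Proj 1 d" using sol by (simp add: pep_solution_def Let_def)
    then obtain y where y: "y \<in> usphere d" "Xhat = line_proj d y" using Proj_1_obtain_unit by blast
    have "op_norm (Xhat - X) \<le> sqrt (1 - (norm (ip d y x))\<^sup>2)"
      unfolding x(2) y(2) by (rule op_norm_line_diff[OF x(1) y(1)])
    also have "norm (ip d y x) = norm (ip d x y)" by (metis ip_commute norm_cj)
    also have "sqrt (1 - (norm (ip d x y))\<^sup>2) < \<delta>"
      using E(3)[OF P] x y sol unfolding good_def by blast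
    finally show ?thesis .
  qed
  then show ?thesis using E(1,2) by blast
qed

end

theorem corollary3p3p2:
  shows "\<exists>C::real. C > 0 \<and>
    (\<forall>(n::nat) (\<delta>::real) (m::nat).
      n \<ge> 1 \<longrightarrow> \<delta> > 0 \<longrightarrow> m \<ge> 1 \<longrightarrow>
      real m \<ge> C * (1 / \<delta>) ^ 2 * real n ^ 2 * ln ((1 / \<delta>) * real n) \<longrightarrow>
      (\<forall>\<mu> :: real mat measure. uniform_Proj n (2 * n) \<mu> \<longrightarrow>
        (\<exists>E \<in> sets (\<Pi>\<^sub>M j \<in> {..<m}. \<mu>).
          measure (\<Pi>\<^sub>M j \<in> {..<m}. \<mu>) E \<ge> 1 - exp (- real n) \<and>
          (\<forall>P \<in> E. \<forall>X \<in> Proj 1 (2 * n). \<forall>Xhat.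
            pep_solution (2 * n) m P (Phi m P X) Xhat \<longrightarrow> op_norm (Xhat - X) < \<delta>))) \<and>
      (\<forall>\<mu> :: complex mat measure. uniform_Proj n (2 * n) \<mu> \<longrightarrow>
        (\<exists>E \<in> sets (\<Pi>\<^sub>M j \<in> {..<m}. \<mu>).
          measure (\<Pi>\<^sub>M j \<in> {..<m}. \<mu>) E \<ge> 1 - exp (- real n) \<and>
          (\<forall>P \<in> E. \<forall>X \<in> Proj 1 (2 * n). \<forall>Xhat.
            pep_solution (2 * n) m P (Phi m P X) Xhat \<longrightarrow> op_norm (Xhat - X) < \<delta>))))"
proof (intro exI[of _ 200000000] conjI allI impI)
  fix n m :: nat and \<delta> :: real
  assume A: "n \<ge> 1" "\<delta> > 0" "m \<ge> 1"
    "real m \<ge> 200000000 * (1 / \<delta>) ^ 2 * real n ^ 2 * ln ((1 / \<delta>) * real n)"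
  show "\<exists>E \<in> sets (\<Pi>\<^sub>M j \<in> {..<m}. \<mu>).
      measure (\<Pi>\<^sub>M j \<in> {..<m}. \<mu>) E \<ge> 1 - exp (- real n) \<and>
      (\<forall>P \<in> E. \<forall>X \<in> Proj 1 (2 * n). \<forall>Xhat.
        pep_solution (2 * n) m P (Phi m P X) Xhat \<longrightarrow> op_norm (Xhat - X) < \<delta>)"
    if "uniform_Proj n (2 * n) \<mu>" for \<mu> :: "real mat measure"
    using A that by (intro uniform_projection.recovery_event uniform_projection.intro) auto
  show "\<exists>E \<in> sets (\<Pi>\<^sub>M j \<in> {..<m}. \<mu>).
      measure (\<Pi>\<^sub>M j \<in> {..<m}. \<mu>) E \<ge> 1 - exp (- real n) \<and>
      (\<forall>P \<in> E. \<forall>X \<in> Proj 1 (2 * n). \<forall>Xhat.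
        pep_solution (2 * n) m P (Phi m P X) Xhat \<longrightarrow> op_norm (Xhat - X) < \<delta>)"
    if "uniform_Proj n (2 * n) \<mu>" for \<mu> :: "complex mat measure"
    using A that by (intro uniform_projection.recovery_event uniform_projection.intro) auto
qed simp

end
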